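(* Let $\Omega$ be a bounded Lipschitz domain in $\mathbb{R}^n$, $n\ge2$, and let $Q>0$ be a constant such that $$Q\,P_\Omega(E)\ \ge\ \min\big(|E|,|\Omega\setminus E|\big)^{1-1/n}\qquad\text{for every measurable } E\subseteq\Omega .$$ Let $u\in H^{1,2}(\Omega)$ (real valued, possibly of changing sign). Then $\tilde u\in H^{1,2}_{\mathrm{loc}}(\tilde\Omega)$ and, for any $\epsilon>0$ (with $\epsilon<|\Omega|$), $$\int_{\tilde\Omega_\epsilon}|D\tilde u|^2\,dx\ \le\ c(\epsilon)\,\big(Q\,n\,c_n^{1/n}\big)^2\int_\Omega|Du|^2\,dx ,$$ where $\tilde\Omega_\epsilon$ is the ball centred at the origin with measure $|\Omega|-\epsilon$ and $$c(\epsilon)=\left(\frac{|\Omega|-\epsilon}{\epsilon}\right)^{2-2/n}\ \text{ if }\ \epsilon\le\frac{|\Omega|}{2},\qquad c(\epsilon)=1\ \text{ otherwise.}$$ Moreover, $u^*$ is absolutely continuous on $(\epsilon,|\Omega|-\epsilon)$ for every $\epsilon\in(0,|\Omega|/2)$.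
   Context: $|\cdot|$ denotes Lebesgue measure of sets, $c_n$ is the measure of the unit ball of $\mathbb{R}^n$, and $D$ denotes the gradient. $P_\Omega(E)$ is the De Giorgi perimeter of $E$ relative to $\Omega$; a constant $Q$ as in the claim exists for every bounded Lipschitz domain. For a real measurable function $u$ on $\Omega$ (possibly of changing sign): the distribution function is $\mu(t)=|\{x\in\Omega:u(x)>t\}|$, $t\in\mathbb{R}$; the decreasing rearrangement is $u^*(s)=\inf\{t\in\mathbb{R}:\mu(t)\le s\}$, $s\in[0,|\Omega|]$; the Schwarz symmetrization is $\tilde u(x)=u^*(c_n|x|^n)$, $x\in\tilde\Omega$, where $\tilde\Omega$ is the (open) ball centred at the origin with the same measure as $\Omega$. Thus $u^*$ and $\tilde u$ are rearrangements of $u$ itself, not of $|u|$. *)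

theory Defs
  imports "HOL-Analysis.Analysis"
begin

section \<open>Bounded Lipschitz domains\<close>

text \<open>
  Near each boundary point, after a rigid motion, \<open>\<Omega>\<close> is the strict epigraph of a Lipschitz
  function of \<open>n - 1\<close> variables.  The rotation is encoded by the unit vector \<open>e\<close> (the new last
  coordinate direction); the remaining variables range over the hyperplane orthogonal to \<open>e\<close>.
\<close>

definition bounded_lipschitz_domain :: "'a::euclidean_space set \<Rightarrow> bool" where
  "bounded_lipschitz_domain \<Omega> \<longleftrightarrow>
     open \<Omega> \<and> connected \<Omega> \<and> \<Omega> \<noteq> {} \<and> bounded \<Omega> \<and>
     (\<forall>p\<in>frontier \<Omega>. \<exists>e r L \<gamma>. norm e = 1 \<and> r > 0 \<and>
        L-lipschitz_on {y. y \<bullet> e = 0} (\<gamma> :: 'a \<Rightarrow> real) \<and>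
        \<Omega> \<inter> ball p r = {x \<in> ball p r. x \<bullet> e > \<gamma> (x - (x \<bullet> e) *\<^sub>R e)})"

section \<open>Compactly supported \<open>C\<^sup>1\<close> functions and the relative perimeter\<close>

text \<open>
  Elements of \<open>C\<^sup>1\<^sub>c(\<Omega>)\<close> are represented by their extension by zero to the whole space.
\<close>

definition C1c :: "'a::euclidean_space set \<Rightarrow> ('a \<Rightarrow> 'b::real_normed_vector) \<Rightarrow> bool" where
  "C1c \<Omega> \<phi> \<longleftrightarrow>
     (\<forall>x. \<phi> differentiable (at x)) \<and>
     (\<forall>h. continuous_on UNIV (\<lambda>x. frechet_derivative \<phi> (at x) h)) \<and>
     compact (closure {x. \<phi> x \<noteq> 0}) \<and> closure {x. \<phi> x \<noteq> 0} \<subseteq> \<Omega>"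

definition divergence :: "('a::euclidean_space \<Rightarrow> 'a) \<Rightarrow> 'a \<Rightarrow> real" where
  "divergence \<phi> x = (\<Sum>i\<in>Basis. frechet_derivative \<phi> (at x) i \<bullet> i)"

definition perimeter :: "'a::euclidean_space set \<Rightarrow> 'a set \<Rightarrow> ereal" where
  "perimeter \<Omega> E =
     (SUP \<phi>\<in>{\<phi>. C1c \<Omega> \<phi> \<and> (\<forall>x. norm (\<phi> x) \<le> 1)}.
        ereal (integral\<^sup>L (lebesgue_on E) (divergence \<phi>)))"

section \<open>Weak gradients and Sobolev spaces\<close>

text \<open>
  Functions on \<open>\<Omega>\<close> are total functions whose values outside \<open>\<Omega>\<close> are irrelevant.
\<close>

definition square_integrable_on ::
    "('a::euclidean_space \<Rightarrow> 'b::euclidean_space) \<Rightarrow> 'a set \<Rightarrow> bool" where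
  "square_integrable_on f S \<longleftrightarrow>
     f \<in> borel_measurable (lebesgue_on S) \<and> integrable (lebesgue_on S) (\<lambda>x. (norm (f x))\<^sup>2)"

definition locally_integrable_on ::
    "('a::euclidean_space \<Rightarrow> 'b::euclidean_space) \<Rightarrow> 'a set \<Rightarrow> bool" where
  "locally_integrable_on f \<Omega> \<longleftrightarrow> (\<forall>K. compact K \<and> K \<subseteq> \<Omega> \<longrightarrow> integrable (lebesgue_on K) f)"

definition is_weak_gradient ::
    "'a::euclidean_space set \<Rightarrow> ('a \<Rightarrow> real) \<Rightarrow> ('a \<Rightarrow> 'a) \<Rightarrow> bool" where
  "is_weak_gradient \<Omega> u g \<longleftrightarrow>
     locally_integrable_on u \<Omega> \<and> locally_integrable_on g \<Omega> \<and>
     (\<forall>\<phi> :: 'a \<Rightarrow> real. C1c \<Omega> \<phi> \<longrightarrow>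
        (\<forall>i\<in>Basis.
           integral\<^sup>L (lebesgue_on \<Omega>) (\<lambda>x. u x * frechet_derivative \<phi> (at x) i) =
           - integral\<^sup>L (lebesgue_on \<Omega>) (\<lambda>x. (g x \<bullet> i) * \<phi> x)))"

text \<open>
  On an open set a weak gradient is unique up to null sets; \<open>weak_gradient \<Omega> u\<close> is one
  representative and is meaningful whenever one exists.
\<close>

definition weak_gradient ::
    "'a::euclidean_space set \<Rightarrow> ('a \<Rightarrow> real) \<Rightarrow> 'a \<Rightarrow> 'a" where
  "weak_gradient \<Omega> u = (SOME g. is_weak_gradient \<Omega> u g)"

definition H12 :: "'a::euclidean_space set \<Rightarrow> ('a \<Rightarrow> real) set" where
  "H12 \<Omega> = {u. square_integrable_on u \<Omega> \<and>
              (\<exists>g. is_weak_gradient \<Omega> u g \<and> square_integrable_on g \<Omega>)}"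

definition H12_loc :: "'a::euclidean_space set \<Rightarrow> ('a \<Rightarrow> real) set" where
  "H12_loc \<Omega> =
     {u. (\<forall>K. compact K \<and> K \<subseteq> \<Omega> \<longrightarrow> square_integrable_on u K) \<and>
         (\<exists>g. is_weak_gradient \<Omega> u g \<and>
              (\<forall>K. compact K \<and> K \<subseteq> \<Omega> \<longrightarrow> square_integrable_on g K))}"

section \<open>Rearrangements\<close>

definition distribution_fun :: "'a::euclidean_space set \<Rightarrow> ('a \<Rightarrow> real) \<Rightarrow> real \<Rightarrow> real" where
  "distribution_fun \<Omega> u t = measure lebesgue {x \<in> \<Omega>. u x > t}"

text \<open>
  The infimum is taken in the reals.  For \<open>\<Omega>\<close> of finite measure and \<open>0 < s < |\<Omega>|\<close> the set is
  nonempty and bounded below.  At \<open>s = |\<Omega>|\<close> (where the infimum is \<open>-\<infinity>\<close>) and, if \<open>u\<close> is not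
  essentially bounded above, at \<open>s = 0\<close> (where it is \<open>\<infinity>\<close>), the value is unspecified; hence
  the symmetrization is unspecified at most at the origin of the open ball on which it lives.
\<close>

definition decr_rearrangement :: "'a::euclidean_space set \<Rightarrow> ('a \<Rightarrow> real) \<Rightarrow> real \<Rightarrow> real" where
  "decr_rearrangement \<Omega> u s = Inf {t. distribution_fun \<Omega> u t \<le> s}"

definition schwarz_symm :: "'a::euclidean_space set \<Rightarrow> ('a \<Rightarrow> real) \<Rightarrow> 'a \<Rightarrow> real" where
  "schwarz_symm \<Omega> u x =
     decr_rearrangement \<Omega> u (measure lebesgue (ball (0::'a) 1) * norm x ^ DIM('a))"

definition centred_ball :: "real \<Rightarrow> 'a::euclidean_space set" where
  "centred_ball m = ball 0 ((m / measure lebesgue (ball (0::'a) 1)) powr (1 / DIM('a)))"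

lemma measure_centred_ball:
  assumes "m \<ge> 0"
  shows "measure lebesgue (centred_ball m :: 'a::euclidean_space set) = m"
proof -
  let ?c = "unit_ball_vol (real DIM('a))"
  have c: "measure lebesgue (ball (0::'a) 1) = ?c"
    by (simp add: content_ball)
  have pos: "?c > 0"
    by simp
  have "((m / ?c) powr (1 / DIM('a))) ^ DIM('a) = m / ?c"
  proof (cases "m = 0")
    case True
    then show ?thesis by simp
  next
    case False
    then have "m / ?c > 0" using assms pos by simp
    moreover have "(z powr (1 / DIM('a))) ^ DIM('a) = z" if "z > 0" for z :: real
      using that by (subst powr_realpow [symmetric]) (simp_all add: powr_powr)
    ultimately show ?thesis by blast
  qed
  moreover have "?c \<noteq> 0"
    using unit_ball_vol_pos [of "real DIM('a)"] by linarith
  ultimately show ?thesis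
    unfolding centred_ball_def c by (simp add: content_ball)
qed

section \<open>Absolute continuity\<close>

definition absolutely_continuous_on :: "real set \<Rightarrow> (real \<Rightarrow> real) \<Rightarrow> bool" where
  "absolutely_continuous_on I f \<longleftrightarrow>
     (\<forall>\<epsilon>>0. \<exists>\<delta>>0. \<forall>F :: (real \<times> real) set.
        finite F \<and> (\<forall>(a, b)\<in>F. a < b \<and> {a..b} \<subseteq> I) \<and>
        pairwise (\<lambda>(a, b) (c, d). {a<..<b} \<inter> {c<..<d} = {}) F \<and>
        (\<Sum>(a, b)\<in>F. b - a) < \<delta> \<longrightarrow>
        (\<Sum>(a, b)\<in>F. \<bar>f b - f a\<bar>) < \<epsilon>)"

end

theory Submission
  imports Defs
begin

text \<open>
  Write \<open>\<mu>\<close> for the distribution function of \<open>u\<close>, \<open>L = |\<Omega>|\<close> and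
  \<open>\<psi> s = min s (L - s) powr (1 - 1/n)\<close> for the isoperimetric profile.  The proof has three steps.
  
  \<^item> Coarea inequality.  The test fields in the definition of the perimeter see the set \<open>{u > t}\<close> through
    smooth cutoffs \<open>F (k (u - t))\<close>, and the weak chain rule bounds the result by
    \<open>\<integral> k F' (k (u - t)) |Du|\<close>.  With the isoperimetric hypothesis, Fatou's lemma and Tonelli in \<open>t\<close> this gives
    \<open>\<integral>_{t1}^{t2} \<psi> (\<mu> t) dt \<le> Q \<integral>_{t1 < u \<le> t2} |Du|\<close>.  Only this inequality is needed, so neither the
    coarea formula nor differentiability almost everywhere of monotone functions enters.
    The chain rule itself is proved by mollification.
  
  \<^item> Passage to the volume variable.  The relations \<open>u* s \<le> t\<close> and \<open>\<mu> t \<le> s\<close> are equivalent for \<open>0 < s < L\<close>.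
    Hence the interval \<open>(s1, s2]\<close> of volumes corresponds to the interval \<open>[u* s2, u* s1)\<close> of levels, whose
    layer \<open>{u* s2 < u < u* s1}\<close> has measure at most \<open>s2 - s1\<close>.  Let \<open>\<theta>\<close> be the image of \<open>\<psi> (\<mu> t) dt\<close>
    under \<open>\<mu>\<close> and \<open>\<nu>\<close> the image of \<open>Q\<^sup>2 |Du|\<^sup>2 dx\<close> under \<open>\<mu> \<circ> u\<close>.  Linearising the Cauchy-Schwarz
    inequality, \<open>2 a \<theta> \<le> a\<^sup>2 ds + \<nu>\<close> on intervals for every \<open>a > 0\<close>, hence on Borel sets.  A family of
    inequalities of this kind forces \<open>\<theta> = p ds\<close> with \<open>\<integral> p\<^sup>2 \<le> \<nu> (0, L)\<close>.  Since \<open>w = p / \<psi>\<close> satisfies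
    \<open>u* s1 - u* s2 = \<integral>_{s1}^{s2} w\<close>, the function \<open>w\<close> plays the role of \<open>- (u* )'\<close>; the bound on \<open>w \<psi>\<close> in
    \<open>L\<^sup>2\<close> yields the absolute continuity.
  
  \<^item> Back to the ball.  With \<open>T x = c_n |x|^n\<close> the symmetrization is \<open>u* \<circ> T\<close> and its weak gradient is
    \<open>- w (T x) DT x\<close>.  As \<open>T\<close> maps Lebesgue measure to Lebesgue measure on the half-line and
    \<open>|DT| = n c_n powr (1/n) * T powr (1 - 1/n)\<close>, the Dirichlet integral over \<open>{T < L - \<epsilon>}\<close> is that of
    \<open>w\<^sup>2 s powr (2 - 2/n)\<close> over \<open>(0, L - \<epsilon>)\<close> up to this constant, and \<open>c(\<epsilon>)\<close> bounds the ratio of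
    \<open>s powr (2 - 2/n)\<close> to \<open>\<psi>\<^sup>2\<close> there.
\<close>

section \<open>Translations in the mean\<close>

lemma
  fixes f :: "'a::euclidean_space \<Rightarrow> 'b::{banach,second_countable_topology}"
  assumes [measurable]: "f \<in> borel_measurable borel"
  shows lborel_integral_shift: "(LBINT x. f (x + h)) = (LBINT x. f x)"
    and lborel_integrable_shift: "integrable lborel (\<lambda>x. f (x + h)) \<longleftrightarrow> integrable lborel f"
proof -
  have *: "lborel = distr lborel borel (\<lambda>x::'a. x + h)"
  proof -
    have "(\<lambda>x::'a. x + h) = (+) h" by (auto simp: add.commute)
    then show ?thesis using lborel_distr_plus[of h] by simp
  qed
  show "(LBINT x. f (x + h)) = (LBINT x. f x)"
    by (subst (2) *) (simp add: integral_distr)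
  show "integrable lborel (\<lambda>x. f (x + h)) \<longleftrightarrow> integrable lborel f"
    by (subst (2) *) (simp add: integrable_distr_eq)
qed

text \<open>
  Continuity of translations in \<open>L\<^sup>1\<close> is stable under linear combinations and \<open>L\<^sup>1\<close> limits, so indicators of
  sets of finite measure suffice, and outer regularity reduces these to indicators of open sets.
\<close>

lemma L1_translation_seq:
  fixes f :: "'a::euclidean_space \<Rightarrow> real"
  assumes "integrable lborel f" and h: "h \<longlonglongrightarrow> 0"
  shows "(\<lambda>n. LBINT x. \<bar>f (x + h n) - f x\<bar>) \<longlonglongrightarrow> 0"
  using assms(1)
proof (induction rule: integrable_induct)
  case (base A c)
  have [measurable]: "A \<in> sets borel" using base by simp
  show ?case
  proof (rule LIMSEQ_I)
    fix e :: real assume "e > 0"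
    define e' where "e' = e / (4 * (\<bar>c\<bar> + 1))"
    have e': "e' > 0" using \<open>e > 0\<close> by (simp add: e'_def)
    obtain U where U: "open U" "A \<subseteq> U" "emeasure lborel (U - A) < ennreal e'"
      using outer_regular_lborel[of A e'] e' by auto
    have [measurable]: "U \<in> sets borel" using U by auto
    have fU: "emeasure lborel U < \<infinity>"
    proof -
      have "emeasure lborel U = emeasure lborel (U - A) + emeasure lborel A"
        using U by (subst plus_emeasure) (auto intro!: arg_cong2[of _ _ _ _ emeasure])
      also have "\<dots> < \<infinity>" using order.strict_trans[OF U(3) ennreal_less_top] base(2) by (auto simp: less_top[symmetric] ennreal_add_eq_top)
      finally show ?thesis .
    qed
    have iU: "integrable lborel (indicator U :: 'a \<Rightarrow> real)" using fU by (simp add: integrable_indicator_iff)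
    have iA: "integrable lborel (indicator A :: 'a \<Rightarrow> real)" using base by (simp add: integrable_indicator_iff)
    have dU: "(LBINT x. \<bar>indicat_real A x - indicat_real U x\<bar>) < e'"
    proof -
      have "(LBINT x. \<bar>indicat_real A x - indicat_real U x\<bar>) = (LBINT x. indicator (U - A) x)"
        using U by (intro Bochner_Integration.integral_cong) (auto simp: indicator_def)
      also have "\<dots> = measure lborel (U - A)" by simp
      also have "\<dots> < e'"
        using U(3) e' by (metis emeasure_eq_ennreal_measure ennreal_less_iff less_top measure_nonneg order.strict_trans ennreal_less_top)
      finally show ?thesis .
    qed
    (* Openness enters here: a point of U stays in U under small shifts, so the overlaps of U
       with its translates exhaust U. *)
    have lim: "(\<lambda>n. LBINT x. indicator U x * indicator U (x + h n)) \<longlonglongrightarrow> (LBINT x. indicat_real U x)"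
    proof (rule integral_dominated_convergence[where w="indicat_real U"])
      show "AE x in lborel. (\<lambda>n. indicator U x * indicator U (x + h n)) \<longlonglongrightarrow> indicat_real U x"
      proof (rule AE_I2)
        fix x :: 'a
        show "(\<lambda>n. indicator U x * indicator U (x + h n)) \<longlonglongrightarrow> indicat_real U x"
        proof (cases "x \<in> U")
          case True
          have "(\<lambda>n. x + h n) \<longlonglongrightarrow> x" using tendsto_add[OF tendsto_const[of x] h] by simp
          then have "eventually (\<lambda>n. x + h n \<in> U) sequentially"
            using True U(1) topological_tendstoD by blast
          then show ?thesis by (intro tendsto_eventually) (auto simp: True elim!: eventually_mono)
        qed simp
      qed
    qed (use iU in \<open>auto simp: indicator_def\<close>)
    have "\<forall>\<^sub>F n in sequentially. 2 * ((LBINT x. indicat_real U x) - (LBINT x. indicator U x * indicator U (x + h n))) < e'"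
    proof -
      have "(\<lambda>n. 2 * ((LBINT x. indicat_real U x) - (LBINT x. indicator U x * indicator U (x + h n)))) \<longlonglongrightarrow> 2 * ((LBINT x. indicat_real U x) - (LBINT x. indicat_real U x))"
        by (intro tendsto_intros lim)
      then show ?thesis using e' by (intro order_tendstoD(2)[of _ 0]) auto
    qed
    then obtain N where N: "\<And>n. n \<ge> N \<Longrightarrow> 2 * ((LBINT x. indicat_real U x) - (LBINT x. indicator U x * indicator U (x + h n))) < e'"
      by (auto simp: eventually_sequentially)
    show "\<exists>N. \<forall>n\<ge>N. norm ((LBINT x. \<bar>indicat_real A (x + h n) *\<^sub>R c - indicat_real A x *\<^sub>R c\<bar>) - 0) < e"
    proof (intro exI allI impI)
      fix n assume "n \<ge> N"
      have iUs: "integrable lborel (\<lambda>x. indicat_real U (x + h n))" "integrable lborel (\<lambda>x. indicat_real A (x + h n))"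
        using iU iA by (simp_all add: lborel_integrable_shift)
      have iUU: "integrable lborel (\<lambda>x. indicat_real U x * indicator U (x + h n))"
        by (rule Bochner_Integration.integrable_bound[OF iU]) (auto simp: indicator_def)
      have "(LBINT x. \<bar>indicat_real U (x + h n) - indicat_real U x\<bar>)
          = (LBINT x. indicat_real U (x + h n) + indicat_real U x - 2 * (indicator U x * indicator U (x + h n)))"
        by (intro Bochner_Integration.integral_cong) (auto simp: indicator_def)
      also have "\<dots> = (LBINT x. indicat_real U (x + h n)) + (LBINT x. indicat_real U x) - 2 * (LBINT x. indicator U x * indicator U (x + h n))"
        using iU iUs iUU by simp
      also have "\<dots> < e'" using N[OF \<open>n \<ge> N\<close>] by (subst lborel_integral_shift) auto
      finally have U': "(LBINT x. \<bar>indicat_real U (x + h n) - indicat_real U x\<bar>) < e'" .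
      have "(LBINT x. \<bar>indicat_real A (x + h n) - indicat_real A x\<bar>)
         \<le> (LBINT x. \<bar>indicat_real A (x + h n) - indicat_real U (x + h n)\<bar> + \<bar>indicat_real U (x + h n) - indicat_real U x\<bar>
              + \<bar>indicat_real A x - indicat_real U x\<bar>)"
        using iU iUs iA by (intro integral_mono) auto
      also have "\<dots> = (LBINT x. \<bar>indicat_real A (x + h n) - indicat_real U (x + h n)\<bar>) + (LBINT x. \<bar>indicat_real U (x + h n) - indicat_real U x\<bar>)
              + (LBINT x. \<bar>indicat_real A x - indicat_real U x\<bar>)"
        using iU iUs iA by simp
      also have "(LBINT x. \<bar>indicat_real A (x + h n) - indicat_real U (x + h n)\<bar>) = (LBINT x. \<bar>indicat_real A x - indicat_real U x\<bar>)"
        by (rule lborel_integral_shift[of "\<lambda>x. \<bar>indicat_real A x - indicat_real U x\<bar>"]) measurable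
      finally have 3: "(LBINT x. \<bar>indicat_real A (x + h n) - indicat_real A x\<bar>) < 3 * e'" using dU U' by linarith
      have "(LBINT x. \<bar>indicat_real A (x + h n) *\<^sub>R c - indicat_real A x *\<^sub>R c\<bar>)
         = (LBINT x. \<bar>c\<bar> * \<bar>indicat_real A (x + h n) - indicat_real A x\<bar>)"
        by (intro Bochner_Integration.integral_cong) (auto simp: indicator_def)
      also have "\<dots> = \<bar>c\<bar> * (LBINT x. \<bar>indicat_real A (x + h n) - indicat_real A x\<bar>)" by simp
      also have "\<dots> \<le> \<bar>c\<bar> * (3 * e')" using 3 by (intro mult_left_mono) auto
      also have "\<dots> < e" using \<open>e > 0\<close> mult_nonneg_nonneg[of e "\<bar>c\<bar>"] unfolding e'_def by (simp add: field_simps del: mult_nonneg_nonneg)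
      finally show "norm ((LBINT x. \<bar>indicat_real A (x + h n) *\<^sub>R c - indicat_real A x *\<^sub>R c\<bar>) - 0) < e"
        by simp
    qed
  qed
next
  case (add f g)
  have [measurable]: "f \<in> borel_measurable borel" "g \<in> borel_measurable borel" using add(1,2) by auto
  have s: "integrable lborel (\<lambda>x. f (x + h n))" "integrable lborel (\<lambda>x. g (x + h n))" for n
    using add by (simp_all add: lborel_integrable_shift)
  show ?case
  proof (rule tendsto_sandwich[OF _ _ tendsto_const])
    show "(\<lambda>n. (LBINT x. \<bar>f (x + h n) - f x\<bar>) + (LBINT x. \<bar>g (x + h n) - g x\<bar>)) \<longlonglongrightarrow> 0"
      using tendsto_add[OF add(3,4)] by simp
    show "\<forall>\<^sub>F n in sequentially. (LBINT x. \<bar>f (x + h n) + g (x + h n) - (f x + g x)\<bar>) \<le> (LBINT x. \<bar>f (x + h n) - f x\<bar>) + (LBINT x. \<bar>g (x + h n) - g x\<bar>)"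
    proof (rule always_eventually, rule allI)
      fix n
      show "(LBINT x. \<bar>f (x + h n) + g (x + h n) - (f x + g x)\<bar>) \<le> (LBINT x. \<bar>f (x + h n) - f x\<bar>) + (LBINT x. \<bar>g (x + h n) - g x\<bar>)"
      proof -
        have "(LBINT x. \<bar>f (x + h n) + g (x + h n) - (f x + g x)\<bar>) \<le> (LBINT x. \<bar>f (x + h n) - f x\<bar> + \<bar>g (x + h n) - g x\<bar>)"
          using add(1,2) s[of n] by (intro integral_mono) auto
        then show ?thesis using add(1,2) s[of n] by simp
      qed
    qed
  qed (auto intro!: always_eventually integral_nonneg_AE)
next
  case (lim f s)
  have [measurable]: "f \<in> borel_measurable borel" "\<And>i. s i \<in> borel_measurable borel" using lim(1,4) by auto
  have L: "(\<lambda>i. LBINT x. \<bar>s i x - f x\<bar>) \<longlonglongrightarrow> (\<integral>x. 0 \<partial>(lborel :: 'a measure))"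
  proof (rule integral_dominated_convergence[where w="\<lambda>x. 3 * \<bar>f x\<bar>"])
    show "AE x in lborel. (\<lambda>i. \<bar>s i x - f x\<bar>) \<longlonglongrightarrow> 0"
      using lim(2) by (intro AE_I2 tendsto_rabs_zero) (auto simp: LIM_zero_iff)
    show "AE x in lborel. norm \<bar>s i x - f x\<bar> \<le> 3 * \<bar>f x\<bar>" for i
    proof (rule AE_I2)
      fix x
      have "\<bar>s i x\<bar> \<le> 2 * \<bar>f x\<bar>" using lim(3)[of x i] by simp
      then show "norm \<bar>s i x - f x\<bar> \<le> 3 * \<bar>f x\<bar>" by simp
    qed
  qed (use lim(4) in auto)
  show ?case
  proof (rule LIMSEQ_I)
    fix e :: real assume "e > 0"
    then obtain i where i: "(LBINT x. \<bar>s i x - f x\<bar>) < e / 3"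
      using order_tendstoD(2)[OF L, of "e/3"] by (auto simp: eventually_sequentially)
    obtain N where N: "\<And>n. n \<ge> N \<Longrightarrow> (LBINT x. \<bar>s i (x + h n) - s i x\<bar>) < e / 3"
      using order_tendstoD(2)[OF lim(5)[of i], of "e/3"] \<open>e > 0\<close> by (auto simp: eventually_sequentially)
    show "\<exists>N. \<forall>n\<ge>N. norm ((LBINT x. \<bar>f (x + h n) - f x\<bar>) - 0) < e"
    proof (intro exI allI impI)
      fix n assume n: "n \<ge> N"
      have sh: "integrable lborel (\<lambda>x. f (x + h n))" "integrable lborel (\<lambda>x. s i (x + h n))"
        using lim by (simp_all add: lborel_integrable_shift)
      have "(LBINT x. \<bar>f (x + h n) - f x\<bar>) \<le> (LBINT x. \<bar>s i (x + h n) - f (x + h n)\<bar> + \<bar>s i (x + h n) - s i x\<bar> + \<bar>s i x - f x\<bar>)"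
        using sh lim(1,4) by (intro integral_mono) auto
      also have "\<dots> = (LBINT x. \<bar>s i (x + h n) - f (x + h n)\<bar>) + (LBINT x. \<bar>s i (x + h n) - s i x\<bar>) + (LBINT x. \<bar>s i x - f x\<bar>)"
        using sh lim(1,4) by simp
      also have "(LBINT x. \<bar>s i (x + h n) - f (x + h n)\<bar>) = (LBINT x. \<bar>s i x - f x\<bar>)"
        by (rule lborel_integral_shift[of "\<lambda>x. \<bar>s i x - f x\<bar>"]) measurable
      finally have "(LBINT x. \<bar>f (x + h n) - f x\<bar>) < e" using i N[OF n] by linarith
      then show "norm ((LBINT x. \<bar>f (x + h n) - f x\<bar>) - 0) < e" by simp
    qed
  qed
qed

lemma L1_translation:
  fixes f :: "'a::euclidean_space \<Rightarrow> real"
  assumes "integrable lborel f"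
  shows "((\<lambda>h. LBINT x. \<bar>f (x + h) - f x\<bar>) \<longlongrightarrow> 0) (at 0)"
  using L1_translation_seq[OF assms] by (auto simp: tendsto_at_iff_sequentially o_def)

section \<open>Mollification\<close>

lemma square_positive_part_has_derivative:
  "((\<lambda>y::real. (max 0 y)\<^sup>2) has_real_derivative 2 * max 0 y) (at y)"
proof (cases y "0::real" rule: linorder_cases)
  case less
  have "((\<lambda>y::real. 0) has_real_derivative 0) (at y)" by simp
  then have "((\<lambda>y::real. (max 0 y)\<^sup>2) has_real_derivative 0) (at y)"
    by (rule has_field_derivative_transform_within[where d="-y"]) (use less in \<open>auto simp: dist_real_def max_def\<close>)
  then show ?thesis using less by simp
next
  case equal
  have "((\<lambda>h. (max 0 h)\<^sup>2 / h) \<longlongrightarrow> 0) (at (0::real))"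
    by (rule Lim_null_comparison[where g="\<lambda>h. \<bar>h\<bar>"])
      (auto simp: max_def power2_eq_square intro!: always_eventually tendsto_eq_intros)
  then show ?thesis using equal by (simp add: DERIV_def)
next
  case greater
  have "((\<lambda>y::real. y\<^sup>2) has_real_derivative 2 * y) (at y)"
    by (auto intro!: derivative_eq_intros)
  then have "((\<lambda>y::real. (max 0 y)\<^sup>2) has_real_derivative 2 * y) (at y)"
    by (rule has_field_derivative_transform_within[where d="y"]) (use greater in \<open>auto simp: dist_real_def max_def\<close>)
  then show ?thesis using greater by simp
qed

text \<open>
  The square of a truncated quadratic is the simplest radial function that is continuously differentiable,
  nonnegative and supported in a ball.
\<close>

definition bump :: "real \<Rightarrow> 'a::euclidean_space \<Rightarrow> real" where
  "bump r z = (max 0 (r\<^sup>2 - z \<bullet> z))\<^sup>2"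

definition mollifier :: "real \<Rightarrow> 'a::euclidean_space \<Rightarrow> real" where
  "mollifier r z = bump r z / (LBINT y. bump r (y::'a))"

definition mollifier_deriv :: "real \<Rightarrow> 'a::euclidean_space \<Rightarrow> 'a \<Rightarrow> real" where
  "mollifier_deriv r z e = - 4 * max 0 (r\<^sup>2 - z \<bullet> z) * (z \<bullet> e) / (LBINT y. bump r (y::'a))"

text \<open>
  Writing the kernel as \<open>mollifier r (y - x)\<close> makes both the shift by \<open>x\<close> and the use of the kernel as a test
  function of \<open>y\<close> immediate; the kernel is even, so this is the usual convolution.
\<close>

definition mollify :: "real \<Rightarrow> ('a::euclidean_space \<Rightarrow> real) \<Rightarrow> 'a \<Rightarrow> real" where
  "mollify r f x = (LBINT y. f y * mollifier r (y - x))"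

lemma bump_nonneg: "bump r z \<ge> 0" by (simp add: bump_def)

lemma bump_eq_0: "r \<ge> 0 \<Longrightarrow> r \<le> norm z \<Longrightarrow> bump r z = 0"
proof -
  assume "r \<ge> 0" "r \<le> norm z"
  then have "r\<^sup>2 \<le> (norm z)\<^sup>2" by (intro power_mono)
  then show ?thesis by (simp add: bump_def power2_norm_eq_inner)
qed

lemma bump_bound: "bump r z \<le> r ^ 4"
proof -
  have "(max 0 (r\<^sup>2 - z \<bullet> z))\<^sup>2 \<le> (r\<^sup>2)\<^sup>2" by (intro power_mono) auto
  then show ?thesis by (simp add: bump_def)
qed

lemma continuous_bump: "continuous_on UNIV (bump r)"
  unfolding bump_def[abs_def] by (intro continuous_intros)

lemma borel_bump [measurable]: "bump r \<in> borel_measurable borel"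
  using continuous_bump by (rule borel_measurable_continuous_onI)

lemma integrable_bounded_support:
  fixes f :: "'a::euclidean_space \<Rightarrow> real"
  assumes "f \<in> borel_measurable borel" "\<And>x. \<bar>f x\<bar> \<le> B" "\<And>x. R < norm x \<Longrightarrow> f x = 0"
  shows "integrable lborel f"
proof (rule Bochner_Integration.integrable_bound[where f="\<lambda>x. B * indicator (cball 0 R) x"])
  show "integrable lborel (\<lambda>x::'a. B * indicator (cball 0 R) x)"
    using emeasure_lborel_cball_finite[of "0::'a" R] by (intro integrable_mult_right) (simp add: integrable_indicator_iff)
  show "AE x in lborel. norm (f x) \<le> norm (B * indicator (cball 0 R) x)"
  proof (rule AE_I2)
    fix x show "norm (f x) \<le> norm (B * indicator (cball 0 R) x)"
      using assms(2)[of x] assms(3)[of x] by (auto simp: indicator_def)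
  qed
qed (use assms(1) in auto)

lemma integrable_bump: "r > 0 \<Longrightarrow> integrable lborel (bump r)"
  by (rule integrable_bounded_support[where B="r^4" and R=r])
    (auto simp: bump_nonneg bump_bound bump_eq_0)

lemma bump_integral_pos:
  assumes "r > 0" shows "(LBINT y. bump r (y::'a::euclidean_space)) > 0"
proof -
  have "(LBINT y. bump r (y::'a)) \<ge> 0" by (simp add: bump_nonneg)
  moreover have "(LBINT y. bump r (y::'a)) \<noteq> 0"
  proof
    assume "(LBINT y. bump r (y::'a)) = 0"
    then have "AE y in lborel. bump r (y::'a) = 0"
      using integral_nonneg_eq_0_iff_AE[OF integrable_bump[where 'a='a, OF assms]] by (simp add: bump_nonneg)
    then have "AE y in lborel. (y::'a) \<notin> ball 0 r"
    proof (rule AE_mp, intro AE_I2 impI)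
      fix y :: 'a assume *: "bump r y = 0"
      show "y \<notin> ball 0 r"
      proof
        assume "y \<in> ball 0 r"
        then have "(norm y)\<^sup>2 < r\<^sup>2" using assms by (intro power_strict_mono) auto
        then show False using * by (simp add: bump_def power2_norm_eq_inner max_def split: if_splits)
      qed
    qed
    then have "emeasure lborel (ball (0::'a) r) = 0"
      by (subst (asm) AE_iff_measurable[OF _ refl]) (auto simp: ball_def)
    then show False using content_ball_pos[of r "0::'a"] assms
      by (simp add: measure_def)
  qed
  ultimately show ?thesis by linarith
qed

lemma mollifier_nonneg: "mollifier r z \<ge> 0"
  unfolding mollifier_def by (intro divide_nonneg_nonneg integral_nonneg_AE AE_I2) (auto simp: bump_nonneg)

lemma mollifier_eq_0: "r \<ge> 0 \<Longrightarrow> r \<le> norm z \<Longrightarrow> mollifier r z = 0"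
  by (simp add: mollifier_def bump_eq_0)

lemma borel_mollifier [measurable]: "mollifier r \<in> borel_measurable borel"
  unfolding mollifier_def[abs_def] by measurable

lemma integrable_mollifier: "r > 0 \<Longrightarrow> integrable lborel (mollifier r)"
  unfolding mollifier_def[abs_def] by (intro integrable_divide integrable_bump)

lemma integral_mollifier: "r > 0 \<Longrightarrow> (LBINT z. mollifier r (z::'a::euclidean_space)) = 1"
  unfolding mollifier_def using bump_integral_pos[of r, where 'a='a] by simp

lemma mollifier_bound:
  obtains B where "\<And>z::'a::euclidean_space. \<bar>mollifier r z\<bar> \<le> B"
proof
  fix z :: 'a
  show "\<bar>mollifier r z\<bar> \<le> r^4 / (LBINT y. bump r (y::'a))"
    using mollifier_nonneg[of r z] unfolding mollifier_def
    by (auto intro!: divide_right_mono bump_bound integral_nonneg_AE simp: bump_nonneg)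
qed

lemma mollifier_has_derivative:
  "(mollifier r has_derivative mollifier_deriv r z) (at (z::'a::euclidean_space))"
proof -
  have 1: "((\<lambda>z::'a. r\<^sup>2 - z \<bullet> z) has_derivative (\<lambda>h. - 2 * (z \<bullet> h))) (at z)"
    by (auto intro!: derivative_eq_intros simp: inner_commute)
  have "((\<lambda>z::'a. (max 0 (r\<^sup>2 - z \<bullet> z))\<^sup>2) has_derivative (\<lambda>h. - 2 * (z \<bullet> h) * (2 * max 0 (r\<^sup>2 - z \<bullet> z)))) (at z)"
    using DERIV_compose_FDERIV[OF square_positive_part_has_derivative 1] by simp
  from has_derivative_mult_right[OF this, of "1 / (LBINT y. bump r (y::'a))"]
  show ?thesis
    by (simp add: mollifier_def[abs_def] mollifier_deriv_def[abs_def] bump_def[abs_def] mult.assoc mult.left_commute mult.commute)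
qed

lemma continuous_mollifier_deriv: "continuous_on UNIV (\<lambda>z. mollifier_deriv r z e)"
  unfolding mollifier_deriv_def by (cases "(LBINT y. bump r (y::'a)) = 0") (auto intro!: continuous_intros)

lemma borel_mollifier_deriv [measurable]: "(\<lambda>z. mollifier_deriv r z e) \<in> borel_measurable borel"
  using continuous_mollifier_deriv by (rule borel_measurable_continuous_onI)

lemma mollifier_deriv_bound:
  assumes "r \<ge> 0"
  obtains B where "\<And>z::'a::euclidean_space. \<bar>mollifier_deriv r z e\<bar> \<le> B"
proof
  fix z :: 'a
  let ?I = "LBINT y. bump r (y::'a)"
  have I: "?I \<ge> 0" by (simp add: bump_nonneg)
  have "\<bar>max 0 (r\<^sup>2 - z \<bullet> z) * (z \<bullet> e)\<bar> \<le> r\<^sup>2 * (r * norm e)"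
  proof (cases "norm z \<le> r")
    case True
    have "\<bar>z \<bullet> e\<bar> \<le> norm z * norm e" by (rule Cauchy_Schwarz_ineq2)
    also have "\<dots> \<le> r * norm e" using True by (intro mult_right_mono) auto
    finally show ?thesis unfolding abs_mult by (intro mult_mono) auto
  next
    case False
    then have "r\<^sup>2 \<le> (norm z)\<^sup>2" using assms by (intro power_mono) auto
    then show ?thesis using assms by (simp add: power2_norm_eq_inner)
  qed
  then show "\<bar>mollifier_deriv r z e\<bar> \<le> 4 * (r\<^sup>2 * (r * norm e)) / ?I"
    using I unfolding mollifier_deriv_def by (auto simp: abs_mult mult.assoc intro!: divide_right_mono)
qed

lemma borel_mollify [measurable]:
  assumes [measurable]: "f \<in> borel_measurable borel"
  shows "mollify r f \<in> borel_measurable borel"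
  unfolding mollify_def[abs_def] by measurable

lemma mollify_shift:
  assumes [measurable]: "f \<in> borel_measurable borel"
  shows "mollify r f x = (LBINT z. f (x + z) * mollifier r z)"
proof -
  have "(LBINT z. f (x + z) * mollifier r z) = (LBINT z. f (z + x) * mollifier r ((z + x) - x))"
    by (simp add: add.commute)
  also have "\<dots> = mollify r f x"
    unfolding mollify_def by (rule lborel_integral_shift[of "\<lambda>y. f y * mollifier r (y - x)"]) measurable
  finally show ?thesis by simp
qed

lemma integrable_mollify_integrand:
  fixes f :: "'a::euclidean_space \<Rightarrow> real"
  assumes "integrable lborel f"
  shows "integrable lborel (\<lambda>y. f y * mollifier r (y - x))"
proof -
  obtain B where B: "\<And>z::'a. \<bar>mollifier r z\<bar> \<le> B" using mollifier_bound by blast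
  have [measurable]: "f \<in> borel_measurable borel" using assms by auto
  show ?thesis
  proof (rule Bochner_Integration.integrable_bound[where f="\<lambda>y. B * f y"])
    show "AE y in lborel. norm (f y * mollifier r (y - x)) \<le> norm (B * f y)"
    proof (rule AE_I2)
      fix y
      have "\<bar>mollifier r (y - x)\<bar> \<le> \<bar>B\<bar>" using B[of "y - x"] by linarith
      then have "\<bar>f y\<bar> * \<bar>mollifier r (y - x)\<bar> \<le> \<bar>f y\<bar> * \<bar>B\<bar>" by (rule mult_left_mono) simp
      then show "norm (f y * mollifier r (y - x)) \<le> norm (B * f y)" by (simp add: abs_mult mult.commute)
    qed
  qed (use assms in auto)
qed

text \<open>
  The mollification is an average of translates, so its distance from \<open>f\<close> is at most the largest distance of a
  translate; by Tonelli this average may be taken after integration.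
\<close>

lemma mollify_L1_distance:
  fixes f :: "'a::euclidean_space \<Rightarrow> real"
  assumes f: "integrable lborel f" and r: "r > 0" and "e \<ge> 0"
    and w: "\<And>z. norm z < r \<Longrightarrow> (LBINT x. \<bar>f (x + z) - f x\<bar>) \<le> e"
  shows "(\<integral>\<^sup>+x. ennreal \<bar>mollify r f x - f x\<bar> \<partial>lborel) \<le> ennreal e"
proof -
  have [measurable]: "f \<in> borel_measurable borel" using f by auto
  have pt: "ennreal \<bar>mollify r f x - f x\<bar> \<le> (\<integral>\<^sup>+z. ennreal (\<bar>f (x + z) - f x\<bar> * mollifier r z) \<partial>lborel)" for x
  proof -
    have i1: "integrable lborel (\<lambda>z. f (x + z) * mollifier r z)"
      using lborel_integrable_shift[of "\<lambda>y. f y * mollifier r (y - x)" x] integrable_mollify_integrand[OF f, of r x]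
      by (simp add: add.commute)
    have i2: "integrable lborel (\<lambda>z. f x * mollifier r (z::'a))"
      using integrable_mollifier[OF r] by auto
    have "mollify r f x - f x = (LBINT z. f (x + z) * mollifier r z) - (LBINT z. f x * mollifier r (z::'a))"
      by (simp add: mollify_shift integral_mollifier[OF r])
    also have "\<dots> = (LBINT z. (f (x + z) - f x) * mollifier r z)"
      using i1 i2 by (subst Bochner_Integration.integral_diff[symmetric]) (auto simp: algebra_simps)
    also have "ennreal \<bar>\<dots>\<bar> \<le> (\<integral>\<^sup>+z. ennreal (norm ((f (x + z) - f x) * mollifier r z)) \<partial>lborel)"
      using integral_norm_bound_ennreal[of lborel "\<lambda>z. (f (x + z) - f x) * mollifier r z"] i1 i2
      by (simp add: left_diff_distrib)
    finally show ?thesis by (simp add: abs_mult mollifier_nonneg)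
  qed
  have "(\<integral>\<^sup>+x. ennreal \<bar>mollify r f x - f x\<bar> \<partial>lborel) \<le> (\<integral>\<^sup>+x. (\<integral>\<^sup>+z. ennreal (\<bar>f (x + z) - f x\<bar> * mollifier r z) \<partial>lborel) \<partial>lborel)"
    by (intro nn_integral_mono pt)
  also have "\<dots> = (\<integral>\<^sup>+z. (\<integral>\<^sup>+x. ennreal (\<bar>f (x + z) - f x\<bar> * mollifier r z) \<partial>lborel) \<partial>lborel)"
    by (rule lborel_pair.Fubini') measurable
  also have "\<dots> \<le> (\<integral>\<^sup>+z. ennreal e * ennreal (mollifier r (z::'a)) \<partial>lborel)"
  proof (rule nn_integral_mono)
    fix z :: 'a
    show "(\<integral>\<^sup>+x. ennreal (\<bar>f (x + z) - f x\<bar> * mollifier r z) \<partial>lborel) \<le> ennreal e * ennreal (mollifier r z)"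
    proof (cases "norm z < r")
      case True
      have "integrable lborel (\<lambda>x. f (x + z))" using f by (simp add: lborel_integrable_shift)
      then have "(\<integral>\<^sup>+x. ennreal \<bar>f (x + z) - f x\<bar> \<partial>lborel) = ennreal (LBINT x. \<bar>f (x + z) - f x\<bar>)"
        using f by (intro nn_integral_eq_integral) auto
      also have "\<dots> \<le> ennreal e" using w[OF True] by (rule ennreal_leI)
      finally have "(\<integral>\<^sup>+x. ennreal \<bar>f (x + z) - f x\<bar> \<partial>lborel) \<le> ennreal e" .
      moreover have "(\<integral>\<^sup>+x. ennreal (\<bar>f (x + z) - f x\<bar> * mollifier r z) \<partial>lborel) = (\<integral>\<^sup>+x. ennreal \<bar>f (x + z) - f x\<bar> \<partial>lborel) * ennreal (mollifier r z)"
        by (subst nn_integral_multc[symmetric]) (auto simp: ennreal_mult mollifier_nonneg)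
      ultimately show ?thesis by (simp add: mult_right_mono)
    next
      case False
      then show ?thesis using r by (simp add: mollifier_eq_0)
    qed
  qed
  also have "\<dots> = ennreal e"
    using integrable_mollifier[OF r, where 'a='a] integral_mollifier[OF r, where 'a='a]
    by (simp add: nn_integral_cmult nn_integral_eq_integral mollifier_nonneg)
  finally show ?thesis .
qed

lemma mollify_L1_convergent:
  fixes f :: "'a::euclidean_space \<Rightarrow> real"
  assumes f: "integrable lborel f" and r: "r > 0"
  shows "(\<lambda>k. LBINT x. \<bar>mollify (r / Suc k) f x - f x\<bar>) \<longlonglongrightarrow> 0"
    and "integrable lborel (mollify (r / Suc k) f)"
proof -
  have [measurable]: "f \<in> borel_measurable borel" using f by auto
  have fin: "integrable lborel (\<lambda>x. mollify s f x - f x)" if s: "s > 0" for s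
  proof (rule integrableI_bounded)
    have "(LBINT x. \<bar>f (x + z) - f x\<bar>) \<le> 2 * (LBINT x. \<bar>f x\<bar>)" for z
    proof -
      have i: "integrable lborel (\<lambda>x. f (x + z))" using f by (simp add: lborel_integrable_shift)
      have "(LBINT x. \<bar>f (x + z) - f x\<bar>) \<le> (LBINT x. \<bar>f (x + z)\<bar> + \<bar>f x\<bar>)"
        using i f by (intro integral_mono) auto
      also have "\<dots> = (LBINT x. \<bar>f (x + z)\<bar>) + (LBINT x. \<bar>f x\<bar>)" using i f by simp
      also have "(LBINT x. \<bar>f (x + z)\<bar>) = (LBINT x. \<bar>f x\<bar>)"
        by (rule lborel_integral_shift[of "\<lambda>x. \<bar>f x\<bar>"]) measurable
      finally show ?thesis by simp
    qed
    from mollify_L1_distance[OF f s _ this]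
    have "(\<integral>\<^sup>+x. ennreal \<bar>mollify s f x - f x\<bar> \<partial>lborel) \<le> ennreal (2 * (LBINT x. \<bar>f x\<bar>))" by simp
    also have "\<dots> < \<infinity>" by simp
    finally show "(\<integral>\<^sup>+x. ennreal (norm (mollify s f x - f x)) \<partial>lborel) < \<infinity>" by simp
  qed measurable
  show "integrable lborel (mollify (r / Suc k) f)"
    using Bochner_Integration.integrable_add[OF fin[of "r / Suc k"] f] r by simp
  show "(\<lambda>k. LBINT x. \<bar>mollify (r / Suc k) f x - f x\<bar>) \<longlonglongrightarrow> 0"
  proof (rule LIMSEQ_I)
    fix e :: real assume e: "e > 0"
    have "\<forall>\<^sub>F h in at 0. (LBINT x. \<bar>f (x + h) - f x\<bar>) < e / 2"
      using order_tendstoD(2)[OF L1_translation[OF f], of "e/2"] e by simp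
    then obtain d where d: "d > 0" "\<And>h. h \<noteq> 0 \<Longrightarrow> norm h < d \<Longrightarrow> (LBINT x. \<bar>f (x + h) - f x\<bar>) < e / 2"
      by (auto simp: eventually_at)
    then have d': "\<And>h. norm h < d \<Longrightarrow> (LBINT x. \<bar>f (x + h) - f x\<bar>) \<le> e / 2"
    proof -
      fix h :: 'a assume "norm h < d"
      then show "(LBINT x. \<bar>f (x + h) - f x\<bar>) \<le> e / 2"
        using d(2)[of h] e by (cases "h = 0") auto
    qed
    obtain N :: nat where N: "r / d < real N" using reals_Archimedean2 by blast
    show "\<exists>N. \<forall>k\<ge>N. norm ((LBINT x. \<bar>mollify (r / Suc k) f x - f x\<bar>) - 0) < e"
    proof (intro exI allI impI)
      fix k assume "k \<ge> N"
      then have "r / d < Suc k" using N by simp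
      then have "r < Suc k * d" using d(1) by (simp only: pos_divide_less_eq)
      then have rk: "r / Suc k < d" by (simp add: pos_divide_less_eq mult.commute del: of_nat_Suc)
      have rk0: "r / Suc k > 0" using r by simp
      have "(\<integral>\<^sup>+x. ennreal \<bar>mollify (r / Suc k) f x - f x\<bar> \<partial>lborel) \<le> ennreal (e/2)"
        using e rk by (intro mollify_L1_distance[OF f rk0] d') auto
      moreover have "(\<integral>\<^sup>+x. ennreal \<bar>mollify (r / Suc k) f x - f x\<bar> \<partial>lborel) = ennreal (LBINT x. \<bar>mollify (r / Suc k) f x - f x\<bar>)"
        using fin[OF rk0] by (intro nn_integral_eq_integral) auto
      ultimately have "(LBINT x. \<bar>mollify (r / Suc k) f x - f x\<bar>) \<le> e / 2" using e by (simp add: ennreal_le_iff)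
      then show "norm ((LBINT x. \<bar>mollify (r / Suc k) f x - f x\<bar>) - 0) < e"
        using e by (simp add: integral_nonneg_AE)
    qed
  qed
qed

section \<open>Test functions and weak partial derivatives\<close>

lemma C1c_has_derivative:
  "C1c U \<phi> \<Longrightarrow> (\<phi> has_derivative frechet_derivative \<phi> (at x)) (at x)"
  by (simp add: C1c_def frechet_derivative_works[symmetric])

lemma C1c_continuous: "C1c U \<phi> \<Longrightarrow> continuous_on UNIV \<phi>"
  by (meson C1c_has_derivative continuous_at_imp_continuous_on has_derivative_continuous)

lemma C1c_frechet_outside:
  assumes "C1c U \<phi>" "x \<notin> closure {x. \<phi> x \<noteq> 0}"
  shows "frechet_derivative \<phi> (at x) = (\<lambda>_. 0)"
proof -
  have "((\<lambda>_. 0) has_derivative (\<lambda>_. 0)) (at x)" by simp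
  then have "(\<phi> has_derivative (\<lambda>_. 0)) (at x)"
  proof (rule has_derivative_transform_within_open)
    show "open (- closure {x. \<phi> x \<noteq> 0})" by (rule open_Compl[OF closed_closure])
    fix y assume "y \<in> - closure {x. \<phi> x \<noteq> 0}"
    then have "y \<notin> {x. \<phi> x \<noteq> 0}" using closure_subset[of "{x. \<phi> x \<noteq> 0}"] by blast
    then show "0 = \<phi> y" by simp
  next
    show "x \<in> - closure {x. \<phi> x \<noteq> 0}" using assms(2) by simp
  qed
  then show ?thesis by (metis frechet_derivative_at)
qed

lemma C1c_outside: "C1c U \<phi> \<Longrightarrow> x \<notin> closure {x. \<phi> x \<noteq> 0} \<Longrightarrow> \<phi> x = 0"
  using closure_subset[of "{x. \<phi> x \<noteq> 0}"] by auto

lemma C1c_borel: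
  assumes "C1c U \<phi>"
  shows "\<phi> \<in> borel_measurable borel" "(\<lambda>x. frechet_derivative \<phi> (at x) e) \<in> borel_measurable borel"
  using C1c_continuous[OF assms] assms by (auto simp: C1c_def intro!: borel_measurable_continuous_onI)

lemma C1c_bounds:
  fixes \<phi> :: "'a::euclidean_space \<Rightarrow> real"
  assumes "C1c U \<phi>"
  obtains B R where "\<forall>x. \<bar>\<phi> x\<bar> \<le> B" "\<forall>x. \<bar>frechet_derivative \<phi> (at x) e\<bar> \<le> B"
    "\<forall>x. R < norm x \<longrightarrow> \<phi> x = 0" "\<forall>x. R < norm x \<longrightarrow> frechet_derivative \<phi> (at x) e = 0"
proof -
  let ?K = "closure {x. \<phi> x \<noteq> 0}"
  have K: "compact ?K" using assms by (simp add: C1c_def)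
  then obtain R where R: "\<And>x. x \<in> ?K \<Longrightarrow> norm x \<le> R" using compact_imp_bounded bounded_iff by metis
  have "bounded (\<phi> ` ?K)"
    by (intro compact_imp_bounded compact_continuous_image continuous_on_subset[OF C1c_continuous[OF assms]] K) simp
  then obtain B1 where B1: "\<And>x. x \<in> ?K \<Longrightarrow> \<bar>\<phi> x\<bar> \<le> B1" unfolding bounded_iff by auto
  have "continuous_on UNIV (\<lambda>x. frechet_derivative \<phi> (at x) e)" using assms by (auto simp: C1c_def)
  then have "bounded ((\<lambda>x. frechet_derivative \<phi> (at x) e) ` ?K)"
    by (intro compact_imp_bounded compact_continuous_image K) (auto intro: continuous_on_subset)
  then obtain B2 where B2: "\<And>x. x \<in> ?K \<Longrightarrow> \<bar>frechet_derivative \<phi> (at x) e\<bar> \<le> B2" unfolding bounded_iff by auto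
  have c: "\<bar>\<phi> x\<bar> \<le> max 0 (max B1 B2)" "\<bar>frechet_derivative \<phi> (at x) e\<bar> \<le> max 0 (max B1 B2)"
    "R < norm x \<Longrightarrow> \<phi> x = 0" "R < norm x \<Longrightarrow> frechet_derivative \<phi> (at x) e = 0" for x
    using B1[of x] B2[of x] R[of x] C1c_outside[OF assms, of x] C1c_frechet_outside[OF assms, of x]
    by (cases "x \<in> ?K"; force)+
  show ?thesis by (rule that[of "max 0 (max B1 B2)" R]) (use c in auto)
qed

lemma C1c_integrable:
  fixes \<phi> :: "'a::euclidean_space \<Rightarrow> real"
  assumes "C1c U \<phi>"
  shows "integrable lborel \<phi>" "integrable lborel (\<lambda>x. frechet_derivative \<phi> (at x) e)"
proof -
  obtain B R where "\<forall>x. \<bar>\<phi> x\<bar> \<le> B" "\<forall>x. \<bar>frechet_derivative \<phi> (at x) e\<bar> \<le> B"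
    "\<forall>x. R < norm x \<longrightarrow> \<phi> x = 0" "\<forall>x. R < norm x \<longrightarrow> frechet_derivative \<phi> (at x) e = 0"
    by (rule C1c_bounds[OF assms, where e=e])
  note C = this[rule_format]
  show "integrable lborel \<phi>"
    by (rule integrable_bounded_support[OF C1c_borel(1)[OF assms] C(1,3)])
  show "integrable lborel (\<lambda>x. frechet_derivative \<phi> (at x) e)"
    by (rule integrable_bounded_support[OF C1c_borel(2)[OF assms] C(2,4)])
qed

lemma integrable_mult_bounded:
  fixes f g :: "'a \<Rightarrow> real"
  assumes "integrable M f" "g \<in> borel_measurable M" "\<And>x. \<bar>g x\<bar> \<le> B"
  shows "integrable M (\<lambda>x. f x * g x)"
proof (rule Bochner_Integration.integrable_bound[where f="\<lambda>x. B * f x"])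
  show "AE x in M. norm (f x * g x) \<le> norm (B * f x)"
  proof (rule AE_I2)
    fix x
    have "\<bar>g x\<bar> \<le> \<bar>B\<bar>" using assms(3)[of x] by linarith
    then have "\<bar>f x\<bar> * \<bar>g x\<bar> \<le> \<bar>f x\<bar> * \<bar>B\<bar>" by (rule mult_left_mono) simp
    then show "norm (f x * g x) \<le> norm (B * f x)" by (simp add: abs_mult mult.commute)
  qed
qed (use assms in auto)

lemma line_derivative:
  fixes w :: "'a::euclidean_space \<Rightarrow> real"
  assumes "(w has_derivative D) (at x)"
  shows "((\<lambda>\<tau>. w (x + \<tau> *\<^sub>R e)) has_real_derivative D e) (at 0)"
proof -
  have 1: "((\<lambda>\<tau>::real. x + \<tau> *\<^sub>R e) has_derivative (\<lambda>\<tau>. \<tau> *\<^sub>R e)) (at 0)"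
    by (auto intro!: derivative_eq_intros)
  have "((\<lambda>\<tau>. w (x + \<tau> *\<^sub>R e)) has_derivative (\<lambda>\<tau>. D (\<tau> *\<^sub>R e))) (at 0)"
    using has_derivative_compose[OF 1, of w D] assms by simp
  moreover have "(\<lambda>\<tau>. D (\<tau> *\<^sub>R e)) = (*) (D e)"
    using linear_scale[OF has_derivative_linear[OF assms]] by (auto simp: fun_eq_iff mult.commute)
  ultimately show ?thesis by (simp add: has_field_derivative_def)
qed

lemma line_lipschitz:
  fixes w :: "'a::euclidean_space \<Rightarrow> real"
  assumes "\<And>x. ((\<lambda>\<tau>. w (x + \<tau> *\<^sub>R e)) has_real_derivative w' x) (at 0)" "\<And>x. \<bar>w' x\<bar> \<le> C"
  shows "\<bar>w (x + \<tau> *\<^sub>R e) - w x\<bar> \<le> C * \<bar>\<tau>\<bar>"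
proof -
  have "((\<lambda>\<tau>. w (x + \<tau> *\<^sub>R e)) has_real_derivative w' (x + t *\<^sub>R e)) (at t)" for t
    using assms(1)[of "x + t *\<^sub>R e"] DERIV_shift[of "\<lambda>s. w (x + s *\<^sub>R e)" "w' (x + t *\<^sub>R e)" 0 t]
    by (simp add: scaleR_add_left add.assoc add.left_commute add.commute)
  then have "norm (w (x + \<tau> *\<^sub>R e) - w (x + 0 *\<^sub>R e)) \<le> C * norm (\<tau> - 0)"
    using assms(2) by (intro field_differentiable_bound[of UNIV "\<lambda>\<tau>. w (x + \<tau> *\<^sub>R e)" "\<lambda>\<tau>. w' (x + \<tau> *\<^sub>R e)"]) auto
  then show ?thesis by simp
qed

lemma difference_quotient_seq:
  fixes w :: "'a::euclidean_space \<Rightarrow> real"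
  assumes "((\<lambda>\<tau>. w (x + \<tau> *\<^sub>R e)) has_real_derivative w') (at 0)"
    and "h \<longlonglongrightarrow> 0" "\<And>n. h n \<noteq> 0"
  shows "(\<lambda>n. (w (x + h n *\<^sub>R e) - w x) / h n) \<longlonglongrightarrow> w'"
  using assms unfolding DERIV_def by (auto simp: tendsto_at_iff_sequentially o_def)

text \<open>
  This replaces the divergence theorem.  The integral of a difference quotient vanishes by translation invariance,
  and the quotients are dominated because the directional derivative is bounded.
\<close>

lemma integral_directional_derivative_zero:
  fixes w :: "'a::euclidean_space \<Rightarrow> real"
  assumes w: "integrable lborel w"
    and d: "\<And>x. ((\<lambda>\<tau>. w (x + \<tau> *\<^sub>R e)) has_real_derivative w' x) (at 0)"
    and b: "\<And>x. \<bar>w' x\<bar> \<le> C" and z: "\<And>x. R < norm x \<Longrightarrow> w x = 0"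
  shows "(LBINT x. w' x) = 0"
proof -
  define h where "h n = 1 / real (Suc n)" for n
  have h: "h \<longlonglongrightarrow> 0" unfolding h_def by (rule LIMSEQ_Suc) (rule lim_1_over_n)
  have hp: "h n > 0" "h n \<le> 1" for n by (auto simp: h_def)
  define q where "q n x = (w (x + h n *\<^sub>R e) - w x) / h n" for n x
  have [measurable]: "w \<in> borel_measurable borel" using w by auto
  have [measurable]: "q n \<in> borel_measurable borel" for n unfolding q_def[abs_def] by measurable
  have qlim: "(\<lambda>n. q n x) \<longlonglongrightarrow> w' x" for x
    unfolding q_def using difference_quotient_seq[OF d h] hp by (metis less_irrefl)
  have [measurable]: "w' \<in> borel_measurable borel"
    by (rule borel_measurable_LIMSEQ_real[OF qlim]) auto
  have "(\<lambda>n. LBINT x. q n x) \<longlonglongrightarrow> (LBINT x. w' x)"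
  proof (rule integral_dominated_convergence[where w="\<lambda>x. C * indicator (cball 0 (R + norm e)) x"])
    show "integrable lborel (\<lambda>x::'a. C * indicator (cball 0 (R + norm e)) x)"
      using emeasure_lborel_cball_finite[of "0::'a"] by (intro integrable_mult_right) (simp add: integrable_indicator_iff)
    show "AE x in lborel. norm (q n x) \<le> C * indicator (cball 0 (R + norm e)) x" for n
    proof (rule AE_I2)
      fix x :: 'a
      show "norm (q n x) \<le> C * indicator (cball 0 (R + norm e)) x"
      proof (cases "norm x \<le> R + norm e")
        case True
        have "\<bar>w (x + h n *\<^sub>R e) - w x\<bar> \<le> C * \<bar>h n\<bar>" by (rule line_lipschitz[OF d b])
        then show ?thesis using True hp[of n] by (simp add: q_def divide_le_eq)
      next
        case False
        have "norm (h n *\<^sub>R e) \<le> norm e" using hp[of n] by (simp add: mult_left_le_one_le)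
        moreover have "norm x \<le> norm (x + h n *\<^sub>R e) + norm (h n *\<^sub>R e)"
          using norm_triangle_ineq4[of "x + h n *\<^sub>R e" "h n *\<^sub>R e"] by simp
        ultimately have "R < norm (x + h n *\<^sub>R e)" using False by linarith
        moreover have "R < norm x" using False norm_ge_zero[of e] by linarith
        ultimately show ?thesis using False z by (simp add: q_def)
      qed
    qed
  qed (use qlim in auto)
  moreover have "(LBINT x. q n x) = 0" for n
  proof -
    have "integrable lborel (\<lambda>x. w (x + h n *\<^sub>R e))" using w by (simp add: lborel_integrable_shift)
    then show ?thesis unfolding q_def using w by (simp add: lborel_integral_shift)
  qed
  ultimately show ?thesis by (simp add: LIMSEQ_const_iff)
qed

lemma mollifier_C1c:
  assumes "r > 0" "cball x r \<subseteq> U"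
  shows "C1c U (\<lambda>y. mollifier r (y - x))"
    and "frechet_derivative (\<lambda>y. mollifier r (y - x)) (at y) = mollifier_deriv r (y - x)"
proof -
  have d: "((\<lambda>y. mollifier r (y - x)) has_derivative mollifier_deriv r (y - x)) (at y)" for y :: 'a
  proof -
    have "((\<lambda>y::'a. y - x) has_derivative (\<lambda>h. h)) (at y)" by (auto intro!: derivative_eq_intros)
    from has_derivative_compose[OF this mollifier_has_derivative] show ?thesis by simp
  qed
  show f: "frechet_derivative (\<lambda>y. mollifier r (y - x)) (at y) = mollifier_deriv r (y - x)" for y
    using frechet_derivative_at[OF d] by simp
  have "{y. mollifier r (y - x) \<noteq> 0} \<subseteq> cball x r"
  proof
    fix y assume "y \<in> {y. mollifier r (y - x) \<noteq> 0}"
    then have "\<not> r \<le> norm (y - x)" using mollifier_eq_0[of r "y - x"] assms(1) by auto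
    then show "y \<in> cball x r" by (simp add: dist_norm norm_minus_commute)
  qed
  then have s: "closure {y. mollifier r (y - x) \<noteq> 0} \<subseteq> cball x r" by (rule closure_minimal) simp
  then have "compact (closure {y. mollifier r (y - x) \<noteq> 0})"
    by (meson bounded_cball bounded_subset closed_closure compact_eq_bounded_closed)
  moreover have "continuous_on UNIV (\<lambda>y. mollifier_deriv r (y - x) h)" for h
    by (rule continuous_on_compose2[OF continuous_mollifier_deriv[of r h]]) (auto intro!: continuous_intros)
  ultimately show "C1c U (\<lambda>y. mollifier r (y - x))"
    using s assms(2) differentiableI[OF d] unfolding C1c_def f by auto
qed

text \<open>
  The defining identity of weak derivatives for a single direction and Borel functions on the whole space, which
  keeps Fubini's theorem and translations free of completions.
\<close>

definition weak_partial :: "'a::euclidean_space set \<Rightarrow> ('a \<Rightarrow> real) \<Rightarrow> ('a \<Rightarrow> real) \<Rightarrow> 'a \<Rightarrow> bool" where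
  "weak_partial U u v e \<longleftrightarrow> (\<forall>\<phi> :: 'a \<Rightarrow> real. C1c U \<phi> \<longrightarrow>
     (LBINT x. u x * frechet_derivative \<phi> (at x) e) = - (LBINT x. v x * \<phi> x))"

lemma mollify_line_derivative:
  fixes f :: "'a::euclidean_space \<Rightarrow> real"
  assumes f: "integrable lborel f" and r: "r > 0"
  shows "((\<lambda>\<tau>. mollify r f (x + \<tau> *\<^sub>R e)) has_real_derivative - (LBINT y. f y * mollifier_deriv r (y - x) e)) (at 0)"
  unfolding DERIV_def tendsto_at_iff_sequentially o_def
proof (intro allI impI)
  fix h :: "nat \<Rightarrow> real" assume h: "\<forall>i. h i \<in> UNIV - {0}" "h \<longlonglongrightarrow> 0"
  have [measurable]: "f \<in> borel_measurable borel" using f by auto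
  obtain B where B: "\<And>z::'a. \<bar>mollifier_deriv r z e\<bar> \<le> B" using mollifier_deriv_bound[of r] r by (metis less_imp_le)
  have d: "((\<lambda>\<tau>. mollifier r (z + \<tau> *\<^sub>R (- e))) has_real_derivative - mollifier_deriv r z e) (at 0)" for z :: 'a
    using line_derivative[OF mollifier_has_derivative[of r z], of "-e"] by (simp add: mollifier_deriv_def)
  have eq: "(mollify r f (x + (0 + h n) *\<^sub>R e) - mollify r f (x + 0 *\<^sub>R e)) / h n =
      (LBINT y. f y * ((mollifier r ((y - x) + h n *\<^sub>R (- e)) - mollifier r (y - x)) / h n))" for n
  proof -
    have "mollify r f (x + h n *\<^sub>R e) - mollify r f x = (LBINT y. f y * mollifier r (y - (x + h n *\<^sub>R e)) - f y * mollifier r (y - x))"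
      unfolding mollify_def by (rule Bochner_Integration.integral_diff[symmetric]; rule integrable_mollify_integrand[OF f])
    then have "(mollify r f (x + h n *\<^sub>R e) - mollify r f x) / h n = (LBINT y. (f y * mollifier r (y - (x + h n *\<^sub>R e)) - f y * mollifier r (y - x)) / h n)"
      by simp
    also have "\<dots> = (LBINT y. f y * ((mollifier r ((y - x) + h n *\<^sub>R (- e)) - mollifier r (y - x)) / h n))"
      by (intro Bochner_Integration.integral_cong) (auto simp: algebra_simps diff_divide_distrib)
    finally show ?thesis by simp
  qed
  have "(\<lambda>n. LBINT y. f y * ((mollifier r ((y - x) + h n *\<^sub>R (- e)) - mollifier r (y - x)) / h n))
      \<longlonglongrightarrow> (LBINT y. f y * - mollifier_deriv r (y - x) e)"
  proof (rule integral_dominated_convergence[where w="\<lambda>y. B * \<bar>f y\<bar>"])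
    show "AE y in lborel. (\<lambda>n. f y * ((mollifier r ((y - x) + h n *\<^sub>R (- e)) - mollifier r (y - x)) / h n))
        \<longlonglongrightarrow> f y * - mollifier_deriv r (y - x) e"
      using h by (intro AE_I2 tendsto_mult_left difference_quotient_seq[OF d]) auto
    show "AE y in lborel. norm (f y * ((mollifier r ((y - x) + h n *\<^sub>R (- e)) - mollifier r (y - x)) / h n)) \<le> B * \<bar>f y\<bar>" for n
    proof (rule AE_I2)
      fix y
      have "\<bar>mollifier r ((y - x) + h n *\<^sub>R (- e)) - mollifier r (y - x)\<bar> \<le> B * \<bar>h n\<bar>"
        by (rule line_lipschitz[OF d]) (use B in simp)
      then have "\<bar>(mollifier r ((y - x) + h n *\<^sub>R (- e)) - mollifier r (y - x)) / h n\<bar> \<le> B"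
        using h(1) by (simp add: abs_divide divide_le_eq)
      then have "\<bar>f y\<bar> * \<bar>(mollifier r ((y - x) + h n *\<^sub>R (- e)) - mollifier r (y - x)) / h n\<bar> \<le> \<bar>f y\<bar> * B"
        by (rule mult_left_mono) simp
      then show "norm (f y * ((mollifier r ((y - x) + h n *\<^sub>R (- e)) - mollifier r (y - x)) / h n)) \<le> B * \<bar>f y\<bar>"
        unfolding real_norm_def abs_mult by (simp add: mult.commute)
    qed
  qed (use f in auto)
  then show "(\<lambda>n. (mollify r f (x + (0 + h n) *\<^sub>R e) - mollify r f (x + 0 *\<^sub>R e)) / h n)
      \<longlonglongrightarrow> - (LBINT y. f y * mollifier_deriv r (y - x) e)"
    unfolding eq by simp
qed

text \<open>
  The kernel is itself an admissible test function as long as its support stays inside \<open>U\<close>; differentiation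
  therefore passes from the kernel to the weak derivative.
\<close>

lemma mollify_weak_partial:
  assumes "weak_partial U u v e" "r > 0" "cball x r \<subseteq> U"
  shows "- (LBINT y. u y * mollifier_deriv r (y - x) e) = mollify r v x"
proof -
  have "(LBINT y. u y * frechet_derivative (\<lambda>y. mollifier r (y - x)) (at y) e) = - (LBINT y. v y * mollifier r (y - x))"
    using assms mollifier_C1c(1) unfolding weak_partial_def by blast
  then show ?thesis by (simp add: mollifier_C1c(2)[OF assms(2,3)] mollify_def)
qed

lemma mollify_bound:
  fixes f :: "'a::euclidean_space \<Rightarrow> real"
  assumes f: "integrable lborel f"
  obtains B where "\<And>x. \<bar>mollify r f x\<bar> \<le> B"
proof -
  obtain B where B: "\<And>z::'a. \<bar>mollifier r z\<bar> \<le> B" using mollifier_bound by blast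
  show ?thesis
  proof
    fix x
    have "\<bar>mollify r f x\<bar> \<le> (LBINT y. \<bar>f y * mollifier r (y - x)\<bar>)"
      unfolding mollify_def using integral_norm_bound[of lborel "\<lambda>y. f y * mollifier r (y - x)"] by simp
    also have "\<dots> \<le> (LBINT y. \<bar>f y\<bar> * B)"
      using f B integrable_abs[OF integrable_mollify_integrand[OF f, of r x]] by (intro integral_mono) (auto simp: abs_mult intro!: mult_left_mono)
    finally show "\<bar>mollify r f x\<bar> \<le> (LBINT y. \<bar>f y\<bar> * B)" .
  qed
qed

lemma mollify_AE_convergent:
  fixes f :: "'a::euclidean_space \<Rightarrow> real"
  assumes f: "integrable lborel f" and r: "r > 0"
  obtains s where "strict_mono s" "AE x in lborel. (\<lambda>k. mollify (r / Suc (s k)) f x) \<longlonglongrightarrow> f x"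
proof -
  have "\<exists>s::nat\<Rightarrow>nat. strict_mono s \<and> (AE x in lborel. (\<lambda>k. mollify (r / Suc (s k)) f x - f x) \<longlonglongrightarrow> 0)"
    by (rule tendsto_L1_AE_subseq) (use mollify_L1_convergent[OF f r] f in auto)
  then show ?thesis using that by (auto simp: LIM_zero_iff)
qed

text \<open>
  The mollified functions satisfy the classical chain rule on the support of \<open>\<phi>\<close>.  A subsequence of the
  mollifications of \<open>u\<close> converges almost everywhere, which handles the bounded continuous factors
  \<open>f (u x)\<close> and \<open>f' (u x)\<close>, while those of \<open>v\<close> converge in \<open>L\<^sup>1\<close>.
\<close>

lemma weak_chain_rule:
  fixes u v \<phi> :: "'a::euclidean_space \<Rightarrow> real" and f :: "real \<Rightarrow> real"
  assumes U: "open U" and u: "integrable lborel u" and v: "integrable lborel v"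
    and wp: "weak_partial U u v e"
    and f: "\<And>y. (f has_real_derivative f' y) (at y)" "continuous_on UNIV f'" "\<And>y. \<bar>f y\<bar> \<le> B" "\<And>y. \<bar>f' y\<bar> \<le> B'"
    and \<phi>: "C1c U \<phi>"
  shows "(LBINT x. f (u x) * frechet_derivative \<phi> (at x) e) = - (LBINT x. f' (u x) * v x * \<phi> x)"
proof -
  let ?K = "closure {x. \<phi> x \<noteq> 0}" and ?D = "\<lambda>x. frechet_derivative \<phi> (at x) e"
  have fc: "continuous_on UNIV f" using f(1) by (meson DERIV_isCont continuous_at_imp_continuous_on)
  note [measurable] = C1c_borel(1)[OF \<phi>] C1c_borel(2)[OF \<phi>, of e]
    borel_measurable_continuous_onI[OF fc] borel_measurable_continuous_onI[OF f(2)]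
  have [measurable]: "u \<in> borel_measurable borel" using u by auto
  have [measurable]: "v \<in> borel_measurable borel" using v by auto
  obtain C R where "\<forall>x. \<bar>\<phi> x\<bar> \<le> C" "\<forall>x. \<bar>?D x\<bar> \<le> C"
    "\<forall>x. R < norm x \<longrightarrow> \<phi> x = 0" "\<forall>x. R < norm x \<longrightarrow> ?D x = 0"
    by (rule C1c_bounds[OF \<phi>, where e=e])
  note C = this[rule_format]
  have nonneg: "0 \<le> B'" "0 \<le> C" "0 \<le> B"
    using order_trans[OF abs_ge_zero f(4)] order_trans[OF abs_ge_zero C(1)] order_trans[OF abs_ge_zero f(3)] by auto
  have f'\<phi>: "\<bar>f' y * \<phi> x\<bar> \<le> B' * C" for x y
    unfolding abs_mult by (intro mult_mono f(4) C(1) nonneg) auto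
  have "compact ?K" "?K \<subseteq> U" using \<phi> by (auto simp: C1c_def)
  then obtain r where r: "r > 0" "(\<Union>x\<in>?K. cball x r) \<subseteq> U"
    using compact_subset_open_imp_cball_epsilon_subset[OF _ U] by blast
  define rr where "rr k = r / Suc k" for k
  have rr: "rr k > 0" "rr k \<le> r" for k using r(1) by (auto simp: rr_def divide_le_eq)
  have id: "(LBINT x. f (mollify (rr k) u x) * ?D x) = - (LBINT x. f' (mollify (rr k) u x) * mollify (rr k) v x * \<phi> x)" for k
  proof -
    let ?u = "mollify (rr k) u" and ?v = "mollify (rr k) v"
    let ?d = "\<lambda>x. - (LBINT y. u y * mollifier_deriv (rr k) (y - x) e)"
    have vd: "?d x * \<phi> x = ?v x * \<phi> x" for x
    proof (cases "x \<in> ?K")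
      case True
      then have "cball x (rr k) \<subseteq> U" using r(2) rr[of k] by (meson UN_subset_iff subset_cball subset_trans)
      then show ?thesis using mollify_weak_partial[OF wp rr(1)] by simp
    next
      case False
      then have "\<phi> x = 0" by (rule C1c_outside[OF \<phi>])
      then show ?thesis by simp
    qed
    obtain Bv where Bv: "\<And>x. \<bar>?v x\<bar> \<le> Bv" using mollify_bound[OF v] by blast
    have bnd1: "\<bar>f' (?u x) * ?v x\<bar> \<le> B' * Bv" for x
      unfolding abs_mult by (intro mult_mono f(4) Bv nonneg) auto
    have "((\<lambda>\<tau>. f (?u (x + \<tau> *\<^sub>R e)) * \<phi> (x + \<tau> *\<^sub>R e)) has_real_derivative
         f' (?u x) * ?v x * \<phi> x + f (?u x) * ?D x) (at 0)" for x
    proof -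
      have "((\<lambda>\<tau>. f (?u (x + \<tau> *\<^sub>R e))) has_real_derivative f' (?u (x + 0 *\<^sub>R e)) * ?d x) (at 0)"
        by (rule DERIV_chain2[OF f(1) mollify_line_derivative[OF u rr(1)]])
      from DERIV_mult[OF this line_derivative[OF C1c_has_derivative[OF \<phi>], of x e]]
      have "((\<lambda>\<tau>. f (?u (x + \<tau> *\<^sub>R e)) * \<phi> (x + \<tau> *\<^sub>R e)) has_real_derivative
         (f' (?u x) * ?d x) * \<phi> x + ?D x * f (?u x)) (at 0)" by simp
      moreover have "(f' (?u x) * ?d x) * \<phi> x + ?D x * f (?u x) = f' (?u x) * ?v x * \<phi> x + f (?u x) * ?D x"
        by (simp only: mult.assoc vd mult.commute[of "?D x"])
      ultimately show ?thesis by (rule subst[rotated])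
    qed
    moreover have "\<bar>f' (?u x) * ?v x * \<phi> x + f (?u x) * ?D x\<bar> \<le> B' * Bv * C + B * C" for x
    proof -
      have "\<bar>f' (?u x) * ?v x * \<phi> x\<bar> \<le> B' * Bv * C"
        unfolding abs_mult[of _ "\<phi> x"] by (intro mult_mono bnd1 C(1) order_trans[OF abs_ge_zero bnd1]) auto
      moreover have "\<bar>f (?u x) * ?D x\<bar> \<le> B * C"
        unfolding abs_mult by (intro mult_mono f(3) C(2) nonneg) auto
      ultimately show ?thesis by linarith
    qed
    moreover have "integrable lborel (\<lambda>x. f (?u x) * \<phi> x)"
      using integrable_mult_bounded[OF C1c_integrable(1)[OF \<phi>], of "\<lambda>x. f (?u x)" B] f(3) by (simp add: mult.commute)
    ultimately have "(LBINT x. f' (?u x) * ?v x * \<phi> x + f (?u x) * ?D x) = 0"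
      using C(3) by (intro integral_directional_derivative_zero[where w="\<lambda>x. f (?u x) * \<phi> x" and R=R and e=e]) auto
    moreover have "integrable lborel (\<lambda>x. f' (?u x) * ?v x * \<phi> x)"
      using integrable_mult_bounded[OF C1c_integrable(1)[OF \<phi>], of "\<lambda>x. f' (?u x) * ?v x" "B' * Bv"] bnd1 by (simp add: mult.commute)
    moreover have "integrable lborel (\<lambda>x. f (?u x) * ?D x)"
      using integrable_mult_bounded[OF C1c_integrable(2)[OF \<phi>, of e], of "\<lambda>x. f (?u x)" B] f(3) by (simp add: mult.commute)
    ultimately show ?thesis by simp
  qed
  obtain s where s: "strict_mono s" "AE x in lborel. (\<lambda>k. mollify (rr (s k)) u x) \<longlonglongrightarrow> u x"
    using mollify_AE_convergent[OF u r(1)] unfolding rr_def by blast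
  have fl: "AE x in lborel. (\<lambda>k. f (mollify (rr (s k)) u x)) \<longlonglongrightarrow> f (u x)"
    using s(2) by eventually_elim (rule continuous_on_tendsto_compose[OF fc], auto)
  have f'l: "AE x in lborel. (\<lambda>k. f' (mollify (rr (s k)) u x)) \<longlonglongrightarrow> f' (u x)"
    using s(2) by eventually_elim (rule continuous_on_tendsto_compose[OF f(2)], auto)
  have L1: "(\<lambda>k. LBINT x. f (mollify (rr (s k)) u x) * ?D x) \<longlonglongrightarrow> (LBINT x. f (u x) * ?D x)"
  proof (rule integral_dominated_convergence[where w="\<lambda>x. B * \<bar>?D x\<bar>"])
    show "AE x in lborel. (\<lambda>k. f (mollify (rr (s k)) u x) * ?D x) \<longlonglongrightarrow> f (u x) * ?D x"
      using fl by eventually_elim (intro tendsto_intros)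
    show "AE x in lborel. norm (f (mollify (rr (s k)) u x) * ?D x) \<le> B * \<bar>?D x\<bar>" for k
      unfolding real_norm_def abs_mult by (intro AE_I2 mult_right_mono f(3)) auto
  qed (use C1c_integrable(2)[OF \<phi>, of e] in auto)
  have i1: "integrable lborel (\<lambda>x. f' (u x) * \<phi> x * v x)"
    using integrable_mult_bounded[OF v, of "\<lambda>x. f' (u x) * \<phi> x" "B' * C"] f'\<phi>
    by (simp add: mult.commute)
  have iv: "integrable lborel (\<lambda>x. f' (mollify (rr k) u x) * \<phi> x * v x)" for k
    using integrable_mult_bounded[OF v, of "\<lambda>x. f' (mollify (rr k) u x) * \<phi> x" "B' * C"] f'\<phi>
    by (simp add: mult.commute)
  have ivk: "integrable lborel (\<lambda>x. f' (mollify (rr k) u x) * \<phi> x * mollify (rr k) v x)" for k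
    using integrable_mult_bounded[OF mollify_L1_convergent(2)[OF v r(1), of k], of "\<lambda>x. f' (mollify (rr k) u x) * \<phi> x" "B' * C"] f'\<phi>
    by (simp add: rr_def mult.commute)
  have L2: "(\<lambda>k. LBINT x. f' (mollify (rr (s k)) u x) * \<phi> x * v x) \<longlonglongrightarrow> (LBINT x. f' (u x) * \<phi> x * v x)"
  proof (rule integral_dominated_convergence[where w="\<lambda>x. B' * C * \<bar>v x\<bar>"])
    show "AE x in lborel. (\<lambda>k. f' (mollify (rr (s k)) u x) * \<phi> x * v x) \<longlonglongrightarrow> f' (u x) * \<phi> x * v x"
      using f'l by eventually_elim (intro tendsto_intros)
    show "AE x in lborel. norm (f' (mollify (rr (s k)) u x) * \<phi> x * v x) \<le> B' * C * \<bar>v x\<bar>" for k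
      unfolding real_norm_def abs_mult[of _ "v _"] by (intro AE_I2 mult_right_mono f'\<phi>) auto
  qed (use v in auto)
  (* The factor in front of v is bounded but varies with k, so the mollified v is first replaced
     by v at the cost of their L1 distance. *)
  have L3: "(\<lambda>k. (LBINT x. f' (mollify (rr (s k)) u x) * \<phi> x * mollify (rr (s k)) v x) - (LBINT x. f' (mollify (rr (s k)) u x) * \<phi> x * v x)) \<longlonglongrightarrow> 0"
  proof (rule Lim_null_comparison)
    show "(\<lambda>k. B' * C * (LBINT x. \<bar>mollify (rr (s k)) v x - v x\<bar>)) \<longlonglongrightarrow> 0"
      using LIMSEQ_subseq_LIMSEQ[OF mollify_L1_convergent(1)[OF v r(1)] s(1)]
      by (intro tendsto_mult_right_zero) (simp add: rr_def o_def)
    show "\<forall>\<^sub>F k in sequentially. norm ((LBINT x. f' (mollify (rr (s k)) u x) * \<phi> x * mollify (rr (s k)) v x) - (LBINT x. f' (mollify (rr (s k)) u x) * \<phi> x * v x))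
       \<le> B' * C * (LBINT x. \<bar>mollify (rr (s k)) v x - v x\<bar>)"
    proof (intro always_eventually allI)
      fix k
      let ?m = "\<lambda>x. f' (mollify (rr (s k)) u x) * \<phi> x"
      have iv': "integrable lborel (mollify (rr (s k)) v)" using mollify_L1_convergent(2)[OF v r(1)] by (simp add: rr_def)
      have "(LBINT x. ?m x * mollify (rr (s k)) v x) - (LBINT x. ?m x * v x) = (LBINT x. ?m x * (mollify (rr (s k)) v x - v x))"
        using iv ivk by (subst Bochner_Integration.integral_diff[symmetric]) (auto simp: right_diff_distrib)
      also have "norm \<dots> \<le> (LBINT x. norm (?m x * (mollify (rr (s k)) v x - v x)))"
        by (rule integral_norm_bound)
      also have "\<dots> \<le> (LBINT x. B' * C * \<bar>mollify (rr (s k)) v x - v x\<bar>)"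
      proof (rule integral_mono)
        show "integrable lborel (\<lambda>x. norm (?m x * (mollify (rr (s k)) v x - v x)))"
          using iv[of "s k"] ivk[of "s k"] by (intro integrable_norm) (simp add: right_diff_distrib)
        show "norm (?m x * (mollify (rr (s k)) v x - v x)) \<le> B' * C * \<bar>mollify (rr (s k)) v x - v x\<bar>" for x
          unfolding real_norm_def abs_mult[of "?m x"] by (intro mult_right_mono f'\<phi>) auto
      qed (use iv' v in auto)
      finally show "norm ((LBINT x. ?m x * mollify (rr (s k)) v x) - (LBINT x. ?m x * v x)) \<le> B' * C * (LBINT x. \<bar>mollify (rr (s k)) v x - v x\<bar>)"
        by simp
    qed
  qed
  have "(\<lambda>k. - (LBINT x. f' (mollify (rr (s k)) u x) * \<phi> x * mollify (rr (s k)) v x)) \<longlonglongrightarrow> - (LBINT x. f' (u x) * \<phi> x * v x)"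
    using tendsto_minus[OF tendsto_add[OF L3 L2]] by simp
  moreover have "- (LBINT x. f' (mollify (rr (s k)) u x) * \<phi> x * mollify (rr (s k)) v x) = (LBINT x. f (mollify (rr (s k)) u x) * ?D x)" for k
    unfolding id by (simp add: mult.commute mult.left_commute)
  ultimately have "(LBINT x. f (u x) * ?D x) = - (LBINT x. f' (u x) * \<phi> x * v x)"
    using L1 LIMSEQ_unique by auto
  then show ?thesis by (simp add: mult.commute mult.left_commute)
qed

text \<open>
  Testing with the mollifier shows that the mollifications vanish at each point of the ball as soon as the radius is
  small; they converge to \<open>f\<close> along a subsequence.
\<close>

lemma fundamental_lemma_ball:
  fixes f :: "'a::euclidean_space \<Rightarrow> real"
  assumes f: "integrable lborel f"
    and z: "\<And>\<phi> :: 'a \<Rightarrow> real. C1c (ball a r) \<phi> \<Longrightarrow> (LBINT x. f x * \<phi> x) = 0"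
  shows "AE x in lborel. x \<in> ball a r \<longrightarrow> f x = 0"
proof -
  obtain s where s: "strict_mono s" "AE x in lborel. (\<lambda>k. mollify (1 / Suc (s k)) f x) \<longlonglongrightarrow> f x"
    using mollify_AE_convergent[OF f zero_less_one] by blast
  from s(2) show ?thesis
  proof (eventually_elim, intro impI)
    fix x assume x: "x \<in> ball a r" and l: "(\<lambda>k. mollify (1 / Suc (s k)) f x) \<longlonglongrightarrow> f x"
    obtain d where d: "d > 0" "cball x d \<subseteq> ball a r" using x open_contains_cball_eq[OF open_ball] by blast
    obtain N :: nat where N: "1 / d < real N" using reals_Archimedean2 by blast
    have "mollify (1 / Suc (s k)) f x = 0" if "k \<ge> N" for k
    proof -
      have "1 / d < real (Suc (s k))" using N that seq_suble[OF s(1), of k] by linarith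
      then have "1 / real (Suc (s k)) < d" using d(1) by (simp add: field_simps del: of_nat_Suc)
      then have "cball x (1 / Suc (s k)) \<subseteq> ball a r" using d(2) by (meson less_imp_le subset_cball subset_trans)
      then show ?thesis unfolding mollify_def by (intro z mollifier_C1c(1)) auto
    qed
    then have "(\<lambda>k. mollify (1 / Suc (s k)) f x) \<longlonglongrightarrow> 0"
      by (intro tendsto_eventually) (auto simp: eventually_sequentially)
    then show "f x = 0" using l LIMSEQ_unique by blast
  qed
qed

section \<open>The coarea inequality\<close>

text \<open>
  A continuously differentiable increasing function with bounded derivative that vanishes on the negative half-line
  and tends to 1 at infinity; \<open>cutoff (k * y)\<close> then tends to the indicator of \<open>y > 0\<close>, including the value 0 at
  \<open>y = 0\<close>.
\<close>

definition cutoff :: "real \<Rightarrow> real" where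
  "cutoff y = (max 0 y)\<^sup>2 / (1 + (max 0 y)\<^sup>2)"

definition cutoff_deriv :: "real \<Rightarrow> real" where
  "cutoff_deriv y = 2 * max 0 y / (1 + (max 0 y)\<^sup>2)\<^sup>2"

lemma one_plus_square_pos: "1 + y\<^sup>2 > (0::real)" by (simp add: add_pos_nonneg)

lemma one_plus_square_neq_0 [simp]: "1 + y\<^sup>2 \<noteq> (0::real)" using one_plus_square_pos[of y] by linarith

lemma cutoff_has_derivative: "(cutoff has_real_derivative cutoff_deriv y) (at y)"
  unfolding cutoff_def[abs_def] cutoff_deriv_def
  by (rule DERIV_cong[OF DERIV_divide[OF square_positive_part_has_derivative DERIV_add[OF DERIV_const square_positive_part_has_derivative]]])
    (simp, simp add: power2_eq_square algebra_simps)

lemma continuous_cutoff_deriv: "continuous_on UNIV cutoff_deriv"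
  unfolding cutoff_deriv_def[abs_def] by (intro continuous_intros) auto

lemma continuous_cutoff: "continuous_on UNIV cutoff"
  unfolding cutoff_def[abs_def] by (intro continuous_intros) auto

lemma borel_cutoff [measurable]: "cutoff \<in> borel_measurable borel" "cutoff_deriv \<in> borel_measurable borel"
  using continuous_cutoff continuous_cutoff_deriv by (auto intro: borel_measurable_continuous_onI)

lemma cutoff_bounds: "0 \<le> cutoff y" "cutoff y \<le> 1"
  using one_plus_square_pos[of "max 0 y"] by (auto simp: cutoff_def divide_le_eq)

lemma cutoff_nonpos: "y \<le> 0 \<Longrightarrow> cutoff y = 0" by (simp add: cutoff_def)

lemma cutoff_deriv_bounds: "0 \<le> cutoff_deriv y" "cutoff_deriv y \<le> 1"
proof -
  let ?p = "max 0 y"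
  show "0 \<le> cutoff_deriv y" by (simp add: cutoff_deriv_def)
  have "(?p - 1)\<^sup>2 \<ge> 0" by (rule zero_le_power2)
  then have "2 * ?p \<le> 1 + ?p\<^sup>2" by (simp add: power2_diff)
  also have "\<dots> \<le> (1 + ?p\<^sup>2) * (1 + ?p\<^sup>2)" using mult_right_mono[of 1 "1 + ?p\<^sup>2" "1 + ?p\<^sup>2"] by simp
  finally show "cutoff_deriv y \<le> 1"
    unfolding cutoff_deriv_def using one_plus_square_pos[of ?p] by (simp add: divide_le_eq power2_eq_square)
qed

lemma cutoff_limit: "(\<lambda>k. cutoff (real k * y)) \<longlonglongrightarrow> (if y > 0 then 1 else 0)"
proof (cases "y > 0")
  case True
  have "(\<lambda>k. 1 - 1 / (1 + (real k * y)\<^sup>2)) \<longlonglongrightarrow> 1 - 0"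
  proof (intro tendsto_diff tendsto_const)
    have 1: "filterlim (\<lambda>k. real k * y) at_top sequentially"
      using True by (intro filterlim_at_top_mult_tendsto_pos[OF tendsto_const] filterlim_real_sequentially) auto
    have "filterlim (\<lambda>k. 1 + (real k * y)\<^sup>2) at_top sequentially"
      by (intro filterlim_tendsto_add_at_top[OF tendsto_const] filterlim_pow_at_top[OF _ 1]) simp
    then show "(\<lambda>k. 1 / (1 + (real k * y)\<^sup>2)) \<longlonglongrightarrow> 0"
      by (intro tendsto_divide_0[OF tendsto_const] filterlim_at_top_imp_at_infinity)
  qed
  moreover have "cutoff (real k * y) = 1 - 1 / (1 + (real k * y)\<^sup>2)" for k
    using True one_plus_square_pos[of "real k * y"] by (simp add: cutoff_def max_def field_simps)
  ultimately show ?thesis using True by simp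
next
  case False
  then have "cutoff (real k * y) = 0" for k by (intro cutoff_nonpos) (simp add: mult_nonneg_nonpos)
  then show ?thesis using False by simp
qed

lemma C1c_component:
  fixes \<phi> :: "'a::euclidean_space \<Rightarrow> 'b::euclidean_space"
  assumes "C1c U \<phi>"
  shows "C1c U (\<lambda>x. \<phi> x \<bullet> b)"
    and "frechet_derivative (\<lambda>x. \<phi> x \<bullet> b) (at x) h = frechet_derivative \<phi> (at x) h \<bullet> b"
proof -
  have d: "((\<lambda>x. \<phi> x \<bullet> b) has_derivative (\<lambda>h. frechet_derivative \<phi> (at x) h \<bullet> b)) (at x)" for x
    by (intro has_derivative_inner_left C1c_has_derivative[OF assms])
  show f: "frechet_derivative (\<lambda>x. \<phi> x \<bullet> b) (at x) h = frechet_derivative \<phi> (at x) h \<bullet> b" for x h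
    using frechet_derivative_at[OF d] by metis
  have s: "closure {x. \<phi> x \<bullet> b \<noteq> 0} \<subseteq> closure {x. \<phi> x \<noteq> 0}" by (intro closure_mono) auto
  then have "compact (closure {x. \<phi> x \<bullet> b \<noteq> 0})"
    using assms unfolding C1c_def by (meson bounded_subset closed_closure compact_eq_bounded_closed)
  then show "C1c U (\<lambda>x. \<phi> x \<bullet> b)"
    using assms s d unfolding C1c_def f by (auto simp: differentiable_def intro!: continuous_intros)
qed

text \<open>
  A Borel representative of a Sobolev function on \<open>\<Omega>\<close> together with its gradient, the latter extended by zero.
\<close>

locale sobolev_function =
  fixes \<Omega> :: "'a::euclidean_space set" and u :: "'a \<Rightarrow> real" and g :: "'a \<Rightarrow> 'a"
  assumes open_domain: "open \<Omega>"
    and u: "integrable lborel u" and g: "integrable lborel g"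
    and g_outside: "\<And>x. x \<notin> \<Omega> \<Longrightarrow> g x = 0"
    and weak: "\<And>i. i \<in> Basis \<Longrightarrow> weak_partial \<Omega> u (\<lambda>x. g x \<bullet> i) i"
begin

lemma measurable_u [measurable]: "u \<in> borel_measurable borel" using u by auto
lemma measurable_g [measurable]: "g \<in> borel_measurable borel" using g by auto
lemma measurable_domain [measurable]: "\<Omega> \<in> sets borel" using open_domain by simp

text \<open>
  The chain rule componentwise, followed by \<open>|g \<bullet> \<phi>| \<le> |g|\<close>.
\<close>

lemma cutoff_divergence_bound:
  assumes \<phi>: "C1c \<Omega> \<phi>" "\<And>x. norm (\<phi> x) \<le> 1"
  shows "(LBINT x. cutoff (real k * (u x - t)) * divergence \<phi> x)
    \<le> (LBINT x. real k * cutoff_deriv (real k * (u x - t)) * norm (g x))"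
proof -
  let ?F = "\<lambda>y. cutoff (real k * (y - t))" and ?F' = "\<lambda>y. real k * cutoff_deriv (real k * (y - t))"
  have dF: "(?F has_real_derivative ?F' y) (at y)" for y
    by (rule DERIV_cong[OF DERIV_chain2[OF cutoff_has_derivative]]) (auto intro!: derivative_eq_intros)
  have cF: "continuous_on UNIV ?F'"
    by (intro continuous_intros continuous_on_compose2[OF continuous_cutoff_deriv]) auto
  have bF: "\<bar>?F y\<bar> \<le> 1" "\<bar>?F' y\<bar> \<le> real k" "0 \<le> ?F' y" for y
    using cutoff_bounds[of "real k * (y - t)"] cutoff_deriv_bounds[of "real k * (y - t)"]
    by (auto simp: abs_mult intro: mult_left_le)
  have [measurable]: "\<phi> \<in> borel_measurable borel" using C1c_borel[OF \<phi>(1)] by simp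
  have gi: "integrable lborel (\<lambda>x. g x \<bullet> i)" for i by (rule integrable_inner_left) (use g in auto)
  have i1: "integrable lborel (\<lambda>x. ?F (u x) * (frechet_derivative \<phi> (at x) i \<bullet> i))" for i
    using integrable_mult_bounded[OF C1c_integrable(2)[OF C1c_component(1)[OF \<phi>(1)], of i i], of "\<lambda>x. ?F (u x)" 1] bF(1)
    by (simp add: C1c_component(2)[OF \<phi>(1)] mult.commute)
  have i2: "integrable lborel (\<lambda>x. ?F' (u x) * (g x \<bullet> i) * (\<phi> x \<bullet> i))" if i: "i \<in> Basis" for i
  proof -
    have "\<bar>\<phi> x \<bullet> i\<bar> \<le> 1" for x using Basis_le_norm[OF i, of "\<phi> x"] \<phi>(2)[of x] by linarith
    then have "\<bar>?F' (u x) * (\<phi> x \<bullet> i)\<bar> \<le> real k * 1" for x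
      unfolding abs_mult[of "?F' (u x)"] using bF(2)[of "u x"] by (intro mult_mono) auto
    then show ?thesis
      using integrable_mult_bounded[OF gi[of i], of "\<lambda>x. ?F' (u x) * (\<phi> x \<bullet> i)" "real k * 1"] by (simp add: mult_ac)
  qed
  have "(LBINT x. ?F (u x) * divergence \<phi> x) = (\<Sum>i\<in>Basis. LBINT x. ?F (u x) * (frechet_derivative \<phi> (at x) i \<bullet> i))"
    unfolding divergence_def sum_distrib_left by (rule Bochner_Integration.integral_sum) (rule i1)
  also have "\<dots> = (\<Sum>i\<in>Basis. - (LBINT x. ?F' (u x) * (g x \<bullet> i) * (\<phi> x \<bullet> i)))"
    using weak_chain_rule[OF open_domain u gi weak dF cF bF(1,2) C1c_component(1)[OF \<phi>(1)]]
    by (intro sum.cong refl) (simp add: C1c_component(2)[OF \<phi>(1)])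
  also have "\<dots> = - (LBINT x. (\<Sum>i\<in>Basis. ?F' (u x) * (g x \<bullet> i) * (\<phi> x \<bullet> i)))"
    unfolding sum_negf by (subst Bochner_Integration.integral_sum) (auto intro: i2)
  also have "(\<lambda>x. \<Sum>i\<in>Basis. ?F' (u x) * (g x \<bullet> i) * (\<phi> x \<bullet> i)) = (\<lambda>x. ?F' (u x) * (g x \<bullet> \<phi> x))"
  proof
    fix x
    have "g x \<bullet> \<phi> x = (\<Sum>i\<in>Basis. (g x \<bullet> i) * (\<phi> x \<bullet> i))" by (rule euclidean_inner)
    then show "(\<Sum>i\<in>Basis. ?F' (u x) * (g x \<bullet> i) * (\<phi> x \<bullet> i)) = ?F' (u x) * (g x \<bullet> \<phi> x)"
      by (simp only: sum_distrib_left mult.assoc)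
  qed
  also have "- (LBINT x. ?F' (u x) * (g x \<bullet> \<phi> x)) \<le> (LBINT x. ?F' (u x) * norm (g x))"
  proof -
    have "integrable lborel (\<lambda>x. norm (g x) * ?F' (u x))"
      by (rule integrable_mult_bounded[OF integrable_norm[OF g]]) (use bF in auto)
    then have i3: "integrable lborel (\<lambda>x. ?F' (u x) * norm (g x))" by (simp add: mult.commute)
    have pt: "\<bar>g x \<bullet> \<phi> x\<bar> \<le> norm (g x)" for x
      using Cauchy_Schwarz_ineq2[of "g x" "\<phi> x"] \<phi>(2)[of x] by (meson mult_left_le norm_ge_zero order_trans)
    have i4: "integrable lborel (\<lambda>x. ?F' (u x) * (g x \<bullet> \<phi> x))"
      by (rule Bochner_Integration.integrable_bound[OF i3]) (use pt bF(3) in \<open>auto simp: abs_mult intro!: mult_left_mono\<close>)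
    have "(LBINT x. - (?F' (u x) * (g x \<bullet> \<phi> x))) \<le> (LBINT x. ?F' (u x) * norm (g x))"
    proof (rule integral_mono)
      fix x
      have "?F' (u x) * (- (g x \<bullet> \<phi> x)) \<le> ?F' (u x) * norm (g x)" using pt[of x] bF(3)[of "u x"] by (intro mult_left_mono) auto
      then show "- (?F' (u x) * (g x \<bullet> \<phi> x)) \<le> ?F' (u x) * norm (g x)" by simp
    qed (use i3 i4 in auto)
    then show ?thesis by simp
  qed
  finally show ?thesis .
qed

lemma superlevel_divergence_limit:
  assumes \<phi>: "C1c \<Omega> \<phi>"
  shows "(\<lambda>k. LBINT x. cutoff (real k * (u x - t)) * divergence \<phi> x)
    \<longlonglongrightarrow> integral\<^sup>L (lebesgue_on {x \<in> \<Omega>. u x > t}) (divergence \<phi>)"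
proof -
  have [measurable]: "(\<lambda>x. frechet_derivative \<phi> (at x) h) \<in> borel_measurable borel" for h using C1c_borel[OF \<phi>] by simp
  have [measurable]: "divergence \<phi> \<in> borel_measurable borel" unfolding divergence_def[abs_def] by measurable
  have di: "integrable lborel (divergence \<phi>)"
    unfolding divergence_def[abs_def]
    using C1c_integrable(2)[OF C1c_component(1)[OF \<phi>]] by (intro Bochner_Integration.integrable_sum) (simp add: C1c_component(2)[OF \<phi>])
  have outside: "divergence \<phi> x = 0" if "x \<notin> \<Omega>" for x
  proof -
    have "x \<notin> closure {x. \<phi> x \<noteq> 0}" using that \<phi> by (auto simp: C1c_def)
    from C1c_frechet_outside[OF \<phi> this] show ?thesis by (simp add: divergence_def)
  qed
  have "integral\<^sup>L (lebesgue_on {x \<in> \<Omega>. u x > t}) (divergence \<phi>) = (\<integral>x. indicator {x \<in> \<Omega>. u x > t} x *\<^sub>R divergence \<phi> x \<partial>lebesgue)"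
    by (rule integral_restrict_space) simp
  also have "\<dots> = (LBINT x. indicator {x \<in> \<Omega>. u x > t} x *\<^sub>R divergence \<phi> x)"
    by (rule integral_completion) measurable
  finally have eq: "integral\<^sup>L (lebesgue_on {x \<in> \<Omega>. u x > t}) (divergence \<phi>) = (LBINT x. indicator {x \<in> \<Omega>. u x > t} x * divergence \<phi> x)"
    by simp
  show ?thesis unfolding eq
  proof (rule integral_dominated_convergence[where w="\<lambda>x. \<bar>divergence \<phi> x\<bar>"])
    show "AE x in lborel. (\<lambda>k. cutoff (real k * (u x - t)) * divergence \<phi> x) \<longlonglongrightarrow> indicator {x \<in> \<Omega>. u x > t} x * divergence \<phi> x"
    proof (rule AE_I2)
      fix x
      have "(\<lambda>k. cutoff (real k * (u x - t)) * divergence \<phi> x) \<longlonglongrightarrow> (if u x - t > 0 then 1 else 0) * divergence \<phi> x"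
        by (intro tendsto_intros cutoff_limit)
      then show "(\<lambda>k. cutoff (real k * (u x - t)) * divergence \<phi> x) \<longlonglongrightarrow> indicator {x \<in> \<Omega>. u x > t} x * divergence \<phi> x"
        using outside[of x] by (cases "x \<in> \<Omega>") (auto simp: indicator_def split: if_splits)
    qed
    show "AE x in lborel. norm (cutoff (real k * (u x - t)) * divergence \<phi> x) \<le> \<bar>divergence \<phi> x\<bar>" for k
      using cutoff_bounds by (intro AE_I2) (auto simp: abs_mult intro: mult_left_le_one_le)
  qed (use di in auto)
qed

text \<open>
  The lower semicontinuity argument for the perimeter: every test field gives a lower bound for the same lower limit,
  which does not depend on the field.
\<close>

lemma perimeter_le_liminf:
  assumes Q: "Q > 0" and \<psi>: "ereal \<psi> \<le> ereal Q * perimeter \<Omega> {x \<in> \<Omega>. u x > t}"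
  shows "ennreal \<psi> \<le> ennreal Q * liminf (\<lambda>k. \<integral>\<^sup>+x. ennreal (real k * cutoff_deriv (real k * (u x - t)) * norm (g x)) \<partial>lborel)"
    (is "_ \<le> _ * liminf ?b")
proof (cases "liminf ?b = \<infinity>")
  case True
  then show ?thesis using Q by (simp add: ennreal_mult_top)
next
  case False
  then obtain l where l: "liminf ?b = ennreal l" "l \<ge> 0" by (cases "liminf ?b") auto
  have "ereal (integral\<^sup>L (lebesgue_on {x \<in> \<Omega>. u x > t}) (divergence \<phi>)) \<le> ereal l"
    if \<phi>: "C1c \<Omega> \<phi>" "\<forall>x. norm (\<phi> x) \<le> 1" for \<phi>
  proof -
    let ?a = "\<lambda>k. LBINT x. cutoff (real k * (u x - t)) * divergence \<phi> x"
    let ?I = "integral\<^sup>L (lebesgue_on {x \<in> \<Omega>. u x > t}) (divergence \<phi>)"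
    have "(\<lambda>k. ennreal (?a k)) \<longlonglongrightarrow> ennreal ?I"
      by (intro tendsto_ennrealI superlevel_divergence_limit \<phi>)
    then have "ennreal ?I = liminf (\<lambda>k. ennreal (?a k))" by (simp add: lim_imp_Liminf)
    also have "\<dots> \<le> liminf ?b"
    proof (intro Liminf_mono always_eventually allI)
      fix k
      have "integrable lborel (\<lambda>x. norm (g x) * (real k * cutoff_deriv (real k * (u x - t))))"
        using cutoff_deriv_bounds by (intro integrable_mult_bounded[where B="real k"] integrable_norm g) (auto simp: abs_mult intro: mult_left_le)
      then have "?b k = ennreal (LBINT x. real k * cutoff_deriv (real k * (u x - t)) * norm (g x))"
        using cutoff_deriv_bounds by (intro nn_integral_eq_integral) (auto simp: mult_ac)
      then show "ennreal (?a k) \<le> ?b k"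
        using cutoff_divergence_bound[OF \<phi>(1), of k t] \<phi>(2) by (simp add: ennreal_leI)
    qed
    finally show ?thesis using l by (simp add: ennreal_le_iff)
  qed
  then have "perimeter \<Omega> {x \<in> \<Omega>. u x > t} \<le> ereal l" unfolding perimeter_def by (intro SUP_least) auto
  then have "ereal Q * perimeter \<Omega> {x \<in> \<Omega>. u x > t} \<le> ereal Q * ereal l" using Q by (intro ereal_mult_left_mono) auto
  from order_trans[OF \<psi> this] have "\<psi> \<le> Q * l" by simp
  then show ?thesis using l Q by (simp add: ennreal_mult[symmetric] ennreal_leI)
qed

text \<open>
  Fatou's lemma moves the lower limit out of the integral over \<open>t\<close>.  After exchanging the integrals, the inner one
  is a difference of two values of the cutoff and converges to the indicator of the layer \<open>t1 < u \<le> t2\<close>.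
\<close>

lemma coarea_inequality:
  assumes Q: "Q > 0" and [measurable]: "\<psi> \<in> borel_measurable borel"
    and \<psi>: "\<And>t. ereal (\<psi> t) \<le> ereal Q * perimeter \<Omega> {x \<in> \<Omega>. u x > t}" and t: "t1 \<le> t2"
  shows "(\<integral>\<^sup>+t. ennreal (\<psi> t) * indicator {t1..t2} t \<partial>lborel)
    \<le> ennreal Q * (\<integral>\<^sup>+x. ennreal (norm (g x)) * indicator {x. t1 < u x \<and> u x \<le> t2} x \<partial>lborel)"
proof -
  let ?h = "\<lambda>k t x. real k * cutoff_deriv (real k * (u x - t))"
  let ?d = "\<lambda>k x. cutoff (real k * (u x - t1)) - cutoff (real k * (u x - t2))"
  have mono: "cutoff y \<le> cutoff z" if "y \<le> z" for y z
    using DERIV_nonneg_imp_nondecreasing[OF that, of cutoff] cutoff_has_derivative cutoff_deriv_bounds by blast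
  have d0: "0 \<le> ?d k x" for k x
    using mono[of "real k * (u x - t2)" "real k * (u x - t1)"] t by (simp add: mult_left_mono)
  have d1: "?d k x \<le> 1" for k x
    using cutoff_bounds[of "real k * (u x - t1)"] cutoff_bounds[of "real k * (u x - t2)"] by linarith
  have inner: "(\<integral>\<^sup>+t. ennreal (?h k t x) * indicator {t1..t2} t \<partial>lborel) = ennreal (?d k x)" for k x
  proof -
    have "(\<integral>\<^sup>+t. ennreal (?h k t x) * indicator {t1..t2} t \<partial>lborel) = ennreal (- cutoff (real k * (u x - t2)) - - cutoff (real k * (u x - t1)))"
    proof (rule nn_integral_FTC_Icc)
      show "((\<lambda>t. - cutoff (real k * (u x - t))) has_real_derivative ?h k s x) (at s)" for s
        by (rule DERIV_cong[OF DERIV_minus[OF DERIV_chain2[OF cutoff_has_derivative]]]) (auto intro!: derivative_eq_intros)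
    qed (use cutoff_deriv_bounds t in auto)
    then show ?thesis by simp
  qed
  have "(\<integral>\<^sup>+t. ennreal (\<psi> t) * indicator {t1..t2} t \<partial>lborel)
      \<le> (\<integral>\<^sup>+t. ennreal Q * liminf (\<lambda>k. (\<integral>\<^sup>+x. ennreal (?h k t x * norm (g x)) \<partial>lborel) * indicator {t1..t2} t) \<partial>lborel)"
  proof (rule nn_integral_mono)
    fix t
    show "ennreal (\<psi> t) * indicator {t1..t2} t \<le> ennreal Q * liminf (\<lambda>k. (\<integral>\<^sup>+x. ennreal (?h k t x * norm (g x)) \<partial>lborel) * indicator {t1..t2} t)"
      using perimeter_le_liminf[OF Q \<psi>[of t]] by (auto simp: indicator_def)
  qed
  also have "\<dots> = ennreal Q * (\<integral>\<^sup>+t. liminf (\<lambda>k. (\<integral>\<^sup>+x. ennreal (?h k t x * norm (g x)) \<partial>lborel) * indicator {t1..t2} t) \<partial>lborel)"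
    by (rule nn_integral_cmult) measurable
  also have "\<dots> \<le> ennreal Q * liminf (\<lambda>k. \<integral>\<^sup>+t. (\<integral>\<^sup>+x. ennreal (?h k t x * norm (g x)) \<partial>lborel) * indicator {t1..t2} t \<partial>lborel)"
    by (intro mult_left_mono nn_integral_liminf) auto
  also have "(\<lambda>k. \<integral>\<^sup>+t. (\<integral>\<^sup>+x. ennreal (?h k t x * norm (g x)) \<partial>lborel) * indicator {t1..t2} t \<partial>lborel)
     = (\<lambda>k. \<integral>\<^sup>+x. ennreal (?d k x * norm (g x)) \<partial>lborel)"
  proof
    fix k
    have "(\<integral>\<^sup>+t. (\<integral>\<^sup>+x. ennreal (?h k t x * norm (g x)) \<partial>lborel) * indicator {t1..t2} t \<partial>lborel)
       = (\<integral>\<^sup>+t. (\<integral>\<^sup>+x. ennreal (?h k t x * norm (g x)) * indicator {t1..t2} t \<partial>lborel) \<partial>lborel)"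
      by (intro nn_integral_cong nn_integral_multc[symmetric]) measurable
    also have "\<dots> = (\<integral>\<^sup>+x. (\<integral>\<^sup>+t. ennreal (?h k t x * norm (g x)) * indicator {t1..t2} t \<partial>lborel) \<partial>lborel)"
      by (rule lborel_pair.Fubini') measurable
    also have "\<dots> = (\<integral>\<^sup>+x. (\<integral>\<^sup>+t. (ennreal (?h k t x) * indicator {t1..t2} t) * ennreal (norm (g x)) \<partial>lborel) \<partial>lborel)"
      using cutoff_deriv_bounds by (intro nn_integral_cong) (simp add: ennreal_mult mult_ac)
    also have "\<dots> = (\<integral>\<^sup>+x. ennreal (?d k x) * ennreal (norm (g x)) \<partial>lborel)"
      by (subst nn_integral_multc) (auto simp only: inner, measurable)
    also have "\<dots> = (\<integral>\<^sup>+x. ennreal (?d k x * norm (g x)) \<partial>lborel)"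
      using d0 by (intro nn_integral_cong) (simp add: ennreal_mult)
    finally show "(\<integral>\<^sup>+t. (\<integral>\<^sup>+x. ennreal (?h k t x * norm (g x)) \<partial>lborel) * indicator {t1..t2} t \<partial>lborel) = (\<integral>\<^sup>+x. ennreal (?d k x * norm (g x)) \<partial>lborel)" .
  qed
  also have "liminf (\<lambda>k. \<integral>\<^sup>+x. ennreal (?d k x * norm (g x)) \<partial>lborel) = (\<integral>\<^sup>+x. ennreal (norm (g x)) * indicator {x. t1 < u x \<and> u x \<le> t2} x \<partial>lborel)"
  proof (rule lim_imp_Liminf)
    show "(\<lambda>k. \<integral>\<^sup>+x. ennreal (?d k x * norm (g x)) \<partial>lborel) \<longlonglongrightarrow> (\<integral>\<^sup>+x. ennreal (norm (g x)) * indicator {x. t1 < u x \<and> u x \<le> t2} x \<partial>lborel)"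
    proof (rule nn_integral_dominated_convergence[where w="\<lambda>x. ennreal (norm (g x))"])
      show "AE x in lborel. (\<lambda>k. ennreal (?d k x * norm (g x))) \<longlonglongrightarrow> ennreal (norm (g x)) * indicator {x. t1 < u x \<and> u x \<le> t2} x"
      proof (rule AE_I2)
        fix x
        have "(\<lambda>k. ?d k x * norm (g x)) \<longlonglongrightarrow> ((if u x - t1 > 0 then 1 else 0) - (if u x - t2 > 0 then 1 else 0)) * norm (g x)"
          by (intro tendsto_intros cutoff_limit)
        from tendsto_ennrealI[OF this]
        show "(\<lambda>k. ennreal (?d k x * norm (g x))) \<longlonglongrightarrow> ennreal (norm (g x)) * indicator {x. t1 < u x \<and> u x \<le> t2} x"
          using t by (auto simp: indicator_def split: if_splits)
      qed
      show "AE x in lborel. ennreal (?d k x * norm (g x)) \<le> ennreal (norm (g x))" for k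
        using d0 d1 by (intro AE_I2 ennreal_leI mult_left_le_one_le) auto
      show "(\<integral>\<^sup>+x. ennreal (norm (g x)) \<partial>lborel) < \<infinity>" using g by (simp add: integrable_iff_bounded)
    qed measurable
  qed simp
  finally show ?thesis .
qed

end

section \<open>Inequalities between measures on the line\<close>

lemma open_dyadic_union:
  fixes U :: "real set"
  assumes "open U"
  defines "J \<equiv> \<lambda>k::nat. {j::int. {real_of_int j / 2^k..(real_of_int j + 1) / 2^k} \<subseteq> U}"
  defines "I \<equiv> \<lambda>(k::nat) (j::int). {real_of_int j / 2^k<..(real_of_int j + 1) / 2^k}"
  shows "incseq (\<lambda>k. \<Union>j\<in>J k. I k j)" "(\<Union>k. \<Union>j\<in>J k. I k j) = U" "disjoint_family_on (I k) (J k)"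
proof -
  show "incseq (\<lambda>k. \<Union>j\<in>J k. I k j)"
  proof (rule incseq_SucI, rule subsetI)
    fix k x assume "x \<in> (\<Union>j\<in>J k. I k j)"
    then obtain j where j: "{real_of_int j / 2^k..(real_of_int j + 1) / 2^k} \<subseteq> U" "real_of_int j / 2^k < x" "x \<le> (real_of_int j + 1) / 2^k"
      by (auto simp: J_def I_def)
    define i where "i = (if x \<le> (real_of_int (2 * j) + 1) / 2^Suc k then 2 * j else 2 * j + 1)"
    have e: "real_of_int j / 2^k = real_of_int (2*j) / 2^Suc k" "(real_of_int j + 1) / 2^k = (real_of_int (2*j+1) + 1) / 2^Suc k"
      by (simp_all add: field_simps)
    have "real_of_int j / 2^k \<le> real_of_int i / 2^Suc k" "(real_of_int i + 1) / 2^Suc k \<le> (real_of_int j + 1) / 2^k"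
      unfolding e i_def by (auto simp del: power_Suc intro!: divide_right_mono)
    then have "{real_of_int i / 2^Suc k..(real_of_int i + 1) / 2^Suc k} \<subseteq> U"
      using j(1) by (meson atLeastatMost_subset_iff order_trans)
    moreover have "real_of_int i / 2^Suc k < x" "x \<le> (real_of_int i + 1) / 2^Suc k"
      using j(2,3) unfolding e i_def by (auto simp: not_le)
    ultimately show "x \<in> (\<Union>j\<in>J (Suc k). I (Suc k) j)" by (auto simp: J_def I_def)
  qed
  show "(\<Union>k. \<Union>j\<in>J k. I k j) = U"
  proof
    show "(\<Union>k. \<Union>j\<in>J k. I k j) \<subseteq> U" by (force simp: J_def I_def)
    show "U \<subseteq> (\<Union>k. \<Union>j\<in>J k. I k j)"
    proof
      fix x assume "x \<in> U"
      then obtain d where d: "d > 0" "ball x d \<subseteq> U" using assms(1) openE by blast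
      obtain k :: nat where "1 / d < 2 ^ k" using real_arch_pow[of 2 "1/d"] by auto
      then have k: "1 / 2^k < d" using d(1) by (simp add: field_simps)
      define j where "j = \<lceil>x * 2^k\<rceil> - 1"
      have "real_of_int j < x * 2^k" "x * 2^k \<le> real_of_int j + 1" unfolding j_def by linarith+
      then have j: "real_of_int j / 2^k < x" "x \<le> (real_of_int j + 1) / 2^k" by (simp_all add: field_simps)
      have e: "(real_of_int j + 1) / 2^k = real_of_int j / 2^k + 1 / 2^k" by (simp add: add_divide_distrib)
      have "{real_of_int j / 2^k..(real_of_int j + 1) / 2^k} \<subseteq> ball x d"
      proof
        fix y assume "y \<in> {real_of_int j / 2^k..(real_of_int j + 1) / 2^k}"
        then have "real_of_int j / 2^k \<le> y" "y \<le> real_of_int j / 2^k + 1 / 2^k" by (auto simp: e)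
        then have "\<bar>x - y\<bar> < d" using j k unfolding e by linarith
        then show "y \<in> ball x d" by (simp add: dist_real_def)
      qed
      then have "j \<in> J k" "x \<in> I k j" using d(2) j by (auto simp: J_def I_def)
      then show "x \<in> (\<Union>k. \<Union>j\<in>J k. I k j)" by blast
    qed
  qed
  show "disjoint_family_on (I k) (J k)"
  proof -
    have "i = j" if "x \<in> I k i" "x \<in> I k j" for i j x
    proof -
      have "real_of_int i < x * 2^k" "x * 2^k \<le> real_of_int i + 1" "real_of_int j < x * 2^k" "x * 2^k \<le> real_of_int j + 1"
        using that by (auto simp: I_def field_simps)
      then have "real_of_int i < real_of_int j + 1" "real_of_int j < real_of_int i + 1" by linarith+
      then show ?thesis by linarith
    qed
    then show ?thesis unfolding disjoint_family_on_def by fastforce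
  qed
qed

text \<open>
  Open sets are increasing unions of disjoint half-open dyadic intervals, and outer regularity of both measures on
  the right carries the inequality from open sets to Borel sets.  Intervals are required to have their closure in
  \<open>S\<close>, so that the endpoints of \<open>S\<close> never occur.
\<close>

lemma interval_inequality_imp_borel_inequality:
  fixes \<theta> \<nu> :: "real measure" and c d :: ennreal
  assumes sets: "sets \<theta> = sets borel" "sets \<nu> = sets borel"
    and fin: "emeasure \<nu> UNIV < \<infinity>" and d: "d < \<infinity>" and S: "open S" "emeasure lborel S < \<infinity>"
    and ineq: "\<And>s1 s2. s1 < s2 \<Longrightarrow> {s1..s2} \<subseteq> S \<Longrightarrow>
      c * emeasure \<theta> {s1<..s2} \<le> d * emeasure lborel {s1<..s2} + emeasure \<nu> {s1<..s2}"
    and A: "A \<in> sets borel" "A \<subseteq> S"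
  shows "c * emeasure \<theta> A \<le> d * emeasure lborel A + emeasure \<nu> A"
proof -
  note [simp] = sets
  have [simp]: "space \<nu> = UNIV" "space \<theta> = UNIV" using sets[THEN sets_eq_imp_space_eq] by auto
  have opn: "c * emeasure \<theta> U \<le> d * emeasure lborel U + emeasure \<nu> U" if U: "open U" "U \<subseteq> S" for U
  proof -
    define J where "J = (\<lambda>k::nat. {j::int. {real_of_int j / 2^k..(real_of_int j + 1) / 2^k} \<subseteq> U})"
    define I where "I = (\<lambda>(k::nat) (j::int). {real_of_int j / 2^k<..(real_of_int j + 1) / 2^k})"
    have dy: "incseq (\<lambda>k. \<Union>j\<in>J k. I k j)" "(\<Union>k. \<Union>j\<in>J k. I k j) = U" "disjoint_family_on (I k) (J k)" for k
      using open_dyadic_union[OF U(1)] unfolding J_def I_def by auto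
    have [measurable]: "(\<Union>j\<in>J k. I k j) \<in> sets borel" for k
      by (intro sets.countable_UN') (auto simp: I_def)
    have [measurable]: "U \<in> sets borel" using U by simp
    have cs: "emeasure M (\<Union>j\<in>J k. I k j) = (\<integral>\<^sup>+j. emeasure M (I k j) \<partial>count_space (J k))" if "sets M = sets borel" for M :: "real measure" and k
      by (rule emeasure_UN_countable[OF _ _ dy(3)]) (auto simp: that I_def)
    have k: "c * emeasure \<theta> (\<Union>j\<in>J k. I k j) \<le> d * emeasure lborel U + emeasure \<nu> U" for k
    proof -
      have "c * emeasure \<theta> (\<Union>j\<in>J k. I k j) = (\<integral>\<^sup>+j. c * emeasure \<theta> (I k j) \<partial>count_space (J k))"
        by (simp add: cs nn_integral_cmult)
      also have "\<dots> \<le> (\<integral>\<^sup>+j. d * emeasure lborel (I k j) + emeasure \<nu> (I k j) \<partial>count_space (J k))"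
      proof (rule nn_integral_mono)
        fix j assume "j \<in> space (count_space (J k))"
        then have "{real_of_int j / 2^k..(real_of_int j + 1) / 2^k} \<subseteq> S" using U(2) by (auto simp: J_def)
        then show "c * emeasure \<theta> (I k j) \<le> d * emeasure lborel (I k j) + emeasure \<nu> (I k j)"
          unfolding I_def by (intro ineq) (auto intro: divide_strict_right_mono)
      qed
      also have "\<dots> = d * emeasure lborel (\<Union>j\<in>J k. I k j) + emeasure \<nu> (\<Union>j\<in>J k. I k j)"
        by (simp add: cs nn_integral_add nn_integral_cmult)
      also have "\<dots> \<le> d * emeasure lborel U + emeasure \<nu> U"
        using dy(2) by (intro add_mono mult_left_mono emeasure_mono) auto
      finally show ?thesis .
    qed
    have "c * emeasure \<theta> U = c * (SUP k. emeasure \<theta> (\<Union>j\<in>J k. I k j))"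
      using dy(1,2) by (subst SUP_emeasure_incseq) auto
    also have "\<dots> = (SUP k. c * emeasure \<theta> (\<Union>j\<in>J k. I k j))" by (simp add: SUP_mult_left_ennreal)
    also have "\<dots> \<le> d * emeasure lborel U + emeasure \<nu> U" by (intro SUP_least k)
    finally show ?thesis .
  qed
  have fA: "emeasure lborel A < \<infinity>" using emeasure_mono[of A S lborel] A(2) S by (auto intro: order.strict_trans1)
  have fnA: "emeasure \<nu> A < \<infinity>" using emeasure_mono[of A UNIV \<nu>] fin by (auto intro: order.strict_trans1)
  show ?thesis
  proof (rule ennreal_le_epsilon)
    fix e :: real assume e: "e > 0"
    obtain d' where d': "d = ennreal d'" "d' \<ge> 0" using d by (cases d) auto
    define e' where "e' = e / (d' + 1)"
    have e': "e' > 0" using e d' by (simp add: e'_def)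
    have "(d' + 1) * e' = e" using d'(2) unfolding e'_def by simp
    then have "d' * e' + e' = e" by (simp add: algebra_simps)
    obtain U1 where U1: "open U1" "A \<subseteq> U1" "emeasure lborel (U1 - A) < ennreal e'"
      using outer_regular_lborel[OF A(1) e'] by blast
    have "emeasure \<nu> A < emeasure \<nu> A + ennreal e'"
    proof -
      obtain r where "emeasure \<nu> A = ennreal r" "r \<ge> 0" using fnA by (cases "emeasure \<nu> A") auto
      then show ?thesis using e' by (simp add: ennreal_plus[symmetric] ennreal_less_iff del: ennreal_plus)
    qed
    then have "(INF U \<in> {U. A \<subseteq> U \<and> open U}. emeasure \<nu> U) < emeasure \<nu> A + ennreal e'"
      using outer_regular[of \<nu> A] A fin by auto
    then obtain U2 where U2: "open U2" "A \<subseteq> U2" "emeasure \<nu> U2 < emeasure \<nu> A + ennreal e'"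
      by (auto simp: INF_less_iff)
    define U where "U = U1 \<inter> U2 \<inter> S"
    have U: "open U" "A \<subseteq> U" "U \<subseteq> S" "U \<subseteq> U1" "U \<subseteq> U2" using U1 U2 S A by (auto simp: U_def)
    have lU: "emeasure lborel U \<le> emeasure lborel A + ennreal e'"
    proof -
      have "emeasure lborel U \<le> emeasure lborel (A \<union> (U1 - A))" using U U1 A by (intro emeasure_mono) auto
      also have "\<dots> \<le> emeasure lborel A + emeasure lborel (U1 - A)" using U1 A by (intro emeasure_subadditive) auto
      also have "\<dots> \<le> emeasure lborel A + ennreal e'" using U1(3) by (intro add_left_mono) simp
      finally show ?thesis .
    qed
    have nU: "emeasure \<nu> U \<le> emeasure \<nu> A + ennreal e'"
      using emeasure_mono[of U U2 \<nu>] U U2 by (auto intro: order.trans less_imp_le)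
    have "c * emeasure \<theta> A \<le> c * emeasure \<theta> U" using U by (intro mult_left_mono emeasure_mono) auto
    also have "\<dots> \<le> d * emeasure lborel U + emeasure \<nu> U" by (rule opn[OF U(1,3)])
    also have "\<dots> \<le> d * (emeasure lborel A + ennreal e') + (emeasure \<nu> A + ennreal e')"
      by (intro add_mono mult_left_mono lU nU) simp
    also have "\<dots> = d * emeasure lborel A + emeasure \<nu> A + (d * ennreal e' + ennreal e')" by (simp add: distrib_left ac_simps)
    also have "d * ennreal e' + ennreal e' = ennreal e"
      using d' e' \<open>d' * e' + e' = e\<close> by (simp add: ennreal_mult[symmetric] ennreal_plus[symmetric] del: ennreal_plus)
    finally show "c * emeasure \<theta> A \<le> d * emeasure lborel A + emeasure \<nu> A + ennreal e" .
  qed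
qed

text \<open>
  Letting \<open>a\<close> depend on the point, the hypothesis says \<open>2 \<integral> a d\<theta> \<le> \<integral> a\<^sup>2 ds + \<nu> S\<close> for simple functions
  \<open>a\<close>.  Choosing \<open>a\<close> close to the density of \<open>\<theta>\<close> bounds its square integral.
\<close>

lemma square_integrable_density_exists:
  fixes \<theta> \<nu> :: "real measure"
  assumes sets: "sets \<theta> = sets borel" "sets \<nu> = sets borel"
    and fin: "emeasure \<nu> UNIV < \<infinity>" and S: "S \<in> sets borel" "emeasure lborel S < \<infinity>"
    and ineq: "\<And>a A. a > 0 \<Longrightarrow> A \<in> sets borel \<Longrightarrow> A \<subseteq> S \<Longrightarrow>
      ennreal (2 * a) * emeasure \<theta> A \<le> ennreal (a\<^sup>2) * emeasure lborel A + emeasure \<nu> A"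
  obtains p :: "real \<Rightarrow> real" where "p \<in> borel_measurable borel" "\<forall>s. p s \<ge> 0"
    "\<forall>A\<in>sets borel. A \<subseteq> S \<longrightarrow> emeasure \<theta> A = (\<integral>\<^sup>+s. ennreal (p s) * indicator A s \<partial>lborel)"
    "(\<integral>\<^sup>+s. ennreal ((p s)\<^sup>2) * indicator S s \<partial>lborel) \<le> emeasure \<nu> UNIV"
proof -
  note [measurable] = S(1)
  note [simp] = sets
  have [simp]: "space \<theta> = UNIV" "space \<nu> = UNIV" using sets[THEN sets_eq_imp_space_eq] by auto
  have [measurable_cong]: "sets \<theta> = sets borel" by fact
  define N where "N = emeasure \<nu> UNIV"
  have Nle: "emeasure \<nu> A \<le> N" if "A \<in> sets borel" for A
    unfolding N_def using that by (intro emeasure_mono) auto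
  have thS: "emeasure \<theta> S < \<infinity>"
  proof -
    have "ennreal 2 * emeasure \<theta> S \<le> emeasure lborel S + emeasure \<nu> S" using ineq[of 1 S] S by simp
    also have "\<dots> < \<infinity>" using S(2) Nle[OF S(1)] fin unfolding N_def by (auto simp: ennreal_add_less_top intro: order.strict_trans1)
    finally show ?thesis by (auto simp: ennreal_mult_less_top)
  qed
  define \<theta>' where "\<theta>' = density \<theta> (indicator S)"
  have \<theta>': "emeasure \<theta>' A = emeasure \<theta> (S \<inter> A)" if "A \<in> sets borel" for A
    unfolding \<theta>'_def using that by (subst emeasure_density) (auto simp: indicator_inter_arith[symmetric])
  (* On a Lebesgue null set A the hypothesis reads 2 a theta(A) <= nu(A) for every a > 0, and the
     right-hand side is bounded. *)
  have "absolutely_continuous lborel \<theta>'"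
    unfolding absolutely_continuous_def
  proof
    fix A :: "real set" assume A: "A \<in> null_sets lborel"
    then have [measurable]: "A \<in> sets borel" by auto
    have "emeasure lborel (S \<inter> A) \<le> emeasure lborel A" by (intro emeasure_mono) auto
    then have l0: "emeasure lborel (S \<inter> A) = 0" using A by (auto simp: null_sets_def)
    have "emeasure \<theta> (S \<inter> A) = 0"
    proof (rule ccontr)
      assume "emeasure \<theta> (S \<inter> A) \<noteq> 0"
      moreover have "emeasure \<theta> (S \<inter> A) \<le> emeasure \<theta> S" by (intro emeasure_mono) auto
      ultimately obtain x where x: "emeasure \<theta> (S \<inter> A) = ennreal x" "x > 0"
        using thS by (cases "emeasure \<theta> (S \<inter> A)") (auto simp: top_unique)
      obtain n where n: "N = ennreal n" "n \<ge> 0" using fin by (cases N) (auto simp: N_def)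
      define a where "a = (n + 1) / x"
      have a: "a > 0" using x n by (simp add: a_def)
      have "ennreal (2 * a) * emeasure \<theta> (S \<inter> A) \<le> ennreal n"
        using ineq[OF a, of "S \<inter> A"] Nle[of "S \<inter> A"] n by (auto simp: l0 intro: order_trans)
      then have "2 * a * x \<le> n" using x a n by (simp add: ennreal_mult[symmetric] ennreal_le_iff)
      then show False using x n by (simp add: a_def)
    qed
    then show "A \<in> null_sets \<theta>'" by (simp add: null_sets_def \<theta>') (simp add: \<theta>'_def)
  qed
  from sigma_finite_measure.Radon_Nikodym[OF sigma_finite_lborel this] obtain f where [measurable]: "f \<in> borel_measurable borel" and f: "density lborel f = \<theta>'"
    by (auto simp: \<theta>'_def)
  have fA: "(\<integral>\<^sup>+s. f s * indicator A s \<partial>lborel) = emeasure \<theta> (S \<inter> A)" if [measurable]: "A \<in> sets borel" for A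
    using \<theta>'[OF that] emeasure_density[of f lborel A] unfolding f by simp
  have "(\<integral>\<^sup>+s. f s \<partial>lborel) = emeasure \<theta> S" using fA[of UNIV] by simp
  then have ffin: "AE s in lborel. f s \<noteq> \<infinity>" using thS by (intro nn_integral_PInf_AE) auto
  (* With a equal to the value of b on each of its level sets, 2 int b^2 <= 2 int b f <= int b^2 + N.
     The integral of b^2 is finite because b is simple and S has finite measure, so it cancels. *)
  have simple: "(\<integral>\<^sup>+s. (b s)\<^sup>2 * indicator S s \<partial>lborel) \<le> N"
    if b: "simple_function lborel b" "\<And>s. b s < \<infinity>" "\<And>s. b s \<le> f s" for b
  proof -
    have [measurable]: "b \<in> borel_measurable borel" using borel_measurable_simple_function[OF b(1)] by simp
    define V where "V = range b"
    have V: "finite V" using simple_functionD(1)[OF b(1)] by (simp add: V_def)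
    define P where "P v = S \<inter> b -` {v}" for v
    have [measurable]: "P v \<in> sets borel" for v unfolding P_def using measurable_sets[of b borel borel "{v}"] by auto
    have dec: "g (b s) * indicator S s = (\<Sum>v\<in>V. g v * indicator (P v) s)" for g :: "ennreal \<Rightarrow> ennreal" and s
    proof -
      have "(\<Sum>v\<in>V. g v * indicator (P v) s) = (\<Sum>v\<in>V. if v = b s then g (b s) * indicator S s else 0)"
        by (intro sum.cong refl) (auto simp: P_def indicator_def)
      also have "\<dots> = g (b s) * indicator S s" using V by (simp add: V_def)
      finally show ?thesis ..
    qed
    have each: "2 * v * emeasure \<theta> (P v) \<le> v\<^sup>2 * emeasure lborel (P v) + emeasure \<nu> (P v)" if "v \<in> V" for v
    proof -
      obtain s where "v = b s" using \<open>v \<in> V\<close> by (auto simp: V_def)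
      then have "v < \<infinity>" using b(2)[of s] by simp
      then obtain a where a: "v = ennreal a" "a \<ge> 0" by (cases v) auto
      show ?thesis
      proof (cases "a = 0")
        case False
        then show ?thesis using ineq[of a "P v"] a
          by (auto simp: P_def ennreal_mult ennreal_power[symmetric] power2_eq_square)
      qed (simp add: a)
    qed
    have "2 * (\<integral>\<^sup>+s. (b s)\<^sup>2 * indicator S s \<partial>lborel) = (\<integral>\<^sup>+s. 2 * ((b s)\<^sup>2 * indicator S s) \<partial>lborel)"
      by (rule nn_integral_cmult[symmetric]) measurable
    also have "\<dots> \<le> (\<integral>\<^sup>+s. (2 * b s * indicator S s) * f s \<partial>lborel)"
      using b(3) by (intro nn_integral_mono) (auto simp: indicator_def power2_eq_square mult.assoc intro!: mult_left_mono)
    also have "\<dots> = (\<integral>\<^sup>+s. (\<Sum>v\<in>V. (2 * v) * (f s * indicator (P v) s)) \<partial>lborel)"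
      unfolding dec[of "\<lambda>v. 2 * v"] sum_distrib_right by (intro nn_integral_cong sum.cong refl) (simp add: mult_ac)
    also have "\<dots> = (\<Sum>v\<in>V. 2 * v * emeasure \<theta> (P v))"
    proof (subst nn_integral_sum)
      show "(\<Sum>v\<in>V. \<integral>\<^sup>+s. 2 * v * (f s * indicator (P v) s) \<partial>lborel) = (\<Sum>v\<in>V. 2 * v * emeasure \<theta> (P v))"
      proof (intro sum.cong refl)
        fix v
        have "S \<inter> P v = P v" by (auto simp: P_def)
        then show "(\<integral>\<^sup>+s. 2 * v * (f s * indicator (P v) s) \<partial>lborel) = 2 * v * emeasure \<theta> (P v)"
          using fA[of "P v"] by (subst nn_integral_cmult) auto
      qed
    qed measurable
    also have "\<dots> \<le> (\<Sum>v\<in>V. v\<^sup>2 * emeasure lborel (P v) + emeasure \<nu> (P v))" by (intro sum_mono each)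
    also have "\<dots> = (\<Sum>v\<in>V. v\<^sup>2 * emeasure lborel (P v)) + (\<Sum>v\<in>V. emeasure \<nu> (P v))" by (rule sum.distrib)
    also have "(\<Sum>v\<in>V. v\<^sup>2 * emeasure lborel (P v)) = (\<integral>\<^sup>+s. (b s)\<^sup>2 * indicator S s \<partial>lborel)"
      by (simp add: dec[of "\<lambda>v. v\<^sup>2"] nn_integral_sum nn_integral_cmult)
    also have "(\<Sum>v\<in>V. emeasure \<nu> (P v)) = emeasure \<nu> (\<Union>v\<in>V. P v)"
      using V by (intro sum_emeasure) (auto simp: disjoint_family_on_def P_def)
    also have "\<dots> \<le> N" using V by (intro Nle sets.finite_UN) auto
    finally have le: "2 * (\<integral>\<^sup>+s. (b s)\<^sup>2 * indicator S s \<partial>lborel) \<le> (\<integral>\<^sup>+s. (b s)\<^sup>2 * indicator S s \<partial>lborel) + N" by simp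
    have "(\<integral>\<^sup>+s. (b s)\<^sup>2 * indicator S s \<partial>lborel) = (\<Sum>v\<in>V. v\<^sup>2 * emeasure lborel (P v))"
      by (simp add: dec[of "\<lambda>v. v\<^sup>2"] nn_integral_sum nn_integral_cmult)
    also have "\<dots> < \<infinity>"
    proof -
      have "v\<^sup>2 * emeasure lborel (P v) < \<infinity>" if "v \<in> V" for v
      proof -
        have "emeasure lborel (P v) \<le> emeasure lborel S" by (intro emeasure_mono) (auto simp: P_def)
        then have "emeasure lborel (P v) < \<infinity>" using S(2) by (rule order.strict_trans1)
        moreover have "v\<^sup>2 < \<infinity>" using that b(2) by (auto simp: V_def power_less_top_ennreal)
        ultimately show ?thesis by (simp add: ennreal_mult_less_top)
      qed
      then show ?thesis using V by (simp add: less_top[symmetric])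
    qed
    finally obtain z where z: "(\<integral>\<^sup>+s. (b s)\<^sup>2 * indicator S s \<partial>lborel) = ennreal z" "z \<ge> 0"
      by (cases "\<integral>\<^sup>+s. (b s)\<^sup>2 * indicator S s \<partial>lborel") auto
    obtain n where n: "N = ennreal n" "n \<ge> 0" using fin by (cases N) (auto simp: N_def)
    have "ennreal (2 * z) \<le> ennreal (z + n)" using le z n by (simp add: ennreal_mult)
    then show ?thesis using z n by (simp add: ennreal_le_iff del: ennreal_plus)
  qed
  obtain b where b: "incseq b" "\<And>i s. b i s < top" "\<And>i. simple_function lborel (b i)" "f = (SUP i. b i)"
    using borel_measurable_implies_simple_function_sequence[of f lborel] by auto
  have [measurable]: "b i \<in> borel_measurable borel" for i using borel_measurable_simple_function[OF b(3)] by simp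
  have fsup: "f s = (SUP i. b i s)" for s by (simp add: b(4) image_image)
  have sq: "(f s)\<^sup>2 * indicator S s \<le> (SUP i. (b i s)\<^sup>2 * indicator S s)" for s
  proof -
    have inc: "incseq (\<lambda>i. b i s)" using b(1) by (auto simp: incseq_def le_fun_def)
    have "(f s) * (f s) = (SUP i. b i s * f s)" unfolding fsup by (simp add: SUP_mult_right_ennreal)
    also have "\<dots> \<le> (SUP i. (b i s)\<^sup>2)"
    proof (rule SUP_least)
      fix i
      have "b i s * f s = (SUP j. b i s * b j s)" unfolding fsup by (simp add: SUP_mult_left_ennreal)
      also have "\<dots> \<le> (SUP i. (b i s)\<^sup>2)"
      proof (rule SUP_least)
        fix j
        have "b i s * b j s \<le> (b (max i j) s)\<^sup>2"
          unfolding power2_eq_square using inc by (intro mult_mono) (auto simp: incseq_def)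
        also have "\<dots> \<le> (SUP i. (b i s)\<^sup>2)" by (rule SUP_upper) simp
        finally show "b i s * b j s \<le> (SUP i. (b i s)\<^sup>2)" .
      qed
      finally show "b i s * f s \<le> (SUP i. (b i s)\<^sup>2)" .
    qed
    finally show ?thesis by (auto simp: indicator_def power2_eq_square)
  qed
  have "(\<integral>\<^sup>+s. (f s)\<^sup>2 * indicator S s \<partial>lborel) \<le> (\<integral>\<^sup>+s. (SUP i. (b i s)\<^sup>2 * indicator S s) \<partial>lborel)"
    by (intro nn_integral_mono sq)
  also have "\<dots> = (SUP i. \<integral>\<^sup>+s. (b i s)\<^sup>2 * indicator S s \<partial>lborel)"
    using b(1) by (intro nn_integral_monotone_convergence_SUP) (auto simp: incseq_def le_fun_def indicator_def intro!: power_mono)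
  also have "\<dots> \<le> N"
  proof (rule SUP_least)
    fix i
    have "b i s \<le> f s" for s unfolding fsup by (rule SUP_upper) simp
    then show "(\<integral>\<^sup>+s. (b i s)\<^sup>2 * indicator S s \<partial>lborel) \<le> N" using b(2,3) by (intro simple) auto
  qed
  finally have fN: "(\<integral>\<^sup>+s. (f s)\<^sup>2 * indicator S s \<partial>lborel) \<le> N" .
  have ae: "AE s in lborel. ennreal (enn2real (f s)) = f s" using ffin by eventually_elim (simp add: less_top)
  show ?thesis
  proof
    show "(\<lambda>s. enn2real (f s)) \<in> borel_measurable borel" by measurable
    show "\<forall>s. enn2real (f s) \<ge> 0" by simp
    show "\<forall>A\<in>sets borel. A \<subseteq> S \<longrightarrow> emeasure \<theta> A = (\<integral>\<^sup>+s. ennreal (enn2real (f s)) * indicator A s \<partial>lborel)"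
    proof (intro ballI impI)
      fix A assume A: "A \<in> sets borel" "A \<subseteq> S"
      have "(\<integral>\<^sup>+s. ennreal (enn2real (f s)) * indicator A s \<partial>lborel) = (\<integral>\<^sup>+s. f s * indicator A s \<partial>lborel)"
        using ae by (intro nn_integral_cong_AE) (auto elim!: eventually_mono)
      then show "emeasure \<theta> A = (\<integral>\<^sup>+s. ennreal (enn2real (f s)) * indicator A s \<partial>lborel)" using fA[OF A(1)] A(2) by (simp add: Int_absorb1)
    qed
    have "(\<integral>\<^sup>+s. ennreal ((enn2real (f s))\<^sup>2) * indicator S s \<partial>lborel) = (\<integral>\<^sup>+s. (f s)\<^sup>2 * indicator S s \<partial>lborel)"
      using ae by (intro nn_integral_cong_AE) (auto elim!: eventually_mono simp: ennreal_power[symmetric])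
    then show "(\<integral>\<^sup>+s. ennreal ((enn2real (f s))\<^sup>2) * indicator S s \<partial>lborel) \<le> emeasure \<nu> UNIV"
      using fN by (simp add: N_def)
  qed
qed

text \<open>
  The inequality \<open>w \<le> 1/(2k) + k w\<^sup>2/2\<close> bounds the total increment over a family of disjoint intervals by
  \<open>1/(2k)\<close> times their total length plus \<open>k C / 2\<close>.
\<close>

lemma absolutely_continuous_on_square_integrable_density:
  fixes f w :: "real \<Rightarrow> real"
  assumes [measurable]: "w \<in> borel_measurable borel" and w: "\<And>s. w s \<ge> 0"
    and f: "\<And>s1 s2. \<alpha> < s1 \<Longrightarrow> s1 \<le> s2 \<Longrightarrow> s2 < \<beta> \<Longrightarrow>
      f s2 \<le> f s1 \<and> ennreal (f s1 - f s2) = (\<integral>\<^sup>+s. ennreal (w s) * indicator {s1<..s2} s \<partial>lborel)"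
    and C: "C \<ge> 0" "(\<integral>\<^sup>+s. ennreal ((w s)\<^sup>2) * indicator {\<alpha><..<\<beta>} s \<partial>lborel) \<le> ennreal C"
  shows "absolutely_continuous_on {\<alpha><..<\<beta>} f"
  unfolding absolutely_continuous_on_def
proof (intro allI impI)
  fix e :: real assume e: "e > 0"
  (* With this k the term k C / 2 is below e / 2, and total length e k makes the other term e / 2. *)
  define k where "k = e / (C + 1)"
  have k: "k > 0" using e C by (simp add: k_def)
  have kC: "k * C < e" using e C(1) by (simp add: k_def field_simps)
  show "\<exists>\<delta>>0. \<forall>F :: (real \<times> real) set.
        finite F \<and> (\<forall>(a, b)\<in>F. a < b \<and> {a..b} \<subseteq> {\<alpha><..<\<beta>}) \<and>
        pairwise (\<lambda>(a, b) (c, d). {a<..<b} \<inter> {c<..<d} = {}) F \<and>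
        (\<Sum>(a, b)\<in>F. b - a) < \<delta> \<longrightarrow>
        (\<Sum>(a, b)\<in>F. \<bar>f b - f a\<bar>) < e"
  proof (intro exI[of _ "e * k"] conjI allI impI)
    show "e * k > 0" using e k by simp
    fix F :: "(real \<times> real) set"
    assume "finite F \<and> (\<forall>(a, b)\<in>F. a < b \<and> {a..b} \<subseteq> {\<alpha><..<\<beta>}) \<and>
        pairwise (\<lambda>(a, b) (c, d). {a<..<b} \<inter> {c<..<d} = {}) F \<and> (\<Sum>(a, b)\<in>F. b - a) < e * k"
    then have F: "finite F" "\<And>a b. (a, b) \<in> F \<Longrightarrow> a < b \<and> {a..b} \<subseteq> {\<alpha><..<\<beta>}"
      and pw: "pairwise (\<lambda>(a, b) (c, d). {a<..<b} \<inter> {c<..<d} = {}) F"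
      and len: "(\<Sum>(a, b)\<in>F. b - a) < e * k" by auto
    let ?I = "\<lambda>(a::real, b). {a<..b}"
    have disj: "disjoint_family_on ?I F"
      unfolding disjoint_family_on_def
    proof (intro ballI impI)
      fix p q assume pq: "p \<in> F" "q \<in> F" "p \<noteq> q"
      obtain a b c d where [simp]: "p = (a, b)" "q = (c, d)" by (cases p; cases q)
      have o: "{a<..<b} \<inter> {c<..<d} = {}" using pairwiseD[OF pw pq] by simp
      show "?I p \<inter> ?I q = {}"
      proof (rule ccontr)
        assume "?I p \<inter> ?I q \<noteq> {}"
        then obtain x where "x \<in> ?I p" "x \<in> ?I q" by blast
        then have x: "a < x" "x \<le> b" "c < x" "x \<le> d" by auto
        have "(max a c + x) / 2 \<in> {a<..<b} \<inter> {c<..<d}" using x by (auto simp: max_def field_simps)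
        then show False using o by blast
      qed
    qed
    have ff: "f b \<le> f a" "ennreal (f a - f b) = (\<integral>\<^sup>+s. ennreal (w s) * indicator {a<..b} s \<partial>lborel)" "a < b" if "(a, b) \<in> F" for a b
    proof -
      have ab: "a < b" and sub: "{a..b} \<subseteq> {\<alpha><..<\<beta>}" using F(2)[OF that] by auto
      have "a \<in> {\<alpha><..<\<beta>}" by (rule subsetD[OF sub]) (use ab in simp)
      moreover have "b \<in> {\<alpha><..<\<beta>}" by (rule subsetD[OF sub]) (use ab in simp)
      ultimately have "\<alpha> < a" "b < \<beta>" by auto
      then show "f b \<le> f a" "ennreal (f a - f b) = (\<integral>\<^sup>+s. ennreal (w s) * indicator {a<..b} s \<partial>lborel)" "a < b"
        using f[of a b] F(2)[OF that] by auto
    qed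
    have am: "w s \<le> 1 / (2 * k) + k / 2 * (w s)\<^sup>2" for s
    proof -
      have "0 \<le> (k * w s - 1)\<^sup>2" by simp
      then have "2 * (k * w s) \<le> (k * w s)\<^sup>2 + 1" by (simp add: power2_diff)
      then show ?thesis using k by (simp add: field_simps power2_eq_square)
    qed
    have "ennreal (\<Sum>(a, b)\<in>F. \<bar>f b - f a\<bar>) = (\<Sum>(a, b)\<in>F. ennreal (f a - f b))"
    proof -
      have "(\<Sum>(a, b)\<in>F. \<bar>f b - f a\<bar>) = (\<Sum>(a, b)\<in>F. f a - f b)"
        by (intro sum.cong refl) (auto dest: ff(1))
      moreover have "(\<Sum>(a, b)\<in>F. ennreal (f a - f b)) = ennreal (\<Sum>(a, b)\<in>F. f a - f b)"
        unfolding case_prod_beta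
      proof (rule sum_ennreal)
        fix p assume "p \<in> F"
        then show "0 \<le> f (fst p) - f (snd p)" using ff(1)[of "fst p" "snd p"] by simp
      qed
      ultimately show ?thesis by simp
    qed
    also have "\<dots> = (\<Sum>p\<in>F. \<integral>\<^sup>+s. ennreal (w s) * indicator (?I p) s \<partial>lborel)"
      using ff(2) by (intro sum.cong) auto
    also have "\<dots> \<le> (\<Sum>p\<in>F. \<integral>\<^sup>+s. ennreal (1 / (2 * k)) * indicator (?I p) s + ennreal (k / 2) * (ennreal ((w s)\<^sup>2) * indicator (?I p) s) \<partial>lborel)"
    proof (intro sum_mono nn_integral_mono)
      fix p s
      have "ennreal (w s) \<le> ennreal (1 / (2 * k)) + ennreal (k / 2) * ennreal ((w s)\<^sup>2)"
        using am[of s] k by (simp add: ennreal_mult[symmetric] ennreal_plus[symmetric] ennreal_leI del: ennreal_plus)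
      then show "ennreal (w s) * indicator (?I p) s \<le> ennreal (1 / (2 * k)) * indicator (?I p) s + ennreal (k / 2) * (ennreal ((w s)\<^sup>2) * indicator (?I p) s)"
        by (auto simp: indicator_def)
    qed
    also have "\<dots> = (\<Sum>p\<in>F. ennreal (1 / (2 * k)) * emeasure lborel (?I p) + ennreal (k / 2) * (\<integral>\<^sup>+s. ennreal ((w s)\<^sup>2) * indicator (?I p) s \<partial>lborel))"
    proof (intro sum.cong refl)
      fix p :: "real \<times> real"
      have [measurable]: "?I p \<in> sets borel" by (cases p) auto
      show "(\<integral>\<^sup>+s. ennreal (1 / (2 * k)) * indicator (?I p) s + ennreal (k / 2) * (ennreal ((w s)\<^sup>2) * indicator (?I p) s) \<partial>lborel)
        = ennreal (1 / (2 * k)) * emeasure lborel (?I p) + ennreal (k / 2) * (\<integral>\<^sup>+s. ennreal ((w s)\<^sup>2) * indicator (?I p) s \<partial>lborel)"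
        by (subst nn_integral_add) (auto simp: nn_integral_cmult)
    qed
    also have "\<dots> = ennreal (1 / (2 * k)) * (\<Sum>p\<in>F. emeasure lborel (?I p)) + ennreal (k / 2) * (\<Sum>p\<in>F. \<integral>\<^sup>+s. ennreal ((w s)\<^sup>2) * indicator (?I p) s \<partial>lborel)"
      by (simp add: sum.distrib sum_distrib_left)
    also have "(\<Sum>p\<in>F. emeasure lborel (?I p)) = ennreal (\<Sum>(a, b)\<in>F. b - a)"
    proof -
      have "(\<Sum>p\<in>F. emeasure lborel (?I p)) = (\<Sum>p\<in>F. ennreal (snd p - fst p))"
        by (intro sum.cong refl) (auto dest: ff(3))
      also have "\<dots> = ennreal (\<Sum>p\<in>F. snd p - fst p)"
      proof (rule sum_ennreal)
        fix p assume "p \<in> F"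
        then show "0 \<le> snd p - fst p" using ff(3)[of "fst p" "snd p"] by simp
      qed
      finally show ?thesis by (simp add: case_prod_beta)
    qed
    also have "(\<Sum>p\<in>F. \<integral>\<^sup>+s. ennreal ((w s)\<^sup>2) * indicator (?I p) s \<partial>lborel) \<le> ennreal C"
    proof -
      have m: "?I p \<in> sets borel" for p by (cases p) auto
      have "(\<Sum>p\<in>F. \<integral>\<^sup>+s. ennreal ((w s)\<^sup>2) * indicator (?I p) s \<partial>lborel) = (\<Sum>p\<in>F. emeasure (density lborel (\<lambda>s. ennreal ((w s)\<^sup>2))) (?I p))"
        using m by (intro sum.cong refl) (subst emeasure_density, auto)
      also have "\<dots> = emeasure (density lborel (\<lambda>s. ennreal ((w s)\<^sup>2))) (\<Union>p\<in>F. ?I p)"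
        using m F(1) disj by (intro sum_emeasure) auto
      also have "\<dots> \<le> emeasure (density lborel (\<lambda>s. ennreal ((w s)\<^sup>2))) {\<alpha><..<\<beta>}"
      proof (intro emeasure_mono UN_least)
        fix p assume "p \<in> F"
        then have "{fst p..snd p} \<subseteq> {\<alpha><..<\<beta>}" using F(2)[of "fst p" "snd p"] by simp
        moreover have "?I p \<subseteq> {fst p..snd p}" by (cases p) auto
        ultimately show "?I p \<subseteq> {\<alpha><..<\<beta>}" by blast
      qed simp
      also have "\<dots> \<le> ennreal C" using C(2) by (subst emeasure_density) auto
      finally show ?thesis .
    qed
    finally have "ennreal (\<Sum>(a, b)\<in>F. \<bar>f b - f a\<bar>) \<le> ennreal (1 / (2 * k)) * ennreal (\<Sum>(a, b)\<in>F. b - a) + ennreal (k / 2) * ennreal C"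
      by (simp add: add_left_mono mult_left_mono)
    also have "\<dots> = ennreal (1 / (2 * k) * (\<Sum>(a, b)\<in>F. b - a) + k / 2 * C)"
    proof -
      have "0 \<le> (\<Sum>(a, b)\<in>F. b - a)" using ff(3) by (intro sum_nonneg) (auto simp: less_imp_le)
      then show ?thesis using k C(1) by (simp add: ennreal_mult[symmetric] ennreal_plus[symmetric] del: ennreal_plus)
    qed
    finally have "ennreal (\<Sum>(a, b)\<in>F. \<bar>f b - f a\<bar>) \<le> ennreal (1 / (2 * k) * (\<Sum>(a, b)\<in>F. b - a) + k / 2 * C)" .
    moreover have "1 / (2 * k) * (\<Sum>(a, b)\<in>F. b - a) + k / 2 * C < e"
    proof -
      have "1 / (2 * k) * (\<Sum>(a, b)\<in>F. b - a) < 1 / (2 * k) * (e * k)" using len k by (intro mult_strict_left_mono) auto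
      then show ?thesis using kC k by simp
    qed
    ultimately show "(\<Sum>(a, b)\<in>F. \<bar>f b - f a\<bar>) < e"
    proof -
      assume le: "ennreal (\<Sum>(a, b)\<in>F. \<bar>f b - f a\<bar>) \<le> ennreal (1 / (2 * k) * (\<Sum>(a, b)\<in>F. b - a) + k / 2 * C)"
        and lt: "1 / (2 * k) * (\<Sum>(a, b)\<in>F. b - a) + k / 2 * C < e"
      have "0 \<le> (\<Sum>(a, b)\<in>F. b - a)" using ff(3) by (intro sum_nonneg) (auto simp: less_imp_le)
      then have "0 \<le> 1 / (2 * k) * (\<Sum>(a, b)\<in>F. b - a) + k / 2 * C" using k C(1) by simp
      then show ?thesis using le lt by (simp add: ennreal_le_iff)
    qed
  qed
qed

section \<open>The distribution function and the decreasing rearrangement\<close>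

locale distribution =
  fixes \<Omega> :: "'a::euclidean_space set" and u :: "'a \<Rightarrow> real"
  assumes domain_borel [measurable]: "\<Omega> \<in> sets borel" and u_borel [measurable]: "u \<in> borel_measurable borel"
    and domain_finite: "emeasure lborel \<Omega> < \<infinity>"
begin

definition L :: real where "L = measure lborel \<Omega>"

abbreviation mu :: "real \<Rightarrow> real" where "mu \<equiv> distribution_fun \<Omega> u"
abbreviation ustar :: "real \<Rightarrow> real" where "ustar \<equiv> decr_rearrangement \<Omega> u"

lemma emeasure_domain: "emeasure lborel \<Omega> = ennreal L"
  using domain_finite by (simp add: L_def emeasure_eq_ennreal_measure)

lemma emeasure_subset_domain_finite: "A \<in> sets borel \<Longrightarrow> A \<subseteq> \<Omega> \<Longrightarrow> emeasure lborel A \<noteq> \<infinity>"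
  using emeasure_mono[of A \<Omega> lborel] domain_finite by (auto simp: top_unique)

lemma mu_eq: "mu t = measure lborel {x \<in> \<Omega>. u x > t}"
  unfolding distribution_fun_def by (rule measure_completion) simp

lemma emeasure_superlevel: "emeasure lborel {x \<in> \<Omega>. u x > t} = ennreal (mu t)"
  unfolding mu_eq by (rule emeasure_eq_ennreal_measure) (use emeasure_subset_domain_finite[of "{x \<in> \<Omega>. u x > t}"] in auto)

lemma mu_nonneg: "0 \<le> mu t" by (simp add: distribution_fun_def)

lemma mu_le: "mu t \<le> L"
proof -
  have "ennreal (mu t) \<le> ennreal L"
    unfolding emeasure_superlevel[symmetric] emeasure_domain[symmetric] by (intro emeasure_mono) auto
  then show ?thesis by (simp add: L_def ennreal_le_iff)
qed

lemma mu_antimono: "s \<le> t \<Longrightarrow> mu t \<le> mu s"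
proof -
  assume "s \<le> t"
  then have "ennreal (mu t) \<le> ennreal (mu s)"
    unfolding emeasure_superlevel[symmetric] by (intro emeasure_mono) auto
  then show ?thesis by (simp add: mu_nonneg ennreal_le_iff)
qed

lemma borel_mu [measurable]: "mu \<in> borel_measurable borel"
proof -
  have "mono (\<lambda>t. - mu t)" by (auto simp: mono_def mu_antimono)
  then have "(\<lambda>t. - mu t) \<in> borel_measurable borel" by (rule borel_measurable_mono)
  then show ?thesis by simp
qed

lemma emeasure_layer:
  assumes "s \<le> t"
  shows "emeasure lborel {x \<in> \<Omega>. s < u x \<and> u x \<le> t} = ennreal (mu s - mu t)"
proof -
  have "{x \<in> \<Omega>. s < u x \<and> u x \<le> t} = {x \<in> \<Omega>. u x > s} - {x \<in> \<Omega>. u x > t}" using assms by auto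
  moreover have "emeasure lborel ({x \<in> \<Omega>. u x > s} - {x \<in> \<Omega>. u x > t}) = emeasure lborel {x \<in> \<Omega>. u x > s} - emeasure lborel {x \<in> \<Omega>. u x > t}"
  proof (rule emeasure_Diff)
    show "emeasure lborel {x \<in> \<Omega>. u x > t} \<noteq> \<infinity>" by (simp add: emeasure_superlevel)
    show "{x \<in> \<Omega>. u x > s} \<in> sets lborel" by measurable
    show "{x \<in> \<Omega>. u x > t} \<in> sets lborel" by measurable
    show "{x \<in> \<Omega>. u x > t} \<subseteq> {x \<in> \<Omega>. u x > s}" using assms by auto
  qed
  ultimately show ?thesis by (simp add: emeasure_superlevel mu_nonneg ennreal_minus)
qed

lemma mu_seq_limit:
  assumes "incseq (\<lambda>n. {x \<in> \<Omega>. u x > t n})" "(\<Union>n. {x \<in> \<Omega>. u x > t n}) = A"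
  shows "(\<lambda>n. mu (t n)) \<longlonglongrightarrow> measure lborel A"
proof -
  have "A \<subseteq> \<Omega>" "A \<in> sets borel" using assms(2) by auto
  then have "emeasure lborel (\<Union>n. {x \<in> \<Omega>. u x > t n}) \<noteq> \<infinity>" using emeasure_subset_domain_finite assms(2) by auto
  moreover have "range (\<lambda>n. {x \<in> \<Omega>. u x > t n}) \<subseteq> sets lborel"
  proof (rule image_subsetI)
    fix n show "{x \<in> \<Omega>. u x > t n} \<in> sets lborel" by measurable
  qed
  ultimately show ?thesis using Lim_measure_incseq[OF _ assms(1)] unfolding mu_eq assms(2) by blast
qed

lemma mu_below: "s < L \<Longrightarrow> \<exists>t. s < mu t"
proof -
  assume "s < L"
  have inc: "incseq (\<lambda>n. {x \<in> \<Omega>. u x > - real n})" by (auto simp: incseq_def)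
  have "(\<Union>n. {x \<in> \<Omega>. u x > - real n}) = \<Omega>"
  proof -
    have "\<exists>n. u x > - real n" for x using reals_Archimedean2[of "- u x"] by (auto intro: exI simp: minus_less_iff)
    then show ?thesis by auto
  qed
  from mu_seq_limit[OF inc this] have "(\<lambda>n. mu (- real n)) \<longlonglongrightarrow> L" by (simp add: L_def)
  from order_tendstoD(1)[OF this \<open>s < L\<close>] show ?thesis by (auto simp: eventually_sequentially)
qed

lemma mu_above: "0 < s \<Longrightarrow> \<exists>t. mu t \<le> s"
proof -
  assume "0 < s"
  have dec: "decseq (\<lambda>n. {x \<in> \<Omega>. u x > real n})" by (auto simp: decseq_def)
  have e: "(\<Inter>n. {x \<in> \<Omega>. u x > real n}) = {}"
  proof -
    have "\<exists>n. \<not> u x > real n" for x using real_arch_simple[of "u x"] by (auto simp: not_less)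
    then show ?thesis by blast
  qed
  have "(\<lambda>n. measure lborel {x \<in> \<Omega>. u x > real n}) \<longlonglongrightarrow> measure lborel (\<Inter>n. {x \<in> \<Omega>. u x > real n})"
  proof (rule Lim_measure_decseq[OF _ dec])
    show "range (\<lambda>n. {x \<in> \<Omega>. u x > real n}) \<subseteq> sets lborel"
    proof (rule image_subsetI)
      fix n show "{x \<in> \<Omega>. u x > real n} \<in> sets lborel" by measurable
    qed
  qed (simp add: emeasure_superlevel)
  then have "(\<lambda>n. mu (real n)) \<longlonglongrightarrow> 0" unfolding e mu_eq by simp
  from order_tendstoD(2)[OF this \<open>0 < s\<close>] show ?thesis by (auto simp: eventually_sequentially intro: less_imp_le)
qed

text \<open>
  The set of levels \<open>t\<close> with \<open>mu t \<le> s\<close> is an up-set; right-continuity of \<open>mu\<close> puts its infimum \<open>ustar s\<close> into it.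
\<close>

lemma rearrangement_galois:
  assumes s: "0 < s" "s < L"
  shows "ustar s \<le> t \<longleftrightarrow> mu t \<le> s"
proof -
  let ?A = "{t. mu t \<le> s}"
  have ne: "?A \<noteq> {}" using mu_above[OF s(1)] by auto
  obtain t0 where t0: "s < mu t0" using mu_below[OF s(2)] by auto
  have "t0 \<le> t" if "t \<in> ?A" for t using that t0 mu_antimono[of t t0] by (auto simp: not_less[symmetric] dest: less_imp_le)
  then have bdd: "bdd_below ?A" by (auto simp: bdd_below_def)
  have us: "ustar s = Inf ?A" by (simp add: decr_rearrangement_def)
  have inA: "mu (ustar s) \<le> s"
  proof -
    let ?t = "\<lambda>n. ustar s + 1 / real (Suc n)"
    have le: "mu (?t n) \<le> s" for n
    proof -
      have "Inf ?A < ?t n" by (simp add: us)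
      then obtain a where "a \<in> ?A" "a < ?t n" using cInf_less_iff[OF ne bdd] by auto
      then show ?thesis using mu_antimono[of a "?t n"] by auto
    qed
    have inc: "incseq (\<lambda>n. {x \<in> \<Omega>. u x > ?t n})"
    proof (rule incseq_SucI)
      fix n
      have "?t (Suc n) \<le> ?t n" by (simp add: frac_le)
      then show "{x \<in> \<Omega>. u x > ?t n} \<subseteq> {x \<in> \<Omega>. u x > ?t (Suc n)}" by auto
    qed
    have "(\<Union>n. {x \<in> \<Omega>. u x > ?t n}) = {x \<in> \<Omega>. u x > ustar s}"
    proof -
      have "\<exists>n. u x > ?t n" if "u x > ustar s" for x
      proof -
        have "0 < u x - ustar s" using that by simp
        then obtain n where "1 / real (Suc n) < u x - ustar s" by (rule nat_approx_posE)
        then have "u x > ?t n" by linarith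
        then show ?thesis ..
      qed
      moreover have "u x > ustar s" if "u x > ?t n" for x n
      proof -
        have "0 < 1 / real (Suc n)" by simp
        then show ?thesis using that by linarith
      qed
      ultimately have ex: "(\<exists>n. u x > ?t n) = (u x > ustar s)" for x by metis
      show ?thesis
      proof (rule set_eqI)
        fix x
        have "x \<in> (\<Union>n. {x \<in> \<Omega>. u x > ?t n}) \<longleftrightarrow> x \<in> \<Omega> \<and> (\<exists>n. u x > ?t n)" by simp
        also have "\<dots> \<longleftrightarrow> x \<in> {x \<in> \<Omega>. u x > ustar s}" unfolding ex by simp
        finally show "x \<in> (\<Union>n. {x \<in> \<Omega>. u x > ?t n}) \<longleftrightarrow> x \<in> {x \<in> \<Omega>. u x > ustar s}" .
      qed
    qed
    from mu_seq_limit[OF inc this] have "(\<lambda>n. mu (?t n)) \<longlonglongrightarrow> mu (ustar s)" by (simp add: mu_eq)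
    then show ?thesis by (rule LIMSEQ_le_const2) (use le in auto)
  qed
  show ?thesis
  proof
    assume "ustar s \<le> t"
    then show "mu t \<le> s" using mu_antimono[of "ustar s" t] inA by linarith
  next
    assume "mu t \<le> s"
    then show "ustar s \<le> t" unfolding us by (intro cInf_lower bdd) simp
  qed
qed

lemma rearrangement_antimono: "0 < s1 \<Longrightarrow> s1 \<le> s2 \<Longrightarrow> s2 < L \<Longrightarrow> ustar s2 \<le> ustar s1"
  using rearrangement_galois[of s2 "ustar s1"] rearrangement_galois[of s1 "ustar s1"] by auto

lemma level_interval:
  assumes "0 < s1" "s1 \<le> s2" "s2 < L"
  shows "{t. s1 < mu t \<and> mu t \<le> s2} = {ustar s2..<ustar s1}"
  using rearrangement_galois[of s1] rearrangement_galois[of s2] assms by (auto simp: not_le[symmetric])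

lemma measurable_rearrangement: "(\<lambda>s. indicator {0<..<L} s * ustar s) \<in> borel_measurable borel"
proof (subst borel_measurable_iff_le, intro allI)
  fix t :: real
  have "{s \<in> space borel. indicator {0<..<L} s * ustar s \<le> t} = {s \<in> {0<..<L}. mu t \<le> s} \<union> (if 0 \<le> t then - {0<..<L} else {})"
    using rearrangement_galois[of _ t] by (auto simp: indicator_def)
  also have "\<dots> \<in> sets borel"
  proof -
    have "{s \<in> {0<..<L}. mu t \<le> s} = {0<..<L} \<inter> {mu t..}" by auto
    then show ?thesis by simp
  qed
  finally show "{s \<in> space borel. indicator {0<..<L} s * ustar s \<le> t} \<in> sets borel" .
qed

text \<open>
  Both image measures give the half-line above \<open>t\<close> the mass \<open>mu t\<close>.
\<close>

lemma rearrangement_equimeasurable: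
  assumes [measurable]: "h \<in> borel_measurable borel"
  shows "(\<integral>\<^sup>+s. h (ustar s) * indicator {0<..<L} s \<partial>lborel) = (\<integral>\<^sup>+x. h (u x) * indicator \<Omega> x \<partial>lborel)"
proof -
  let ?r = "\<lambda>s. indicator {0<..<L} s * ustar s"
  note [measurable] = measurable_rearrangement
  let ?M = "distr (density lborel (indicator {0<..<L})) borel ?r" and ?N = "distr (density lborel (indicator \<Omega>)) borel u"
  have M: "emeasure ?M {t<..} = ennreal (mu t)" for t
  proof -
    have "emeasure ?M {t<..} = emeasure (density lborel (indicator {0<..<L})) {s. t < ?r s}"
      by (subst emeasure_distr) (auto intro!: arg_cong2[of _ _ _ _ emeasure])
    also have "\<dots> = (\<integral>\<^sup>+s. indicator {0<..<L} s * indicator {s. t < ?r s} s \<partial>lborel)"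
      by (rule emeasure_density) measurable
    also have "\<dots> = (\<integral>\<^sup>+s. indicator {0<..<mu t} s \<partial>lborel)"
    proof (rule nn_integral_cong)
      fix s
      show "indicator {0<..<L} s * indicator {s. t < ?r s} s = (indicator {0<..<mu t} s :: ennreal)"
      proof (cases "s \<in> {0<..<L}")
        case True
        then have "t < ?r s \<longleftrightarrow> s < mu t" using rearrangement_galois[of s t] by (auto simp: not_le[symmetric])
        then show ?thesis using True by (simp add: indicator_def)
      next
        case False
        then have "s \<notin> {0<..<mu t}" using mu_le[of t] by auto
        then show ?thesis using False by (simp add: indicator_def)
      qed
    qed
    also have "\<dots> = ennreal (mu t)" using mu_nonneg[of t] by simp
    finally show ?thesis .
  qed
  have N: "emeasure ?N {t<..} = ennreal (mu t)" for t
  proof -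
    have "emeasure ?N {t<..} = emeasure (density lborel (indicator \<Omega>)) {x. t < u x}"
      by (subst emeasure_distr) (auto intro!: arg_cong2[of _ _ _ _ emeasure])
    also have "\<dots> = (\<integral>\<^sup>+x. indicator \<Omega> x * indicator {x. t < u x} x \<partial>lborel)"
      by (rule emeasure_density) measurable
    also have "\<dots> = (\<integral>\<^sup>+x. indicator {x \<in> \<Omega>. u x > t} x \<partial>lborel)"
      by (intro nn_integral_cong) (auto simp: indicator_def)
    also have "\<dots> = ennreal (mu t)" by (simp add: emeasure_superlevel)
    finally show ?thesis .
  qed
  have eq: "?M = ?N" by (rule measure_eqI_lessThan) (simp_all add: M N)
  have "(\<integral>\<^sup>+s. h (ustar s) * indicator {0<..<L} s \<partial>lborel) = (\<integral>\<^sup>+s. indicator {0<..<L} s * h (?r s) \<partial>lborel)"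
    by (intro nn_integral_cong) (auto simp: indicator_def)
  also have "\<dots> = (\<integral>\<^sup>+s. h (?r s) \<partial>density lborel (indicator {0<..<L}))"
    by (rule nn_integral_density[symmetric]) measurable
  also have "\<dots> = (\<integral>\<^sup>+y. h y \<partial>?M)" by (rule nn_integral_distr[symmetric]) measurable
  also have "\<dots> = (\<integral>\<^sup>+y. h y \<partial>?N)" by (simp only: eq)
  also have "\<dots> = (\<integral>\<^sup>+x. h (u x) \<partial>density lborel (indicator \<Omega>))" by (rule nn_integral_distr) measurable
  also have "\<dots> = (\<integral>\<^sup>+x. indicator \<Omega> x * h (u x) \<partial>lborel)" by (rule nn_integral_density) measurable
  finally show ?thesis by (simp only: mult.commute)
qed

end

section \<open>The derivative of the rearrangement\<close>

locale isoperimetric_sobolev = sobolev_function \<Omega> u g + distribution \<Omega> u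
  for \<Omega> :: "'a::euclidean_space set" and u :: "'a \<Rightarrow> real" and g :: "'a \<Rightarrow> 'a" +
  fixes Q :: real
  assumes Q: "Q > 0"
    and isoperimetric: "\<And>t. ereal (min (mu t) (L - mu t) powr (1 - 1 / DIM('a))) \<le> ereal Q * perimeter \<Omega> {x \<in> \<Omega>. u x > t}"
    and square: "integrable lborel (\<lambda>x. (norm (g x))\<^sup>2)"
begin

definition psi :: "real \<Rightarrow> real" where "psi s = min s (L - s) powr (1 - 1 / DIM('a))"

lemma borel_psi [measurable]: "psi \<in> borel_measurable borel" unfolding psi_def[abs_def] by measurable

lemma psi_nonneg: "psi s \<ge> 0" by (simp add: psi_def)

lemma psi_pos: "0 < s \<Longrightarrow> s < L \<Longrightarrow> psi s > 0" by (simp add: psi_def)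

definition energy :: real where "energy = (LBINT x. (norm (g x))\<^sup>2)"

lemma energy_nonneg: "energy \<ge> 0" by (simp add: energy_def)

text \<open>
  The length of level intervals, weighted by the isoperimetric profile and transported to the volume variable
  \<open>s = mu t\<close>.  On the interval \<open>(s1, s2]\<close> and without the weight it would be \<open>ustar s1 - ustar s2\<close>.
\<close>

definition level_measure :: "real measure" where
  "level_measure = distr (density lborel (\<lambda>t. ennreal (psi (mu t)))) borel mu"

text \<open>
  The Dirichlet energy of \<open>u\<close>, transported to the volume variable and scaled by \<open>Q\<^sup>2\<close>.
\<close>

definition energy_measure :: "real measure" where
  "energy_measure = distr (density lborel (\<lambda>x. ennreal (Q\<^sup>2 * (norm (g x))\<^sup>2))) borel (\<lambda>x. mu (u x))"

lemma emeasure_level_measure: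
  assumes [measurable]: "A \<in> sets borel"
  shows "emeasure level_measure A = (\<integral>\<^sup>+t. ennreal (psi (mu t)) * indicator {t. mu t \<in> A} t \<partial>lborel)"
proof -
  have "{t. mu t \<in> A} \<in> sets borel" by measurable
  moreover have "mu -` A = {t. mu t \<in> A}" by auto
  ultimately show ?thesis unfolding level_measure_def by (subst emeasure_distr) (auto simp: emeasure_density)
qed

lemma emeasure_energy_measure:
  assumes [measurable]: "A \<in> sets borel"
  shows "emeasure energy_measure A = (\<integral>\<^sup>+x. ennreal (Q\<^sup>2 * (norm (g x))\<^sup>2) * indicator {x. mu (u x) \<in> A} x \<partial>lborel)"
proof -
  have "{x. mu (u x) \<in> A} \<in> sets borel" by measurable
  moreover have "(\<lambda>x. mu (u x)) -` A = {x. mu (u x) \<in> A}" by auto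
  ultimately show ?thesis unfolding energy_measure_def by (subst emeasure_distr) (auto simp: emeasure_density)
qed

lemma energy_measure_UNIV: "emeasure energy_measure UNIV = ennreal (Q\<^sup>2 * energy)"
proof -
  have "emeasure energy_measure UNIV = (\<integral>\<^sup>+x. ennreal (Q\<^sup>2 * (norm (g x))\<^sup>2) \<partial>lborel)" by (subst emeasure_energy_measure) auto
  also have "\<dots> = ennreal (LBINT x. Q\<^sup>2 * (norm (g x))\<^sup>2)" using square by (intro nn_integral_eq_integral) auto
  finally show ?thesis by (simp add: energy_def)
qed

text \<open>
  The coarea inequality and \<open>2 a Q |g| \<le> a\<^sup>2 + Q\<^sup>2 |g|\<^sup>2\<close>.  For levels strictly below \<open>ustar s1\<close> the layer has
  measure at most \<open>s2 - s1\<close>; a plateau of \<open>u\<close> at the level \<open>ustar s1\<close> itself could make it larger.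
\<close>

lemma layer_inequality:
  assumes a: "a > 0" and s: "0 < s1" "s1 < s2" "s2 < L" and t2: "ustar s2 \<le> t2" "t2 < ustar s1"
  shows "ennreal (2 * a) * (\<integral>\<^sup>+t. ennreal (psi (mu t)) * indicator {ustar s2..t2} t \<partial>lborel)
    \<le> ennreal (a\<^sup>2) * ennreal (s2 - s1) + emeasure energy_measure {s1<..s2}"
proof -
  let ?t1 = "ustar s2"
  have m1: "mu ?t1 \<le> s2" using rearrangement_galois[of s2 ?t1] s by simp
  have m2: "s1 < mu t2" using rearrangement_galois[of s1 t2] s t2 by auto
  have "(\<integral>\<^sup>+t. ennreal (psi (mu t)) * indicator {?t1..t2} t \<partial>lborel)
      \<le> ennreal Q * (\<integral>\<^sup>+x. ennreal (norm (g x)) * indicator {x. ?t1 < u x \<and> u x \<le> t2} x \<partial>lborel)"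
    by (rule coarea_inequality[OF Q _ _ t2(1)]) (use isoperimetric in \<open>auto simp: psi_def\<close>)
  then have "ennreal (2 * a) * (\<integral>\<^sup>+t. ennreal (psi (mu t)) * indicator {?t1..t2} t \<partial>lborel)
      \<le> ennreal (2 * a) * (ennreal Q * (\<integral>\<^sup>+x. ennreal (norm (g x)) * indicator {x. ?t1 < u x \<and> u x \<le> t2} x \<partial>lborel))"
    by (rule mult_left_mono) simp
  also have "\<dots> = (\<integral>\<^sup>+x. ennreal (2 * a * Q * norm (g x)) * indicator {x. ?t1 < u x \<and> u x \<le> t2} x \<partial>lborel)"
  proof -
    have "(\<integral>\<^sup>+x. ennreal (2 * a * Q * norm (g x)) * indicator {x. ?t1 < u x \<and> u x \<le> t2} x \<partial>lborel)
      = (\<integral>\<^sup>+x. ennreal (2 * a * Q) * (ennreal (norm (g x)) * indicator {x. ?t1 < u x \<and> u x \<le> t2} x) \<partial>lborel)"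
      using a Q by (intro nn_integral_cong) (simp add: ennreal_mult mult_ac)
    also have "\<dots> = ennreal (2 * a * Q) * (\<integral>\<^sup>+x. ennreal (norm (g x)) * indicator {x. ?t1 < u x \<and> u x \<le> t2} x \<partial>lborel)"
      by (rule nn_integral_cmult) measurable
    also have "ennreal (2 * a * Q) = ennreal (2 * a) * ennreal Q" using a Q by (intro ennreal_mult) auto
    finally show ?thesis by (simp add: mult.assoc)
  qed
  also have "\<dots> \<le> (\<integral>\<^sup>+x. ennreal (a\<^sup>2) * indicator {x \<in> \<Omega>. ?t1 < u x \<and> u x \<le> t2} x
      + ennreal (Q\<^sup>2 * (norm (g x))\<^sup>2) * indicator {x. mu (u x) \<in> {s1<..s2}} x \<partial>lborel)"
  proof (rule nn_integral_mono)
    fix x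
    show "ennreal (2 * a * Q * norm (g x)) * indicator {x. ?t1 < u x \<and> u x \<le> t2} x
      \<le> ennreal (a\<^sup>2) * indicator {x \<in> \<Omega>. ?t1 < u x \<and> u x \<le> t2} x
        + ennreal (Q\<^sup>2 * (norm (g x))\<^sup>2) * indicator {x. mu (u x) \<in> {s1<..s2}} x"
    proof (cases "x \<in> \<Omega> \<and> ?t1 < u x \<and> u x \<le> t2")
      case True
      then have "s1 < mu (u x)" "mu (u x) \<le> s2"
        using m1 m2 mu_antimono[of "u x" t2] mu_antimono[of ?t1 "u x"] by auto
      moreover have "2 * a * Q * norm (g x) \<le> a\<^sup>2 + Q\<^sup>2 * (norm (g x))\<^sup>2"
        using zero_le_power2[of "a - Q * norm (g x)"] by (simp add: power2_diff power_mult_distrib)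
      ultimately show ?thesis using True by (simp add: ennreal_plus[symmetric] ennreal_leI del: ennreal_plus)
    next
      case False
      then show ?thesis using g_outside[of x] by (auto simp: indicator_def)
    qed
  qed
  also have "\<dots> = ennreal (a\<^sup>2) * emeasure lborel {x \<in> \<Omega>. ?t1 < u x \<and> u x \<le> t2} + emeasure energy_measure {s1<..s2}"
    by (subst nn_integral_add) (auto simp: nn_integral_cmult emeasure_energy_measure)
  also have "\<dots> \<le> ennreal (a\<^sup>2) * ennreal (s2 - s1) + emeasure energy_measure {s1<..s2}"
    unfolding emeasure_layer[OF t2(1)] using m1 m2 by (intro add_right_mono mult_left_mono ennreal_leI) auto
  finally show ?thesis .
qed

text \<open>
  The upper level of the layer tends to \<open>ustar s1\<close> from below, and no mass is lost in the limit because the set of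
  levels belonging to \<open>(s1, s2]\<close> is half-open.
\<close>

lemma interval_inequality:
  assumes a: "a > 0" and s: "0 < s1" "s1 < s2" "s2 < L"
  shows "ennreal (2 * a) * emeasure level_measure {s1<..s2} \<le> ennreal (a\<^sup>2) * emeasure lborel {s1<..s2} + emeasure energy_measure {s1<..s2}"
proof -
  define D where "D = density lborel (\<lambda>t. ennreal (psi (mu t)))"
  have D: "emeasure D A = (\<integral>\<^sup>+t. ennreal (psi (mu t)) * indicator A t \<partial>lborel)" if "A \<in> sets borel" for A
    unfolding D_def using that by (subst emeasure_density) auto
  have th: "emeasure level_measure {s1<..s2} = emeasure D {ustar s2..<ustar s1}"
    using level_interval[of s1 s2] s by (simp add: emeasure_level_measure D)
  show ?thesis
  proof (cases "ustar s2 < ustar s1")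
    case False
    then show ?thesis by (simp add: th)
  next
    case True
    define d where "d = ustar s1 - ustar s2"
    have d: "d > 0" using True by (simp add: d_def)
    let ?t = "\<lambda>n. ustar s1 - d / real (Suc n)"
    have t: "ustar s2 \<le> ?t n" "?t n < ustar s1" for n
    proof -
      have "d / real (Suc n) \<le> d / 1" using d by (intro divide_left_mono) auto
      then show "ustar s2 \<le> ?t n" by (simp add: d_def)
      show "?t n < ustar s1" using d by simp
    qed
    have inc: "incseq (\<lambda>n. {ustar s2..?t n})"
    proof (rule incseq_SucI)
      fix n
      have "d / real (Suc (Suc n)) \<le> d / real (Suc n)" using d by (intro divide_left_mono) auto
      then show "{ustar s2..?t n} \<subseteq> {ustar s2..?t (Suc n)}" by auto
    qed
    have "(\<Union>n. {ustar s2..?t n}) = {ustar s2..<ustar s1}"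
    proof
      show "(\<Union>n. {ustar s2..?t n}) \<subseteq> {ustar s2..<ustar s1}" using t(2) by (force intro: order.strict_trans1)
      show "{ustar s2..<ustar s1} \<subseteq> (\<Union>n. {ustar s2..?t n})"
      proof
        fix y assume y: "y \<in> {ustar s2..<ustar s1}"
        then have "0 < (ustar s1 - y) / d" using d by simp
        then obtain n where "1 / real (Suc n) < (ustar s1 - y) / d" by (rule nat_approx_posE)
        then have "d / real (Suc n) < ustar s1 - y" using d by (simp add: field_simps)
        then show "y \<in> (\<Union>n. {ustar s2..?t n})" using y by (auto intro!: exI[of _ n])
      qed
    qed
    then have "emeasure D {ustar s2..<ustar s1} = (SUP n. emeasure D {ustar s2..?t n})"
      using inc by (subst SUP_emeasure_incseq) (auto simp: D_def)
    then have "ennreal (2 * a) * emeasure level_measure {s1<..s2} = (SUP n. ennreal (2 * a) * emeasure D {ustar s2..?t n})"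
      by (simp add: th SUP_mult_left_ennreal)
    also have "\<dots> \<le> ennreal (a\<^sup>2) * ennreal (s2 - s1) + emeasure energy_measure {s1<..s2}"
      using layer_inequality[OF a s t] by (intro SUP_least) (simp add: D)
    finally show ?thesis using s by simp
  qed
qed

text \<open>
  The density of the level measure, divided by the profile, is minus the derivative of the rearrangement: integrating
  \<open>1 / psi\<close> against the level measure of \<open>(s1, s2]\<close> returns the length of the corresponding interval of levels.
\<close>

lemma rearrangement_density:
  assumes "0 < L"
  obtains w :: "real \<Rightarrow> real" where "w \<in> borel_measurable borel" "\<forall>s. w s \<ge> 0"
    "\<forall>s1 s2. 0 < s1 \<longrightarrow> s1 \<le> s2 \<longrightarrow> s2 < L \<longrightarrow>
      ennreal (ustar s1 - ustar s2) = (\<integral>\<^sup>+s. ennreal (w s) * indicator {s1<..s2} s \<partial>lborel)"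
    "(\<integral>\<^sup>+s. ennreal ((w s * psi s)\<^sup>2) * indicator {0<..<L} s \<partial>lborel) \<le> ennreal (Q\<^sup>2 * energy)"
proof -
  let ?S = "{0<..<L}"
  have sets: "sets level_measure = sets borel" "sets energy_measure = sets borel" by (simp_all add: level_measure_def energy_measure_def)
  have fin: "emeasure energy_measure UNIV < \<infinity>" by (simp add: energy_measure_UNIV)
  have SL: "emeasure lborel ?S < \<infinity>" using assms by simp
  have ineq: "ennreal (2 * a) * emeasure level_measure A \<le> ennreal (a\<^sup>2) * emeasure lborel A + emeasure energy_measure A"
    if a: "a > 0" and A: "A \<in> sets borel" "A \<subseteq> ?S" for a A
  proof (rule interval_inequality_imp_borel_inequality[OF sets fin _ _ SL _ A])
    fix s1 s2 :: real assume s: "s1 < s2" "{s1..s2} \<subseteq> ?S"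
    have "s1 \<in> ?S" by (rule subsetD[OF s(2)]) (use s(1) in simp)
    moreover have "s2 \<in> ?S" by (rule subsetD[OF s(2)]) (use s(1) in simp)
    ultimately show "ennreal (2 * a) * emeasure level_measure {s1<..s2} \<le> ennreal (a\<^sup>2) * emeasure lborel {s1<..s2} + emeasure energy_measure {s1<..s2}"
      using s by (intro interval_inequality[OF a]) auto
  qed auto
  have Sb: "?S \<in> sets borel" by simp
  obtain p where [measurable]: "p \<in> borel_measurable borel" and p0': "\<forall>s. p s \<ge> 0"
    and p': "\<forall>A\<in>sets borel. A \<subseteq> ?S \<longrightarrow> emeasure level_measure A = (\<integral>\<^sup>+s. ennreal (p s) * indicator A s \<partial>lborel)"
    and p2: "(\<integral>\<^sup>+s. ennreal ((p s)\<^sup>2) * indicator ?S s \<partial>lborel) \<le> emeasure energy_measure UNIV"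
    by (rule square_integrable_density_exists[OF sets fin Sb SL ineq])
  note p0 = p0'[rule_format] and p = p'[rule_format]
  have [measurable_cong]: "sets level_measure = sets borel" by (rule sets)
  have eq: "density level_measure (indicator ?S) = density lborel (\<lambda>s. ennreal (p s) * indicator ?S s)"
  proof (rule measure_eqI)
    fix A assume "A \<in> sets (density level_measure (indicator ?S))"
    then have [measurable]: "A \<in> sets borel" by (simp add: sets)
    have "emeasure (density level_measure (indicator ?S)) A = emeasure level_measure (?S \<inter> A)"
      by (subst emeasure_density) (auto simp: indicator_inter_arith[symmetric] sets)
    also have "\<dots> = (\<integral>\<^sup>+s. ennreal (p s) * indicator (?S \<inter> A) s \<partial>lborel)" by (rule p) auto
    also have "\<dots> = emeasure (density lborel (\<lambda>s. ennreal (p s) * indicator ?S s)) A"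
      by (subst emeasure_density) (auto simp: indicator_inter_arith mult.assoc)
    finally show "emeasure (density level_measure (indicator ?S)) A = emeasure (density lborel (\<lambda>s. ennreal (p s) * indicator ?S s)) A" .
  qed (simp add: sets)
  define w where "w s = p s / psi s" for s
  show ?thesis
  proof
    show [measurable]: "w \<in> borel_measurable borel" unfolding w_def[abs_def] by measurable
    show "\<forall>s. w s \<ge> 0" by (simp add: w_def p0 psi_nonneg)
    have "(\<integral>\<^sup>+s. ennreal ((w s * psi s)\<^sup>2) * indicator ?S s \<partial>lborel) = (\<integral>\<^sup>+s. ennreal ((p s)\<^sup>2) * indicator ?S s \<partial>lborel)"
      using psi_pos by (intro nn_integral_cong) (auto simp: w_def indicator_def dest: psi_pos)
    then show "(\<integral>\<^sup>+s. ennreal ((w s * psi s)\<^sup>2) * indicator ?S s \<partial>lborel) \<le> ennreal (Q\<^sup>2 * energy)"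
      using p2 by (simp add: energy_measure_UNIV)
    show "\<forall>s1 s2. 0 < s1 \<longrightarrow> s1 \<le> s2 \<longrightarrow> s2 < L \<longrightarrow>
      ennreal (ustar s1 - ustar s2) = (\<integral>\<^sup>+s. ennreal (w s) * indicator {s1<..s2} s \<partial>lborel)"
    proof (intro allI impI)
      fix s1 s2 assume s: "0 < s1" "s1 \<le> s2" "s2 < L"
      let ?h = "\<lambda>s. ennreal (1 / psi s) * indicator {s1<..s2} s"
      have sub: "indicator ?S s * indicator {s1<..s2} s = (indicator {s1<..s2} s :: ennreal)" for s
        using s by (auto simp: indicator_def)
      have "(\<integral>\<^sup>+s. ennreal (w s) * indicator {s1<..s2} s \<partial>lborel) = (\<integral>\<^sup>+s. (ennreal (p s) * indicator ?S s) * ?h s \<partial>lborel)"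
        using s by (intro nn_integral_cong) (auto simp: w_def indicator_def p0 psi_nonneg ennreal_mult[symmetric])
      also have "\<dots> = (\<integral>\<^sup>+s. ?h s \<partial>density lborel (\<lambda>s. ennreal (p s) * indicator ?S s))"
        by (rule nn_integral_density[symmetric]) measurable
      also have "\<dots> = (\<integral>\<^sup>+s. ?h s \<partial>density level_measure (indicator ?S))" by (simp only: eq)
      also have "\<dots> = (\<integral>\<^sup>+s. indicator ?S s * ?h s \<partial>level_measure)"
        by (rule nn_integral_density) measurable
      also have "\<dots> = (\<integral>\<^sup>+s. ?h s \<partial>level_measure)" by (intro nn_integral_cong) (metis sub mult.left_commute)
      also have "\<dots> = (\<integral>\<^sup>+t. ?h (mu t) \<partial>density lborel (\<lambda>t. ennreal (psi (mu t))))"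
        unfolding level_measure_def by (rule nn_integral_distr) measurable
      also have "\<dots> = (\<integral>\<^sup>+t. ennreal (psi (mu t)) * ?h (mu t) \<partial>lborel)"
        by (rule nn_integral_density) measurable
      also have "\<dots> = (\<integral>\<^sup>+t. indicator {t. s1 < mu t \<and> mu t \<le> s2} t \<partial>lborel)"
      proof (intro nn_integral_cong)
        fix t
        show "ennreal (psi (mu t)) * ?h (mu t) = indicator {t. s1 < mu t \<and> mu t \<le> s2} t"
          using psi_pos[of "mu t"] s by (auto simp: indicator_def ennreal_mult[symmetric])
      qed
      also have "\<dots> = emeasure lborel {ustar s2..<ustar s1}" by (simp add: level_interval[OF s])
      also have "\<dots> = ennreal (ustar s1 - ustar s2)"
        using rearrangement_antimono[OF s] by simp
      finally show "ennreal (ustar s1 - ustar s2) = (\<integral>\<^sup>+s. ennreal (w s) * indicator {s1<..s2} s \<partial>lborel)" ..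
    qed
  qed
qed

end

section \<open>Radial functions\<close>

text \<open>
  The volume of the centred ball through \<open>x\<close>; the Schwarz symmetrization is \<open>ustar\<close> composed with it.
\<close>

definition radial_volume :: "'a::euclidean_space \<Rightarrow> real" where
  "radial_volume x = measure lebesgue (ball (0::'a) 1) * norm x ^ DIM('a)"

text \<open>
  The exponent \<open>DIM('a) - 2\<close> is a truncated difference and is meant for dimension at least 2, where the field is
  continuous at the origin.
\<close>

definition radial_volume_grad :: "'a::euclidean_space \<Rightarrow> 'a" where
  "radial_volume_grad x = (measure lebesgue (ball (0::'a) 1) * DIM('a) * norm x ^ (DIM('a) - 2)) *\<^sub>R x"

lemma unit_ball_measure_pos: "measure lebesgue (ball (0::'a::euclidean_space) 1) > 0"
  by (simp add: content_ball)

lemma borel_radial_volume [measurable]: "radial_volume \<in> borel_measurable borel"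
  unfolding radial_volume_def[abs_def] by measurable

lemma borel_radial_volume_grad [measurable]: "radial_volume_grad \<in> borel_measurable borel"
  unfolding radial_volume_grad_def[abs_def] by measurable

lemma radial_volume_nonneg: "radial_volume x \<ge> 0"
  by (simp add: radial_volume_def)

lemma radial_volume_eq_0_iff: "radial_volume (x::'a::euclidean_space) = 0 \<longleftrightarrow> x = 0"
  using unit_ball_measure_pos[where 'a='a] by (simp add: radial_volume_def)

lemma radial_volume_pos: "x \<noteq> 0 \<Longrightarrow> radial_volume (x::'a::euclidean_space) > 0"
  using radial_volume_nonneg[of x] radial_volume_eq_0_iff[of x] by linarith

lemma centred_ball_eq:
  assumes "m \<ge> 0"
  shows "centred_ball m = {x::'a::euclidean_space. radial_volume x < m}"
proof -
  let ?c = "measure lebesgue (ball (0::'a) 1)" and ?q = "(m / measure lebesgue (ball (0::'a) 1)) powr (1 / DIM('a))"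
  have c: "?c > 0" by (rule unit_ball_measure_pos)
  have qn: "?q ^ DIM('a) = m / ?c"
  proof (cases "m = 0")
    case False
    then have "m / ?c > 0" using assms c by simp
    moreover have "(z powr (1 / DIM('a))) ^ DIM('a) = z" if "z > 0" for z :: real
      using that by (subst powr_realpow [symmetric]) (simp_all add: powr_powr)
    ultimately show ?thesis by blast
  qed simp
  have "norm x < ?q \<longleftrightarrow> norm x ^ DIM('a) < ?q ^ DIM('a)" for x :: 'a
    by (meson DIM_positive norm_ge_zero powr_ge_zero power_less_imp_less_base power_strict_mono)
  then have "norm x < ?q \<longleftrightarrow> radial_volume x < m" for x :: 'a
    unfolding qn radial_volume_def using c by (simp add: field_simps)
  moreover have "x \<in> centred_ball m \<longleftrightarrow> norm x < ?q" for x :: 'a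
    by (simp add: centred_ball_def)
  ultimately show ?thesis by blast
qed

lemma emeasure_radial_less: "emeasure lborel {x::'a::euclidean_space. radial_volume x < m} = ennreal m"
proof (cases "m \<ge> 0")
  case True
  have b: "{x::'a. radial_volume x < m} = ball 0 ((m / measure lebesgue (ball (0::'a) 1)) powr (1 / DIM('a)))"
    using centred_ball_eq[OF True, where 'a='a] by (simp add: centred_ball_def)
  have "emeasure lborel {x::'a. radial_volume x < m} = ennreal (measure lborel {x::'a. radial_volume x < m})"
  proof (rule emeasure_eq_ennreal_measure)
    show "emeasure lborel {x::'a. radial_volume x < m} \<noteq> top"
      using emeasure_bounded_finite[OF bounded_ball, of "0::'a" "(m / measure lebesgue (ball (0::'a) 1)) powr (1 / DIM('a))"]
      unfolding b by auto
  qed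
  also have "measure lborel {x::'a. radial_volume x < m} = measure lebesgue {x::'a. radial_volume x < m}"
    by (rule measure_completion[symmetric]) simp
  also have "\<dots> = m" using measure_centred_ball[OF True, where 'a='a] by (simp add: centred_ball_eq[OF True])
  finally show ?thesis .
next
  case False
  have "\<not> radial_volume x < m" for x :: 'a using radial_volume_nonneg[of x] False by linarith
  then have "{x::'a. radial_volume x < m} = {}" by blast
  then show ?thesis using False by (simp add: ennreal_neg)
qed

lemma measure_eqI_Iio:
  fixes M N :: "real measure"
  assumes sets: "sets M = sets borel" "sets N = sets borel"
  assumes fin: "\<And>b. emeasure M {..<b} < \<infinity>"
  assumes eq: "\<And>b. emeasure M {..<b} = emeasure N {..<b}"
  shows "M = N"
proof (rule measure_eqI_generator_eq_countable)
  let ?LT = "\<lambda>a::real. {..<a}" let ?E = "range ?LT"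
  have "{..<a} \<inter> {..<b} = {..<min a b}" for a b :: real by auto
  then show "Int_stable ?E" by (auto simp: Int_stable_def)
  show "?E \<subseteq> Pow UNIV" "sets M = sigma_sets UNIV ?E" "sets N = sigma_sets UNIV ?E"
    unfolding sets borel_Iio by auto
  show "?LT`Rats \<subseteq> ?E" by auto
  show "emeasure M a \<noteq> \<infinity>" if "a \<in> ?LT`Rats" for a using that fin by (auto simp: less_top)
  show "(\<Union>i\<in>Rats. ?LT i) = UNIV"
  proof -
    have "\<exists>q\<in>Rats. x < q" for x :: real using Rats_dense_in_real[of x "x + 1"] by auto
    then show ?thesis by auto
  qed
qed (auto intro: eq countable_rat)

text \<open>
  The volume function transports Lebesgue measure to Lebesgue measure on the positive half-line, because its sublevel
  sets are balls of the prescribed measure.  This takes the place of polar coordinates.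
\<close>

lemma nn_integral_radial:
  assumes [measurable]: "h \<in> borel_measurable borel"
  shows "(\<integral>\<^sup>+x. h (radial_volume (x::'a::euclidean_space)) \<partial>lborel) = (\<integral>\<^sup>+s. h s * indicator {0<..} s \<partial>lborel)"
proof -
  let ?N = "density lborel (\<lambda>s. indicator {0::real<..} s)"
  have "distr (lborel :: 'a measure) borel radial_volume = ?N"
  proof (rule measure_eqI_Iio)
    fix b :: real
    have "emeasure (distr (lborel :: 'a measure) borel radial_volume) {..<b} = emeasure lborel {x::'a. radial_volume x < b}"
      by (subst emeasure_distr) (auto intro!: arg_cong2[of _ _ _ _ emeasure])
    then have 1: "emeasure (distr (lborel :: 'a measure) borel radial_volume) {..<b} = ennreal b" by (simp add: emeasure_radial_less)
    have "emeasure ?N {..<b} = (\<integral>\<^sup>+s. indicator {0<..} s * indicator {..<b} s \<partial>lborel)"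
      by (rule emeasure_density) auto
    also have "\<dots> = (\<integral>\<^sup>+s. indicator {0<..<b} s \<partial>lborel)"
      by (intro nn_integral_cong) (auto simp: indicator_def)
    finally have "emeasure ?N {..<b} = (\<integral>\<^sup>+s. indicator {0<..<b} s \<partial>lborel)" .
    then have 2: "emeasure ?N {..<b} = ennreal b" by (cases "b \<ge> 0") (auto simp: ennreal_neg)
    show "emeasure (distr (lborel :: 'a measure) borel radial_volume) {..<b} = emeasure ?N {..<b}" using 1 2 by simp
    show "emeasure (distr (lborel :: 'a measure) borel radial_volume) {..<b} < \<infinity>" using 1 by simp
  qed simp_all
  then have "(\<integral>\<^sup>+x. h (radial_volume (x::'a)) \<partial>lborel) = (\<integral>\<^sup>+s. h s \<partial>?N)"
    by (subst nn_integral_distr[symmetric, of radial_volume lborel borel h]) auto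
  also have "\<dots> = (\<integral>\<^sup>+s. h s * indicator {0<..} s \<partial>lborel)"
    by (subst nn_integral_density) (auto simp: mult.commute)
  finally show ?thesis .
qed

lemma radial_volume_has_derivative:
  assumes dim: "DIM('a) \<ge> 2"
  shows "(radial_volume has_derivative (\<lambda>h. radial_volume_grad x \<bullet> h)) (at (x::'a::euclidean_space))"
proof -
  let ?c = "measure lebesgue (ball (0::'a) 1)" and ?n = "DIM('a)"
  show ?thesis
  proof (cases "x = 0")
    case True
    have "((\<lambda>h::'a. norm (radial_volume (0 + h) - radial_volume (0::'a) - 0) / norm h) \<longlongrightarrow> 0) (at 0)"
    proof (rule Lim_null_comparison[where g="\<lambda>h. ?c * norm h ^ (?n - 1)"])
      have "((\<lambda>h::'a. ?c * norm h ^ (?n - 1)) \<longlongrightarrow> ?c * norm (0::'a) ^ (?n - 1)) (at 0)"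
        by (intro tendsto_intros)
      then show "((\<lambda>h::'a. ?c * norm h ^ (?n - 1)) \<longlongrightarrow> 0) (at 0)" using dim by (simp add: power_0_left)
      show "\<forall>\<^sub>F h::'a in at 0. norm (norm (radial_volume (0 + h) - radial_volume (0::'a) - 0) / norm h) \<le> ?c * norm h ^ (?n - 1)"
      proof (intro always_eventually allI)
        fix h :: 'a
        have "norm h ^ ?n = norm h ^ (?n - 1) * norm h" using dim by (metis One_nat_def Suc_pred DIM_positive power_Suc2)
        then show "norm (norm (radial_volume (0 + h) - radial_volume (0::'a) - 0) / norm h) \<le> ?c * norm h ^ (?n - 1)"
          using dim by (cases "h = 0") (simp_all add: radial_volume_def abs_mult power_0_left)
      qed
    qed
    then have "(radial_volume has_derivative (\<lambda>h. 0)) (at (0::'a))"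
      unfolding has_derivative_at by simp
    then show ?thesis using True by (simp add: radial_volume_grad_def)
  next
    case False
    have e: "norm x ^ (?n - 1) = norm x ^ (?n - 2) * norm x"
    proof -
      have "?n - 1 = Suc (?n - 2)" using dim by simp
      then show ?thesis by (simp only: power_Suc2)
    qed
    have "((\<lambda>x::'a. ?c * norm x ^ ?n) has_derivative (\<lambda>h. ?c * (real ?n * (h \<bullet> sgn x) * norm x ^ (?n - 1)))) (at x)"
      by (rule has_derivative_mult_right[OF has_derivative_power[OF has_derivative_norm[OF False]], THEN has_derivative_eq_rhs])
        (simp add: fun_eq_iff inner_commute)
    moreover have "?c * (real ?n * (h \<bullet> sgn x) * norm x ^ (?n - 1)) = radial_volume_grad x \<bullet> h" for h
      using False by (simp add: radial_volume_grad_def e sgn_div_norm inner_commute field_simps del: One_nat_def)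
    ultimately show ?thesis unfolding radial_volume_def[abs_def] by simp
  qed
qed

lemma norm_radial_volume_grad:
  assumes dim: "DIM('a) \<ge> 2"
  shows "norm (radial_volume_grad (x::'a::euclidean_space)) =
    DIM('a) * measure lebesgue (ball (0::'a) 1) powr (1 / DIM('a)) * radial_volume x powr (1 - 1 / DIM('a))"
proof (cases "x = 0")
  case True
  then show ?thesis using dim by (simp add: radial_volume_grad_def radial_volume_def power_0_left)
next
  case False
  let ?c = "measure lebesgue (ball (0::'a) 1)" and ?n = "DIM('a)"
  have c: "?c > 0" by (rule unit_ball_measure_pos)
  have x: "norm x > 0" using False by simp
  have e: "norm x ^ (?n - 2) * norm x = norm x ^ (?n - 1)"
  proof -
    have "?n - 1 = Suc (?n - 2)" using dim by simp
    then show ?thesis by (simp only: power_Suc2)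
  qed
  have "radial_volume x powr (1 - 1 / ?n) = ?c powr (1 - 1 / ?n) * (norm x ^ ?n) powr (1 - 1 / ?n)"
    unfolding radial_volume_def by (rule powr_mult)
  also have "(norm x ^ ?n) powr (1 - 1 / ?n) = norm x powr (real ?n * (1 - 1 / ?n))"
    using x by (simp add: powr_realpow[symmetric] powr_powr)
  also have "real ?n * (1 - 1 / ?n) = real (?n - 1)" using dim by (simp add: field_simps of_nat_diff)
  also have "norm x powr real (?n - 1) = norm x ^ (?n - 1)" using x by (rule powr_realpow)
  finally have r: "radial_volume x powr (1 - 1 / ?n) = ?c powr (1 - 1 / ?n) * norm x ^ (?n - 1)" .
  have "?c powr (1 / ?n) * ?c powr (1 - 1 / ?n) = ?c" using c by (simp add: powr_add[symmetric])
  note cc = this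
  have "norm (radial_volume_grad x) = ?c * ?n * (norm x ^ (?n - 2) * norm x)"
    using c by (simp add: radial_volume_grad_def)
  also have "\<dots> = (?c powr (1 / ?n) * ?c powr (1 - 1 / ?n)) * ?n * norm x ^ (?n - 1)" by (simp only: e cc)
  also have "\<dots> = ?n * ?c powr (1 / ?n) * radial_volume x powr (1 - 1 / ?n)" unfolding r by (simp only: mult_ac)
  finally show ?thesis .
qed

text \<open>
  Continuously differentiable approximations from below of the positive part, with derivatives between 0 and 1 that
  tend to the indicator of the positive half-line.
\<close>

definition smooth_positive_part :: "nat \<Rightarrow> real \<Rightarrow> real" where
  "smooth_positive_part k y = sqrt (1 / Suc k + (max 0 y)\<^sup>2) - sqrt (1 / Suc k)"

definition smooth_positive_part_deriv :: "nat \<Rightarrow> real \<Rightarrow> real" where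
  "smooth_positive_part_deriv k y = max 0 y / sqrt (1 / Suc k + (max 0 y)\<^sup>2)"

lemma smooth_positive_part_radicand: "1 / real (Suc k) + (max 0 y)\<^sup>2 > 0"
  by (simp add: add_pos_nonneg)

lemma smooth_positive_part_has_derivative: "(smooth_positive_part k has_real_derivative smooth_positive_part_deriv k y) (at y)"
proof -
  have "((\<lambda>y. 1 / real (Suc k) + (max 0 y)\<^sup>2) has_real_derivative 0 + 2 * max 0 y) (at y)"
    by (intro DERIV_add DERIV_const square_positive_part_has_derivative)
  from DERIV_chain2[OF DERIV_real_sqrt[OF smooth_positive_part_radicand] this]
  have "((\<lambda>y. sqrt (1 / Suc k + (max 0 y)\<^sup>2)) has_real_derivative
      inverse (sqrt (1 / Suc k + (max 0 y)\<^sup>2)) / 2 * (0 + 2 * max 0 y)) (at y)" .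
  note 1 = DERIV_diff[OF this DERIV_const[of "sqrt (1 / Suc k)"]]
  have "inverse z / 2 * (0 + 2 * p) - 0 = p / z" for z p :: real by (simp add: inverse_eq_divide)
  from DERIV_cong[OF 1 this] show ?thesis
    unfolding smooth_positive_part_def[abs_def] smooth_positive_part_deriv_def .
qed

lemma smooth_positive_part_bounds: "0 \<le> smooth_positive_part k y" "smooth_positive_part k y \<le> max 0 y" "\<bar>smooth_positive_part_deriv k y\<bar> \<le> 1"
proof -
  show "0 \<le> smooth_positive_part k y" by (simp add: smooth_positive_part_def)
  have "sqrt (1 / Suc k + (max 0 y)\<^sup>2) \<le> sqrt (1 / Suc k) + sqrt ((max 0 y)\<^sup>2)"
    by (rule sqrt_add_le_add_sqrt) auto
  then show "smooth_positive_part k y \<le> max 0 y" by (simp add: smooth_positive_part_def)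
  have "sqrt ((max 0 y)\<^sup>2) \<le> sqrt (1 / Suc k + (max 0 y)\<^sup>2)" by (intro real_sqrt_le_mono) simp
  then have "max 0 y \<le> sqrt (1 / Suc k + (max 0 y)\<^sup>2)" by simp
  then show "\<bar>smooth_positive_part_deriv k y\<bar> \<le> 1"
    unfolding smooth_positive_part_deriv_def using smooth_positive_part_radicand[of k y] by (simp add: abs_divide divide_le_eq)
qed

lemma borel_smooth_pos [measurable]:
  "smooth_positive_part k \<in> borel_measurable borel" "smooth_positive_part_deriv k \<in> borel_measurable borel"
  unfolding smooth_positive_part_def[abs_def] smooth_positive_part_deriv_def[abs_def] by measurable

lemma smooth_positive_part_limit:
  "(\<lambda>k. smooth_positive_part k y) \<longlonglongrightarrow> max 0 y"
  "(\<lambda>k. smooth_positive_part_deriv k y) \<longlonglongrightarrow> (if y > 0 then 1 else 0)"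
proof -
  have 0: "(\<lambda>k. 1 / real (Suc k)) \<longlonglongrightarrow> 0" by (rule LIMSEQ_Suc) (rule lim_1_over_n)
  have 1: "(\<lambda>k. sqrt (1 / Suc k + (max 0 y)\<^sup>2)) \<longlonglongrightarrow> sqrt (0 + (max 0 y)\<^sup>2)"
    by (intro tendsto_intros 0)
  have "(\<lambda>k. smooth_positive_part k y) \<longlonglongrightarrow> sqrt (0 + (max 0 y)\<^sup>2) - sqrt 0"
    unfolding smooth_positive_part_def by (intro tendsto_diff 1 tendsto_real_sqrt 0)
  then show "(\<lambda>k. smooth_positive_part k y) \<longlonglongrightarrow> max 0 y" by simp
  show "(\<lambda>k. smooth_positive_part_deriv k y) \<longlonglongrightarrow> (if y > 0 then 1 else 0)"
  proof (cases "y > 0")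
    case True
    have "(\<lambda>k. smooth_positive_part_deriv k y) \<longlonglongrightarrow> max 0 y / sqrt (0 + (max 0 y)\<^sup>2)"
      unfolding smooth_positive_part_deriv_def by (intro tendsto_divide tendsto_const 1) (use True in auto)
    then show ?thesis using True by simp
  qed (simp add: smooth_positive_part_deriv_def)
qed

text \<open>
  Integration by parts for the Lipschitz function \<open>max 0 (b - radial_volume x)\<close>, obtained from its smooth
  approximations.
\<close>

lemma integral_truncated_cone:
  fixes \<phi> :: "'a::euclidean_space \<Rightarrow> real"
  assumes dim: "DIM('a) \<ge> 2" and \<phi>: "C1c U \<phi>"
  shows "(LBINT x. max 0 (b - radial_volume x) * frechet_derivative \<phi> (at x) e)
    = (LBINT x. indicator {x. radial_volume x < b} x * ((radial_volume_grad x \<bullet> e) * \<phi> x))"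
    and "integrable lborel (\<lambda>x. (radial_volume_grad x \<bullet> e) * \<phi> x)"
proof -
  let ?D = "\<lambda>x. frechet_derivative \<phi> (at x) e" and ?T = "radial_volume :: 'a \<Rightarrow> real" and ?H = "\<lambda>x. (radial_volume_grad x \<bullet> e) * \<phi> x"
  note [measurable] = C1c_borel(1)[OF \<phi>] C1c_borel(2)[OF \<phi>, of e]
  obtain C R where "\<forall>x. \<bar>\<phi> x\<bar> \<le> C" "\<forall>x. \<bar>?D x\<bar> \<le> C"
    "\<forall>x. R < norm x \<longrightarrow> \<phi> x = 0" "\<forall>x. R < norm x \<longrightarrow> ?D x = 0"
    by (rule C1c_bounds[OF \<phi>, where e=e])
  note C = this[rule_format]
  have C0: "C \<ge> 0" using C(1)[of 0] by linarith
  let ?c = "measure lebesgue (ball (0::'a) 1)"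
  define A where "A = ?c * DIM('a) * max 0 R ^ (DIM('a) - 2) * max 0 R * norm e * C"
  have HA: "\<bar>?H x\<bar> \<le> A" for x
  proof (cases "R < norm x")
    case True
    then show ?thesis using C(3) C0 by (simp add: A_def)
  next
    case False
    have "\<bar>radial_volume_grad x \<bullet> e\<bar> \<le> norm (radial_volume_grad x) * norm e" by (rule Cauchy_Schwarz_ineq2)
    also have "norm (radial_volume_grad x) = ?c * DIM('a) * norm x ^ (DIM('a) - 2) * norm x" by (simp add: radial_volume_grad_def)
    also have "\<dots> * norm e \<le> ?c * DIM('a) * max 0 R ^ (DIM('a) - 2) * max 0 R * norm e"
      using False by (intro mult_right_mono mult_mono power_mono) auto
    finally show ?thesis unfolding abs_mult A_def using C(1)[of x] by (intro mult_mono) auto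
  qed
  show iH: "integrable lborel ?H"
    by (rule integrable_bounded_support[where B=A and R=R]) (use HA C(3) in auto)
  have bk: "\<bar>smooth_positive_part k (b - ?T x)\<bar> \<le> \<bar>b\<bar>" for k x
    using smooth_positive_part_bounds(1,2)[of k "b - ?T x"] radial_volume_nonneg[of x] by linarith
  have id: "(LBINT x. smooth_positive_part k (b - ?T x) * ?D x) = (LBINT x. smooth_positive_part_deriv k (b - ?T x) * ?H x)" for k
  proof -
    let ?w' = "\<lambda>x. smooth_positive_part k (b - ?T x) * ?D x - smooth_positive_part_deriv k (b - ?T x) * ?H x"
    have "((\<lambda>\<tau>. smooth_positive_part k (b - ?T (x + \<tau> *\<^sub>R e)) * \<phi> (x + \<tau> *\<^sub>R e)) has_real_derivative ?w' x) (at 0)" for x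
    proof -
      have "((\<lambda>\<tau>. b - ?T (x + \<tau> *\<^sub>R e)) has_real_derivative 0 - radial_volume_grad x \<bullet> e) (at 0)"
        by (intro DERIV_diff DERIV_const line_derivative radial_volume_has_derivative[OF dim])
      from DERIV_mult[OF DERIV_chain2[OF smooth_positive_part_has_derivative this] line_derivative[OF C1c_has_derivative[OF \<phi>], of x e]]
      show ?thesis by (rule DERIV_cong) (simp add: algebra_simps)
    qed
    moreover have "\<bar>?w' x\<bar> \<le> \<bar>b\<bar> * C + 1 * A" for x
    proof -
      have "\<bar>smooth_positive_part k (b - ?T x) * ?D x\<bar> \<le> \<bar>b\<bar> * C"
        unfolding abs_mult by (intro mult_mono bk C(2)) auto
      moreover have "\<bar>smooth_positive_part_deriv k (b - ?T x) * ?H x\<bar> \<le> 1 * A"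
        unfolding abs_mult[of _ "?H x"] by (intro mult_mono smooth_positive_part_bounds(3) HA) auto
      ultimately show ?thesis by linarith
    qed
    moreover have "integrable lborel (\<lambda>x. smooth_positive_part k (b - ?T x) * \<phi> x)"
      using integrable_mult_bounded[OF C1c_integrable(1)[OF \<phi>], of "\<lambda>x. smooth_positive_part k (b - ?T x)" "\<bar>b\<bar>"] bk by (simp add: mult.commute)
    ultimately have "(LBINT x. ?w' x) = 0"
      using C(3) by (intro integral_directional_derivative_zero[where w="\<lambda>x. smooth_positive_part k (b - ?T x) * \<phi> x" and R=R and e=e]) auto
    moreover have "integrable lborel (\<lambda>x. smooth_positive_part k (b - ?T x) * ?D x)"
      using integrable_mult_bounded[OF C1c_integrable(2)[OF \<phi>, of e], of "\<lambda>x. smooth_positive_part k (b - ?T x)" "\<bar>b\<bar>"] bk by (simp add: mult.commute)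
    moreover have "integrable lborel (\<lambda>x. smooth_positive_part_deriv k (b - ?T x) * ?H x)"
      using integrable_mult_bounded[OF iH, of "\<lambda>x. smooth_positive_part_deriv k (b - ?T x)" 1] smooth_positive_part_bounds(3) by (simp add: mult.commute)
    ultimately show ?thesis by simp
  qed
  have L1: "(\<lambda>k. LBINT x. smooth_positive_part k (b - ?T x) * ?D x) \<longlonglongrightarrow> (LBINT x. max 0 (b - ?T x) * ?D x)"
  proof (rule integral_dominated_convergence[where w="\<lambda>x. \<bar>b\<bar> * \<bar>?D x\<bar>"])
    show "AE x in lborel. (\<lambda>k. smooth_positive_part k (b - ?T x) * ?D x) \<longlonglongrightarrow> max 0 (b - ?T x) * ?D x"
      by (intro AE_I2 tendsto_intros smooth_positive_part_limit)
    show "AE x in lborel. norm (smooth_positive_part k (b - ?T x) * ?D x) \<le> \<bar>b\<bar> * \<bar>?D x\<bar>" for k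
      unfolding real_norm_def abs_mult by (intro AE_I2 mult_right_mono bk) auto
  qed (use C1c_integrable(2)[OF \<phi>, of e] in auto)
  have L2: "(\<lambda>k. LBINT x. smooth_positive_part_deriv k (b - ?T x) * ?H x) \<longlonglongrightarrow> (LBINT x. indicator {x. ?T x < b} x * ?H x)"
  proof (rule integral_dominated_convergence[where w="\<lambda>x. 1 * \<bar>?H x\<bar>"])
    show "AE x in lborel. (\<lambda>k. smooth_positive_part_deriv k (b - ?T x) * ?H x) \<longlonglongrightarrow> indicator {x. ?T x < b} x * ?H x"
    proof (rule AE_I2)
      fix x
      have "(\<lambda>k. smooth_positive_part_deriv k (b - ?T x) * ?H x) \<longlonglongrightarrow> (if b - ?T x > 0 then 1 else 0) * ?H x"
        by (intro tendsto_intros smooth_positive_part_limit)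
      then show "(\<lambda>k. smooth_positive_part_deriv k (b - ?T x) * ?H x) \<longlonglongrightarrow> indicator {x. ?T x < b} x * ?H x"
        by (auto simp: indicator_def split: if_splits)
    qed
    show "AE x in lborel. norm (smooth_positive_part_deriv k (b - ?T x) * ?H x) \<le> 1 * \<bar>?H x\<bar>" for k
      unfolding real_norm_def abs_mult[of _ "?H _"] by (intro AE_I2 mult_right_mono smooth_positive_part_bounds(3)) auto
  qed (use iH in auto)
  show "(LBINT x. max 0 (b - ?T x) * ?D x) = (LBINT x. indicator {x. ?T x < b} x * ?H x)"
    using LIMSEQ_unique[OF L1[unfolded id] L2] .
qed

text \<open>
  Exchanging the order of integration over \<open>s\<close> and over the ball of volume \<open>s\<close>.  Since \<open>|K s| \<le> C * s\<close>, the
  weight \<open>\<omega>\<close> only has to be integrable against \<open>s\<close>, which permits a singularity at 0.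
\<close>

lemma layer_fubini:
  fixes D :: "'a::euclidean_space \<Rightarrow> real" and \<omega> :: "real \<Rightarrow> real"
  assumes D: "integrable lborel D" "\<And>x. \<bar>D x\<bar> \<le> C"
    and [measurable]: "\<omega> \<in> borel_measurable borel" and \<omega>0: "\<And>s. \<omega> s \<ge> 0"
    and \<omega>: "integrable lborel (\<lambda>s. \<omega> s * s * indicator {0<..<b} s)"
  defines "K \<equiv> \<lambda>s. LBINT x. indicator {x. radial_volume x < s} x * D x"
  shows "integrable lborel (\<lambda>s. indicator {0<..<b} s * (\<omega> s * K s))"
    and "integrable lborel (\<lambda>x. (LBINT s. \<omega> s * indicator {radial_volume x<..<b} s) * D x)"
    and "(LBINT s. indicator {0<..<b} s * (\<omega> s * K s)) = (LBINT x. (LBINT s. \<omega> s * indicator {radial_volume x<..<b} s) * D x)"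
    and "\<bar>K s\<bar> \<le> C * max 0 s"
proof -
  let ?T = "radial_volume :: 'a \<Rightarrow> real"
  have [measurable]: "D \<in> borel_measurable borel" using D(1) by auto
  have C0: "C \<ge> 0" using D(2)[of 0] by linarith
  have mass: "integrable lborel (\<lambda>x. indicat_real {x. ?T x < s} x)" "(LBINT x. indicat_real {x. ?T x < s} x) = max 0 s" for s
  proof -
    show "integrable lborel (\<lambda>x. indicat_real {x. ?T x < s} x)" by (simp add: integrable_indicator_iff emeasure_radial_less)
    have "measure lborel {x. ?T x < s} = max 0 s"
      by (simp add: measure_def emeasure_radial_less) (simp add: enn2real_ennreal max_def ennreal_neg)
    then show "(LBINT x. indicat_real {x. ?T x < s} x) = max 0 s" by simp
  qed
  have absK: "(LBINT x. indicator {x. ?T x < s} x * \<bar>D x\<bar>) \<le> C * max 0 s" for s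
  proof -
    have "(LBINT x. indicator {x. ?T x < s} x * \<bar>D x\<bar>) \<le> (LBINT x. C * indicat_real {x. ?T x < s} x)"
    proof (rule integral_mono)
      show "integrable lborel (\<lambda>x. indicator {x. ?T x < s} x * \<bar>D x\<bar>)"
        by (rule Bochner_Integration.integrable_bound[OF integrable_abs[OF D(1)]]) (auto simp: indicator_def)
      show "indicator {x. ?T x < s} x * \<bar>D x\<bar> \<le> C * indicat_real {x. ?T x < s} x" for x using D(2)[of x] by (auto simp: indicator_def)
    qed (use mass in simp)
    then show ?thesis using mass by simp
  qed
  show "\<bar>K s\<bar> \<le> C * max 0 s"
  proof -
    have "\<bar>K s\<bar> \<le> (LBINT x. norm (indicator {x. ?T x < s} x * D x))"
      unfolding K_def using integral_norm_bound[of lborel "\<lambda>x. indicator {x. ?T x < s} x * D x"] by simp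
    also have "\<dots> = (LBINT x. indicator {x. ?T x < s} x * \<bar>D x\<bar>)" by (simp add: abs_mult)
    finally show ?thesis using absK[of s] by linarith
  qed
  let ?f = "\<lambda>s x. (indicator {0<..<b} s * \<omega> s) * (indicator {x. ?T x < s} x * D x)"
  have meas: "case_prod ?f \<in> borel_measurable (lborel \<Otimes>\<^sub>M lborel)"
  proof -
    have "?f = (\<lambda>s x. (indicator {0<..<b} s * \<omega> s) * ((if ?T x < s then 1 else 0) * D x))" by (auto simp: fun_eq_iff indicator_def)
    then show ?thesis by simp
  qed
  have int: "integrable (lborel \<Otimes>\<^sub>M lborel) (case_prod ?f)"
  proof (rule lborel_pair.Fubini_integrable[OF meas])
    show "integrable lborel (\<lambda>s. LBINT x. norm (case_prod ?f (s, x)))"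
    proof (rule Bochner_Integration.integrable_bound[where f="\<lambda>s. C * (\<omega> s * s * indicator {0<..<b} s)"])
      show "integrable lborel (\<lambda>s. C * (\<omega> s * s * indicator {0<..<b} s))" using \<omega> by simp
      show "(\<lambda>s. LBINT x. norm (case_prod ?f (s, x))) \<in> borel_measurable lborel"
        using meas by (intro lborel.borel_measurable_lebesgue_integral) auto
      show "AE s in lborel. norm (LBINT x. norm (case_prod ?f (s, x))) \<le> norm (C * (\<omega> s * s * indicator {0<..<b} s))"
      proof (rule AE_I2)
        fix s :: real
        have "(LBINT x. norm (case_prod ?f (s, x))) = (LBINT x. (indicator {0<..<b} s * \<omega> s) * (indicator {x. ?T x < s} x * \<bar>D x\<bar>))"
          using \<omega>0 by (intro Bochner_Integration.integral_cong) (auto simp: abs_mult)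
        also have "\<dots> = (indicator {0<..<b} s * \<omega> s) * (LBINT x. indicator {x. ?T x < s} x * \<bar>D x\<bar>)"
          by (rule integral_mult_right_zero)
        finally have e: "(LBINT x. norm (case_prod ?f (s, x))) = (indicator {0<..<b} s * \<omega> s) * (LBINT x. indicator {x. ?T x < s} x * \<bar>D x\<bar>)" .
        have n: "0 \<le> (LBINT x. indicator {x. ?T x < s} x * \<bar>D x\<bar>)" by (intro integral_nonneg_AE AE_I2) auto
        have "\<dots> \<le> C * max 0 s" by (rule absK)
        then have "(indicator {0<..<b} s * \<omega> s) * (LBINT x. indicator {x. ?T x < s} x * \<bar>D x\<bar>) \<le> (indicator {0<..<b} s * \<omega> s) * (C * max 0 s)"
          using \<omega>0 by (intro mult_left_mono) auto
        also have "\<dots> = C * (\<omega> s * s * indicator {0<..<b} s)" by (auto simp: indicator_def)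
        finally have le: "(indicator {0<..<b} s * \<omega> s) * (LBINT x. indicator {x. ?T x < s} x * \<bar>D x\<bar>) \<le> C * (\<omega> s * s * indicator {0<..<b} s)" .
        have "0 \<le> (indicator {0<..<b} s * \<omega> s) * (LBINT x. indicator {x. ?T x < s} x * \<bar>D x\<bar>)"
          by (rule mult_nonneg_nonneg[OF _ n]) (use \<omega>0 in simp)
        then show "norm (LBINT x. norm (case_prod ?f (s, x))) \<le> norm (C * (\<omega> s * s * indicator {0<..<b} s))"
          using le order_trans[OF _ abs_ge_self] unfolding e by (simp only: real_norm_def abs_of_nonneg)
      qed
    qed
    show "AE s in lborel. integrable lborel (\<lambda>x. case_prod ?f (s, x))"
    proof (rule AE_I2)
      fix s :: real
      have "integrable lborel (\<lambda>x. indicator {x. ?T x < s} x * D x)"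
        by (rule Bochner_Integration.integrable_bound[OF D(1)]) (auto simp: indicator_def)
      then show "integrable lborel (\<lambda>x. case_prod ?f (s, x))" by simp
    qed
  qed
  have i1: "(\<lambda>s. LBINT x. ?f s x) = (\<lambda>s. indicator {0<..<b} s * (\<omega> s * K s))"
    by (simp add: K_def mult.assoc)
  have i2: "(\<lambda>x. LBINT s. ?f s x) = (\<lambda>x. (LBINT s. \<omega> s * indicator {?T x<..<b} s) * D x)"
  proof
    fix x :: 'a
    have "(LBINT s. ?f s x) = (LBINT s. (\<omega> s * indicator {?T x<..<b} s) * D x)"
      using radial_volume_nonneg[of x] by (intro Bochner_Integration.integral_cong) (auto simp: indicator_def)
    then show "(LBINT s. ?f s x) = (LBINT s. \<omega> s * indicator {?T x<..<b} s) * D x" by simp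
  qed
  show "integrable lborel (\<lambda>s. indicator {0<..<b} s * (\<omega> s * K s))"
    using lborel_pair.integrable_fst[OF int] by (simp only: i1)
  show "integrable lborel (\<lambda>x. (LBINT s. \<omega> s * indicator {radial_volume x<..<b} s) * D x)"
    using lborel_pair.integrable_snd[OF int] by (simp only: i2)
  show "(LBINT s. indicator {0<..<b} s * (\<omega> s * K s)) = (LBINT x. (LBINT s. \<omega> s * indicator {radial_volume x<..<b} s) * D x)"
    using lborel_pair.Fubini_integral[OF int] by (simp only: i1 i2)
qed

text \<open>
  An integrated divergence theorem on balls: the integral over \<open>0 < s < b\<close> of the flux of \<open>\<phi> e\<close> through the sphere
  bounding volume \<open>s\<close>.
\<close>

lemma integral_layers_eq:
  fixes \<phi> :: "'a::euclidean_space \<Rightarrow> real"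
  assumes dim: "DIM('a) \<ge> 2" and \<phi>: "C1c U \<phi>"
  shows "(LBINT s. indicator {0<..<b} s * (LBINT x. indicator {x. radial_volume x < s} x * frechet_derivative \<phi> (at x) e))
    = (LBINT x. indicator {x. radial_volume x < b} x * ((radial_volume_grad x \<bullet> e) * \<phi> x))"
proof -
  obtain C R where "\<forall>x. \<bar>\<phi> x\<bar> \<le> C" "\<forall>x. \<bar>frechet_derivative \<phi> (at x) e\<bar> \<le> C"
    "\<forall>x. R < norm x \<longrightarrow> \<phi> x = 0" "\<forall>x. R < norm x \<longrightarrow> frechet_derivative \<phi> (at x) e = 0"
    by (rule C1c_bounds[OF \<phi>, where e=e])
  note C = this[rule_format]
  have "integrable lborel (\<lambda>s::real. 1 * s * indicator {0<..<b} s)"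
    by (rule integrable_bounded_support[where B="\<bar>b\<bar>" and R="\<bar>b\<bar>"]) (auto simp: indicator_def)
  from layer_fubini(3)[OF C1c_integrable(2)[OF \<phi>, of e] C(2) _ _ this]
  have "(LBINT s. indicator {0<..<b} s * (1 * (LBINT x. indicator {x. radial_volume x < s} x * frechet_derivative \<phi> (at x) e)))
    = (LBINT x. (LBINT s. 1 * indicator {radial_volume x<..<b} s) * frechet_derivative \<phi> (at x) e)" by simp
  moreover have "(LBINT s. 1 * indicator {t<..<b} s) = max 0 (b - t)" for t :: real
    by (simp add: max_def)
  ultimately show ?thesis using integral_truncated_cone(1)[OF dim \<phi>, of b e] by simp
qed

lemma integral_eq_enn2real_nn_integral:
  fixes f :: "'a \<Rightarrow> real"
  assumes "f \<in> borel_measurable M" "\<And>x. 0 \<le> f x"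
  shows "(\<integral>x. f x \<partial>M) = enn2real (\<integral>\<^sup>+x. ennreal (f x) \<partial>M)"
  using assms by (intro integral_eq_nn_integral) auto

lemma radial_integral:
  fixes h :: "real \<Rightarrow> real"
  assumes [measurable]: "h \<in> borel_measurable borel" and h: "\<And>s. h s \<ge> 0"
  shows "(LBINT x. h (radial_volume (x::'a::euclidean_space))) = (LBINT s. indicator {0<..} s * h s)"
    and "integrable lborel (\<lambda>x::'a. h (radial_volume x)) \<longleftrightarrow> integrable lborel (\<lambda>s. indicator {0<..} s * h s)"
proof -
  have e: "(\<integral>\<^sup>+x. ennreal (h (radial_volume (x::'a))) \<partial>lborel) = (\<integral>\<^sup>+s. ennreal (indicator {0<..} s * h s) \<partial>lborel)"
    by (subst nn_integral_radial[of "\<lambda>s. ennreal (h s)"]) (auto intro!: nn_integral_cong simp: indicator_def)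
  show "(LBINT x. h (radial_volume (x::'a))) = (LBINT s. indicator {0<..} s * h s)"
    by (subst (1 2) integral_eq_enn2real_nn_integral) (use h e in auto)
  show "integrable lborel (\<lambda>x::'a. h (radial_volume x)) \<longleftrightarrow> integrable lborel (\<lambda>s. indicator {0<..} s * h s)"
    unfolding integrable_iff_bounded using e h by (simp add: abs_mult)
qed

text \<open>
  By the previous identity, the flux as a density in \<open>s\<close> and the image under the volume function of
  \<open>(radial_volume_grad x \<bullet> e) * \<phi> x\<close> as a density in \<open>x\<close> give the same mass to each interval \<open>(0, b)\<close>; hence any
  weight has the same integral against both.
\<close>

lemma weighted_layers_eq:
  fixes \<phi> :: "'a::euclidean_space \<Rightarrow> real" and w :: "real \<Rightarrow> real"
  assumes dim: "DIM('a) \<ge> 2" and \<phi>: "C1c U \<phi>" and R: "R > 0"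
    and [measurable]: "w \<in> borel_measurable borel" and w0: "\<And>s. w s \<ge> 0"
    and wq: "integrable lborel (\<lambda>s. indicator {0<..<R} s * (w s * s powr (1 - 1 / DIM('a))))"
  shows "(LBINT s. indicator {0<..<R} s * (w s * (LBINT x. indicator {x. radial_volume x < s} x * frechet_derivative \<phi> (at x) e)))
    = (LBINT x. indicator {x. radial_volume x < R} x * (w (radial_volume x) * ((radial_volume_grad x \<bullet> e) * \<phi> x)))"
    and "integrable lborel (\<lambda>x. indicator {x. radial_volume x < R} x * (w (radial_volume x) * ((radial_volume_grad x \<bullet> e) * \<phi> x)))"
proof -
  let ?D = "\<lambda>x. frechet_derivative \<phi> (at x) e" and ?T = "radial_volume :: 'a \<Rightarrow> real" and ?n = "DIM('a)"
  define H where "H x = (radial_volume_grad x \<bullet> e) * \<phi> x" for x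
  define K where "K s = (LBINT x. indicator {x. ?T x < s} x * ?D x)" for s
  define q where "q s = s powr (1 - 1 / ?n)" for s
  note [measurable] = C1c_borel(1)[OF \<phi>] C1c_borel(2)[OF \<phi>, of e]
  have [measurable]: "H \<in> borel_measurable borel" unfolding H_def[abs_def] by measurable
  have [measurable]: "q \<in> borel_measurable borel" unfolding q_def[abs_def] by measurable
  have [measurable]: "K \<in> borel_measurable borel"
  proof -
    have "K = (\<lambda>s. LBINT x. (if ?T x < s then 1 else 0) * ?D x)"
      unfolding K_def[abs_def] by (intro ext Bochner_Integration.integral_cong) (auto simp: indicator_def)
    also have "\<dots> \<in> borel_measurable borel" by measurable
    finally show ?thesis .
  qed
  obtain C Rb where "\<forall>x. \<bar>\<phi> x\<bar> \<le> C" "\<forall>x. \<bar>?D x\<bar> \<le> C"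
    "\<forall>x. Rb < norm x \<longrightarrow> \<phi> x = 0" "\<forall>x. Rb < norm x \<longrightarrow> ?D x = 0"
    by (rule C1c_bounds[OF \<phi>, where e=e])
  note C = this[rule_format]
  have C0: "C \<ge> 0" using C(1)[of 0] by linarith
  let ?A = "?n * measure lebesgue (ball (0::'a) 1) powr (1 / ?n)"
  define M where "M = max (C * R powr (1 / ?n)) (?A * norm e * C)"
  have q0: "q s \<ge> 0" for s by (simp add: q_def)
  have M0: "M \<ge> 0" using C0 by (simp add: M_def le_max_iff_disj)
  have KM: "\<bar>K s\<bar> \<le> M * q s" if s: "0 < s" "s < R" for s
  proof -
    have int0: "integrable lborel (\<lambda>s::real. 1 * s * indicator {0<..<R} s)"
      by (rule integrable_bounded_support[where B="\<bar>R\<bar>" and R="\<bar>R\<bar>"]) (auto simp: indicator_def)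
    have "\<bar>K s\<bar> \<le> C * max 0 s"
      unfolding K_def by (rule layer_fubini(4)[OF C1c_integrable(2)[OF \<phi>] C(2) _ _ int0]) auto
    also have "max 0 s = s powr (1 / ?n) * q s" using s by (simp add: q_def powr_add[symmetric])
    also have "C * (s powr (1 / ?n) * q s) \<le> C * (R powr (1 / ?n) * q s)"
      using s C0 q0 by (intro mult_left_mono mult_right_mono powr_mono2) auto
    also have "\<dots> \<le> M * q s" unfolding mult.assoc[symmetric] using q0 by (intro mult_right_mono) (auto simp: M_def)
    finally show ?thesis .
  qed
  have HM: "\<bar>H x\<bar> \<le> M * q (?T x)" for x
  proof -
    have "\<bar>radial_volume_grad x \<bullet> e\<bar> \<le> norm (radial_volume_grad x) * norm e" by (rule Cauchy_Schwarz_ineq2)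
    also have "\<dots> = ?A * q (?T x) * norm e" unfolding norm_radial_volume_grad[OF dim] q_def by simp
    finally have "\<bar>H x\<bar> \<le> (?A * q (?T x) * norm e) * C"
      unfolding H_def abs_mult using C(1)[of x] q0 by (intro mult_mono) auto
    also have "\<dots> = (?A * norm e * C) * q (?T x)" by simp
    also have "\<dots> \<le> M * q (?T x)" using q0 by (intro mult_right_mono) (auto simp: M_def)
    finally show ?thesis .
  qed
  (* Signed densities do not define measures.  Adding M q, respectively its pullback, makes both
     nonnegative; the power q bounds H by the formula for the gradient and is integrable against
     w near 0, which a constant need not be. *)
  define a where "a s = indicator {0<..<R} s * (K s + M * q s)" for s
  define h where "h x = indicator {x. ?T x < R} x * (H x + M * q (?T x))" for x
  have [measurable]: "a \<in> borel_measurable borel" unfolding a_def[abs_def] by measurable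
  have [measurable]: "h \<in> borel_measurable borel" unfolding h_def[abs_def] by measurable
  have a0: "a s \<ge> 0" for s using KM[of s] by (auto simp: a_def indicator_def abs_le_iff)
  have h0: "h x \<ge> 0" for x using HM[of x] by (auto simp: h_def indicator_def abs_le_iff)
  have iH: "integrable lborel H" unfolding H_def[abs_def] by (rule integral_truncated_cone(2)[OF dim \<phi>])
  have iHb: "integrable lborel (\<lambda>x. indicator {x. ?T x < b} x * H x)" for b
    by (rule Bochner_Integration.integrable_bound[OF iH]) (auto simp: indicator_def)
  have qR: "integrable lborel (\<lambda>s. indicator {0<..<b} s * q s)" if "b \<le> R" for b
  proof (rule integrable_bounded_support[where B="q R" and R=R])
    show "\<bar>indicator {0<..<b} s * q s\<bar> \<le> q R" for s
      using that q0[of R] dim by (auto simp: indicator_def q_def intro!: powr_mono2)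
  qed (use that in \<open>auto simp: indicator_def\<close>)
  have iK: "integrable lborel (\<lambda>s. indicator {0<..<b} s * K s)" if "b \<le> R" for b
  proof (rule Bochner_Integration.integrable_bound[where f="\<lambda>s. M * (indicator {0<..<b} s * q s)"])
    show "AE s in lborel. norm (indicator {0<..<b} s * K s) \<le> norm (M * (indicator {0<..<b} s * q s))"
    proof (rule AE_I2)
      fix s show "norm (indicator {0<..<b} s * K s) \<le> norm (M * (indicator {0<..<b} s * q s))"
        using KM[of s] that M0 q0[of s] by (auto simp: indicator_def)
    qed
  qed (use qR[OF that] in auto)
  have qT: "(LBINT x. indicator {x. ?T x < b} x * q (?T x)) = (LBINT s. indicator {0<..<b} s * q s)"
    and iqT: "integrable lborel (\<lambda>x. indicator {x. ?T x < b} x * q (?T x))" if "b \<le> R" for b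
  proof -
    have eq: "(\<lambda>s. indicator {0<..} s * (indicator {..<b} s * q s)) = (\<lambda>s. indicator {0<..<b} s * q s)"
      by (auto simp: indicator_def fun_eq_iff)
    have eq2: "(\<lambda>x. indicator {..<b} (?T x) * q (?T x)) = (\<lambda>x. indicator {x. ?T x < b} x * q (?T x))"
      by (auto simp: indicator_def fun_eq_iff)
    have b: "(\<lambda>s. indicator {..<b} s * q s) \<in> borel_measurable borel" by measurable
    have nn: "indicator {..<b} s * q s \<ge> 0" for s using q0[of s] by (auto simp: indicator_def)
    note r = radial_integral[where 'a='a, OF b nn, unfolded eq eq2, simplified]
    show "(LBINT x. indicator {x. ?T x < b} x * q (?T x)) = (LBINT s. indicator {0<..<b} s * q s)" using r(1) by simp
    show "integrable lborel (\<lambda>x. indicator {x. ?T x < b} x * q (?T x))" using r(2) qR[OF that] by simp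
  qed
  let ?M1 = "density lborel (\<lambda>s. ennreal (a s))" and ?M2 = "distr (density lborel (\<lambda>x. ennreal (h x))) borel ?T"
  have M12: "?M1 = ?M2"
  proof (rule measure_eqI_Iio)
    fix b :: real
    define b' where "b' = min b R"
    have b': "b' \<le> R" by (simp add: b'_def)
    have 1: "emeasure ?M1 {..<b} = ennreal ((LBINT s. indicator {0<..<b'} s * K s) + M * (LBINT s. indicator {0<..<b'} s * q s))"
    proof -
      have "emeasure ?M1 {..<b} = (\<integral>\<^sup>+s. ennreal (indicator {..<b} s * a s) \<partial>lborel)"
        by (subst emeasure_density) (auto intro!: nn_integral_cong simp: indicator_def)
      also have "(\<lambda>s. indicator {..<b} s * a s) = (\<lambda>s. indicator {0<..<b'} s * K s + M * (indicator {0<..<b'} s * q s))"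
        by (auto simp: fun_eq_iff a_def b'_def indicator_def)
      also have "(\<integral>\<^sup>+s. ennreal (indicator {0<..<b'} s * K s + M * (indicator {0<..<b'} s * q s)) \<partial>lborel)
        = ennreal (LBINT s. indicator {0<..<b'} s * K s + M * (indicator {0<..<b'} s * q s))"
      proof (rule nn_integral_eq_integral)
        show "AE s in lborel. 0 \<le> indicator {0<..<b'} s * K s + M * (indicator {0<..<b'} s * q s)"
        proof (rule AE_I2)
          fix s show "0 \<le> indicator {0<..<b'} s * K s + M * (indicator {0<..<b'} s * q s)"
            using KM[of s] b' by (auto simp: indicator_def abs_le_iff)
        qed
      qed (use iK[OF b'] qR[OF b'] in auto)
      finally show ?thesis using iK[OF b'] qR[OF b'] by simp
    qed
    have 2: "emeasure ?M2 {..<b} = ennreal ((LBINT x. indicator {x. ?T x < b'} x * H x) + M * (LBINT x. indicator {x. ?T x < b'} x * q (?T x)))"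
    proof -
      have "emeasure ?M2 {..<b} = emeasure (density lborel (\<lambda>x. ennreal (h x))) {x. ?T x < b}"
        by (subst emeasure_distr) (auto intro!: arg_cong2[of _ _ _ _ emeasure])
      also have "\<dots> = (\<integral>\<^sup>+x. ennreal (indicator {x. ?T x < b} x * h x) \<partial>lborel)"
        by (subst emeasure_density) (auto intro!: nn_integral_cong simp: indicator_def)
      also have "(\<lambda>x. indicator {x. ?T x < b} x * h x) = (\<lambda>x. indicator {x. ?T x < b'} x * H x + M * (indicator {x. ?T x < b'} x * q (?T x)))"
        by (auto simp: fun_eq_iff h_def b'_def indicator_def)
      also have "(\<integral>\<^sup>+x. ennreal (indicator {x. ?T x < b'} x * H x + M * (indicator {x. ?T x < b'} x * q (?T x))) \<partial>lborel)
        = ennreal (LBINT x. indicator {x. ?T x < b'} x * H x + M * (indicator {x. ?T x < b'} x * q (?T x)))"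
      proof (rule nn_integral_eq_integral)
        show "AE x in lborel. 0 \<le> indicator {x. ?T x < b'} x * H x + M * (indicator {x. ?T x < b'} x * q (?T x))"
        proof (rule AE_I2)
          fix x show "0 \<le> indicator {x. ?T x < b'} x * H x + M * (indicator {x. ?T x < b'} x * q (?T x))"
            using HM[of x] by (auto simp: indicator_def abs_le_iff)
        qed
      qed (use iHb[of b'] iqT[OF b'] in auto)
      finally show ?thesis using iHb[of b'] iqT[OF b'] by simp
    qed
    show "emeasure ?M1 {..<b} = emeasure ?M2 {..<b}"
      unfolding 1 2 qT[OF b'] using integral_layers_eq[OF dim \<phi>, of b' e] by (simp add: K_def H_def)
    show "emeasure ?M1 {..<b} < \<infinity>" unfolding 1 by simp
  qed simp_all
  have nneq: "(\<integral>\<^sup>+s. ennreal (w s * a s) \<partial>lborel) = (\<integral>\<^sup>+x. ennreal (w (?T x) * h x) \<partial>lborel)"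
  proof -
    have "(\<integral>\<^sup>+s. ennreal (w s * a s) \<partial>lborel) = (\<integral>\<^sup>+s. ennreal (w s) \<partial>?M1)"
      by (subst nn_integral_density) (auto simp: ennreal_mult a0 w0 mult.commute)
    also have "\<dots> = (\<integral>\<^sup>+x. ennreal (w (?T x)) \<partial>density lborel (\<lambda>x. ennreal (h x)))"
      unfolding M12 by (rule nn_integral_distr) measurable
    also have "\<dots> = (\<integral>\<^sup>+x. ennreal (w (?T x) * h x) \<partial>lborel)"
      by (subst nn_integral_density) (auto simp: ennreal_mult h0 w0 mult.commute)
    finally show ?thesis .
  qed
  have iwK: "integrable lborel (\<lambda>s. indicator {0<..<R} s * (w s * K s))"
  proof (rule Bochner_Integration.integrable_bound[where f="\<lambda>s. M * (indicator {0<..<R} s * (w s * q s))"])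
    show "integrable lborel (\<lambda>s. M * (indicator {0<..<R} s * (w s * q s)))" using wq by (simp add: q_def)
    show "AE s in lborel. norm (indicator {0<..<R} s * (w s * K s)) \<le> norm (M * (indicator {0<..<R} s * (w s * q s)))"
    proof (rule AE_I2)
      fix s show "norm (indicator {0<..<R} s * (w s * K s)) \<le> norm (M * (indicator {0<..<R} s * (w s * q s)))"
      proof (cases "s \<in> {0<..<R}")
        case True
        then have "w s * \<bar>K s\<bar> \<le> w s * (M * q s)" using KM[of s] w0[of s] by (intro mult_left_mono) auto
        then show ?thesis using True M0 q0[of s] w0[of s] by (simp add: abs_mult mult_ac)
      qed simp
    qed
  qed measurable
  have wa: "(\<lambda>s. w s * a s) = (\<lambda>s. indicator {0<..<R} s * (w s * K s) + M * (indicator {0<..<R} s * (w s * q s)))"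
    by (auto simp: fun_eq_iff a_def algebra_simps)
  have wqi: "integrable lborel (\<lambda>s. indicator {0<..<R} s * (w s * q s))" using wq by (simp add: q_def)
  have iwa: "integrable lborel (\<lambda>s. w s * a s)" unfolding wa using iwK wqi by auto
  have iwh: "integrable lborel (\<lambda>x. w (?T x) * h x)"
  proof (rule integrableI_nonneg)
    have "(\<integral>\<^sup>+s. ennreal (w s * a s) \<partial>lborel) = ennreal (LBINT s. w s * a s)"
      using iwa w0 a0 by (intro nn_integral_eq_integral) auto
    then show "(\<integral>\<^sup>+x. ennreal (w (?T x) * h x) \<partial>lborel) < \<infinity>" using nneq by simp
  qed (use w0 h0 in auto)
  have eqwah: "(LBINT s. w s * a s) = (LBINT x. w (?T x) * h x)"
    using nneq w0 a0 h0 by (subst (1 2) integral_eq_enn2real_nn_integral) auto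
  have qwT: "(LBINT x. indicator {x. ?T x < R} x * (w (?T x) * q (?T x))) = (LBINT s. indicator {0<..<R} s * (w s * q s))"
    and iqwT: "integrable lborel (\<lambda>x. indicator {x. ?T x < R} x * (w (?T x) * q (?T x)))"
  proof -
    have eq: "(\<lambda>s. indicator {0<..} s * (indicator {..<R} s * (w s * q s))) = (\<lambda>s. indicator {0<..<R} s * (w s * q s))"
      by (auto simp: indicator_def fun_eq_iff)
    have eq2: "(\<lambda>x. indicator {..<R} (?T x) * (w (?T x) * q (?T x))) = (\<lambda>x. indicator {x. ?T x < R} x * (w (?T x) * q (?T x)))"
      by (auto simp: indicator_def fun_eq_iff)
    have b: "(\<lambda>s. indicator {..<R} s * (w s * q s)) \<in> borel_measurable borel" by measurable
    have nn: "indicator {..<R} s * (w s * q s) \<ge> 0" for s using q0[of s] w0[of s] by (auto simp: indicator_def)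
    note r = radial_integral[where 'a='a, OF b nn, unfolded eq eq2, simplified]
    show "(LBINT x. indicator {x. ?T x < R} x * (w (?T x) * q (?T x))) = (LBINT s. indicator {0<..<R} s * (w s * q s))" using r(1) by simp
    show "integrable lborel (\<lambda>x. indicator {x. ?T x < R} x * (w (?T x) * q (?T x)))" using r(2) wqi by simp
  qed
  have wh: "(\<lambda>x. indicator {x. ?T x < R} x * (w (?T x) * H x)) = (\<lambda>x. w (?T x) * h x - M * (indicator {x. ?T x < R} x * (w (?T x) * q (?T x))))"
    by (auto simp: fun_eq_iff h_def algebra_simps)
  have iwH: "integrable lborel (\<lambda>x. indicator {x. ?T x < R} x * (w (?T x) * H x))"
    unfolding wh using iwh iqwT by auto
  then show "integrable lborel (\<lambda>x. indicator {x. radial_volume x < R} x * (w (radial_volume x) * ((radial_volume_grad x \<bullet> e) * \<phi> x)))"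
    by (simp add: H_def)
  have "(LBINT x. indicator {x. ?T x < R} x * (w (?T x) * H x)) = (LBINT x. w (?T x) * h x) - M * (LBINT x. indicator {x. ?T x < R} x * (w (?T x) * q (?T x)))"
    unfolding wh using iwh iqwT by simp
  also have "\<dots> = (LBINT s. indicator {0<..<R} s * (w s * K s))"
    unfolding eqwah[symmetric] qwT wa using iwK wqi by simp
  finally show "(LBINT s. indicator {0<..<R} s * (w s * (LBINT x. indicator {x. radial_volume x < s} x * frechet_derivative \<phi> (at x) e)))
    = (LBINT x. indicator {x. radial_volume x < R} x * (w (radial_volume x) * ((radial_volume_grad x \<bullet> e) * \<phi> x)))"
    by (simp add: H_def K_def)
qed

section \<open>Borel representatives and uniqueness of weak gradients\<close>

lemma lebesgue_on_borel:
  fixes f f' :: "'a::euclidean_space \<Rightarrow> 'b::{banach, second_countable_topology}"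
  assumes S: "S \<in> sets borel" and f: "f \<in> borel_measurable borel" and eq: "\<And>x. x \<in> S \<Longrightarrow> f' x = f x"
  shows "f' \<in> borel_measurable (lebesgue_on S)"
    and "integrable (lebesgue_on S) f' \<longleftrightarrow> integrable lborel (\<lambda>x. indicator S x *\<^sub>R f x)"
    and "integral\<^sup>L (lebesgue_on S) f' = (LBINT x. indicator S x *\<^sub>R f x)"
proof -
  have sp: "space (lebesgue_on S) = S" by simp
  have m: "f \<in> borel_measurable (lebesgue_on S)"
    by (rule measurable_restrict_space1) (use f in \<open>auto intro: measurable_completion\<close>)
  then show m': "f' \<in> borel_measurable (lebesgue_on S)"
    using measurable_cong[of "lebesgue_on S" f' f borel] eq by simp
  have S': "S \<inter> space lebesgue \<in> sets lebesgue" using S by simp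
  have mi: "(\<lambda>x. indicator S x *\<^sub>R f x) \<in> borel_measurable lborel" using S f by simp
  have "integrable (lebesgue_on S) f' \<longleftrightarrow> integrable (lebesgue_on S) f"
    by (rule Bochner_Integration.integrable_cong) (use eq in auto)
  also have "\<dots> \<longleftrightarrow> integrable lebesgue (\<lambda>x. indicator S x *\<^sub>R f x)"
    by (rule integrable_restrict_space[OF S'])
  finally show "integrable (lebesgue_on S) f' \<longleftrightarrow> integrable lborel (\<lambda>x. indicator S x *\<^sub>R f x)"
    using integrable_completion[OF mi] by simp
  have "integral\<^sup>L (lebesgue_on S) f' = integral\<^sup>L (lebesgue_on S) f"
    by (rule Bochner_Integration.integral_cong) (use eq in auto)
  also have "\<dots> = integral\<^sup>L lebesgue (\<lambda>x. indicator S x *\<^sub>R f x)"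
    by (rule integral_restrict_space[OF S'])
  finally show "integral\<^sup>L (lebesgue_on S) f' = (LBINT x. indicator S x *\<^sub>R f x)"
    using integral_completion[OF mi] by simp
qed

lemma nn_integral_lebesgue_on_borel:
  fixes f :: "'a::euclidean_space \<Rightarrow> ennreal"
  assumes S: "S \<in> sets borel" and f: "f \<in> borel_measurable borel"
  shows "(\<integral>\<^sup>+x. f x \<partial>lebesgue_on S) = (\<integral>\<^sup>+x. f x * indicator S x \<partial>lborel)"
proof -
  have "(\<integral>\<^sup>+x. f x \<partial>lebesgue_on S) = (\<integral>\<^sup>+x. f x * indicator S x \<partial>lebesgue)"
    by (rule nn_integral_restrict_space) (use S in simp)
  then show ?thesis by (simp add: nn_integral_completion)
qed

lemma AE_lebesgue_on_iff:
  assumes "S \<in> sets borel"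
  shows "(AE x in lebesgue_on S. P x) \<longleftrightarrow> (AE x in lborel. x \<in> S \<longrightarrow> P x)"
proof -
  have "(AE x in lebesgue_on S. P x) \<longleftrightarrow> (AE x in lebesgue. x \<in> S \<longrightarrow> P x)"
    by (rule AE_restrict_space_iff) (use assms in simp)
  then show ?thesis by (simp add: AE_completion_iff)
qed

lemma lebesgue_on_representative:
  fixes f :: "'a::euclidean_space \<Rightarrow> 'b::euclidean_space"
  assumes S: "S \<in> sets borel" and f: "f \<in> borel_measurable (lebesgue_on S)"
  obtains f0 where "f0 \<in> borel_measurable borel" "\<forall>x. x \<notin> S \<longrightarrow> f0 x = 0" "AE x in lborel. x \<in> S \<longrightarrow> f x = f0 x"
proof -
  have "(\<lambda>x. if x \<in> S then f x else 0) \<in> borel_measurable lebesgue"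
    using f S by (simp add: borel_measurable_if)
  then have m: "(\<lambda>x. (if x \<in> S then f x else 0) \<bullet> i) \<in> borel_measurable lebesgue" for i by measurable
  have "\<forall>i. \<exists>h\<in>borel_measurable lborel. AE x in lborel. (if x \<in> S then f x else 0) \<bullet> i = h x"
    using completion_ex_borel_measurable_real[OF m] by blast
  then obtain h where h: "\<And>i. h i \<in> borel_measurable lborel" "\<And>i. AE x in lborel. (if x \<in> S then f x else 0) \<bullet> i = h i x"
    by metis
  define f0 where "f0 x = indicator S x *\<^sub>R (\<Sum>i\<in>Basis. h i x *\<^sub>R i)" for x
  show ?thesis
  proof
    have [measurable]: "h i \<in> borel_measurable borel" for i using h(1)[of i] by simp
    show "f0 \<in> borel_measurable borel" unfolding f0_def[abs_def] using S by measurable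
    show "\<forall>x. x \<notin> S \<longrightarrow> f0 x = 0" by (simp add: f0_def)
    have "AE x in lborel. \<forall>i\<in>Basis. (if x \<in> S then f x else 0) \<bullet> i = h i x"
      by (intro AE_finite_allI h(2)) simp
    then show "AE x in lborel. x \<in> S \<longrightarrow> f x = f0 x"
    proof (eventually_elim, intro impI)
      fix x assume a: "\<forall>i\<in>Basis. (if x \<in> S then f x else 0) \<bullet> i = h i x" and x: "x \<in> S"
      have "f0 x = (\<Sum>i\<in>Basis. (f x \<bullet> i) *\<^sub>R i)" using a x by (simp add: f0_def)
      then show "f x = f0 x" by (simp add: euclidean_representation)
    qed
  qed
qed

lemma integrable_of_square:
  fixes f :: "'a \<Rightarrow> 'b::{banach, second_countable_topology}"
  assumes "finite_measure M" "f \<in> borel_measurable M" "integrable M (\<lambda>x. (norm (f x))\<^sup>2)"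
  shows "integrable M f"
proof -
  interpret finite_measure M by fact
  have "integrable M (\<lambda>x. 1 + (norm (f x))\<^sup>2)" using assms(3) by simp
  then show ?thesis
  proof (rule Bochner_Integration.integrable_bound)
    show "AE x in M. norm (f x) \<le> norm (1 + (norm (f x))\<^sup>2)"
    proof (rule AE_I2)
      fix x
      have "0 \<le> (norm (f x) - 1)\<^sup>2" by simp
      then have "2 * norm (f x) \<le> 1 + (norm (f x))\<^sup>2" by (simp add: power2_diff)
      moreover have "0 \<le> norm (f x)" by simp
      ultimately have "norm (f x) \<le> 1 + (norm (f x))\<^sup>2" by linarith
      then show "norm (f x) \<le> norm (1 + (norm (f x))\<^sup>2)" by simp
    qed
  qed fact
qed

lemma square_integrable_imp_locally_integrable:
  assumes "\<And>K. compact K \<Longrightarrow> K \<subseteq> U \<Longrightarrow> square_integrable_on f K"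
  shows "locally_integrable_on f U"
  unfolding locally_integrable_on_def
proof (intro allI impI)
  fix K assume K: "compact K \<and> K \<subseteq> U"
  then have A: "square_integrable_on f K" using assms by blast
  have B: "finite_measure (lebesgue_on K)"
    using K by (intro finite_measure_lebesgue_on lmeasurable_compact) simp
  show "integrable (lebesgue_on K) f"
    by (rule integrable_of_square[OF B A[unfolded square_integrable_on_def, THEN conjunct1] A[unfolded square_integrable_on_def, THEN conjunct2]])
qed

text \<open>
  On a closed ball inside \<open>U\<close> the difference of the two gradients is integrable, so the fundamental lemma applies to
  it; countably many such balls cover \<open>U\<close>.
\<close>

lemma weak_gradient_unique:
  fixes u :: "'a::euclidean_space \<Rightarrow> real"
  assumes U: "open U" and g: "is_weak_gradient U u g" and g': "is_weak_gradient U u g'"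
  shows "AE x in lborel. x \<in> U \<longrightarrow> g x = g' x"
proof -
  have Ub: "U \<in> sets borel" using U by simp
  have one: "AE x in lborel. x \<in> ball a r \<longrightarrow> g x = g' x" if K: "cball a r \<subseteq> U" for a r
  proof -
    let ?K = "cball a r"
    have Kb: "?K \<in> sets borel" by simp
    have ig: "integrable (lebesgue_on ?K) g" "integrable (lebesgue_on ?K) g'"
      using g g' K unfolding is_weak_gradient_def locally_integrable_on_def by auto
    have "AE x in lborel. x \<in> ball a r \<longrightarrow> (g x - g' x) \<bullet> i = 0" if i: "i \<in> Basis" for i
    proof -
      let ?d = "\<lambda>x. (g x - g' x) \<bullet> i"
      have id: "integrable (lebesgue_on ?K) ?d" using ig by (intro integrable_inner_left Bochner_Integration.integrable_diff)
      obtain f where f: "f \<in> borel_measurable borel" "\<forall>x. x \<notin> ?K \<longrightarrow> f x = 0" "AE x in lborel. x \<in> ?K \<longrightarrow> ?d x = f x"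
        by (rule lebesgue_on_representative[OF Kb borel_measurable_integrable[OF id]])
      have fae: "AE x in lebesgue_on ?K. ?d x = f x" using f(3) by (simp only: AE_lebesgue_on_iff[OF Kb])
      have fK: "f \<in> borel_measurable (lebesgue_on ?K)" by (rule lebesgue_on_borel(1)[OF Kb f(1)]) simp
      have ind: "(\<lambda>x. indicator ?K x *\<^sub>R f x) = f" using f(2) by (auto simp: indicator_def fun_eq_iff)
      have "integrable (lebesgue_on ?K) f"
        using integrable_cong_AE[OF borel_measurable_integrable[OF id] fK fae] id by blast
      then have fi: "integrable lborel f" using lebesgue_on_borel(2)[OF Kb f(1), of f] unfolding ind by simp
      have "AE x in lborel. x \<in> ball a r \<longrightarrow> f x = 0"
      proof (rule fundamental_lemma_ball[OF fi])
        fix \<phi> :: "'a \<Rightarrow> real" assume \<phi>: "C1c (ball a r) \<phi>"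
        then have sub: "closure {x. \<phi> x \<noteq> 0} \<subseteq> ball a r" by (simp add: C1c_def)
        then have out: "\<phi> x = 0" if "x \<notin> ?K" for x
          using that closure_subset[of "{x. \<phi> x \<noteq> 0}"] by (metis (mono_tags, lifting) ball_subset_cball mem_Collect_eq subsetD)
        have \<phi>U: "C1c U \<phi>" using \<phi> K ball_subset_cball[of a r] unfolding C1c_def by blast
        obtain C R where "\<forall>x. \<bar>\<phi> x\<bar> \<le> C" "\<forall>x. \<bar>frechet_derivative \<phi> (at x) i\<bar> \<le> C"
          "\<forall>x. R < norm x \<longrightarrow> \<phi> x = 0" "\<forall>x. R < norm x \<longrightarrow> frechet_derivative \<phi> (at x) i = 0"
          by (rule C1c_bounds[OF \<phi>, where e=i])
        note C = this[rule_format]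
        have \<phi>K: "\<phi> \<in> borel_measurable (lebesgue_on ?K)" by (rule lebesgue_on_borel(1)[OF Kb C1c_borel(1)[OF \<phi>]]) simp
        have red: "integral\<^sup>L (lebesgue_on U) (\<lambda>x. (G x \<bullet> i) * \<phi> x) = integral\<^sup>L (lebesgue_on ?K) (\<lambda>x. (G x \<bullet> i) * \<phi> x)" for G :: "'a \<Rightarrow> 'a"
        proof -
          have "integral\<^sup>L (lebesgue_on U) (\<lambda>x. (G x \<bullet> i) * \<phi> x) = (\<integral>x. indicator U x *\<^sub>R ((G x \<bullet> i) * \<phi> x) \<partial>lebesgue)"
            by (rule integral_restrict_space) (use Ub in simp)
          also have "\<dots> = (\<integral>x. indicator ?K x *\<^sub>R ((G x \<bullet> i) * \<phi> x) \<partial>lebesgue)"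
          proof (rule Bochner_Integration.integral_cong[OF refl])
            fix x show "indicator U x *\<^sub>R ((G x \<bullet> i) * \<phi> x) = indicator ?K x *\<^sub>R ((G x \<bullet> i) * \<phi> x)"
              using out[of x] K by (cases "x \<in> ?K") (auto simp: indicator_def)
          qed
          also have "\<dots> = integral\<^sup>L (lebesgue_on ?K) (\<lambda>x. (G x \<bullet> i) * \<phi> x)"
            by (rule integral_restrict_space[symmetric]) simp
          finally show ?thesis .
        qed
        have eq: "integral\<^sup>L (lebesgue_on U) (\<lambda>x. (g x \<bullet> i) * \<phi> x) = integral\<^sup>L (lebesgue_on U) (\<lambda>x. (g' x \<bullet> i) * \<phi> x)"
        proof -
          have "integral\<^sup>L (lebesgue_on U) (\<lambda>x. u x * frechet_derivative \<phi> (at x) i) = - integral\<^sup>L (lebesgue_on U) (\<lambda>x. (g x \<bullet> i) * \<phi> x)"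
            using g \<phi>U i unfolding is_weak_gradient_def by blast
          moreover have "integral\<^sup>L (lebesgue_on U) (\<lambda>x. u x * frechet_derivative \<phi> (at x) i) = - integral\<^sup>L (lebesgue_on U) (\<lambda>x. (g' x \<bullet> i) * \<phi> x)"
            using g' \<phi>U i unfolding is_weak_gradient_def by blast
          ultimately show ?thesis by linarith
        qed
        have ii: "integrable (lebesgue_on ?K) (\<lambda>x. (g x \<bullet> i) * \<phi> x)" "integrable (lebesgue_on ?K) (\<lambda>x. (g' x \<bullet> i) * \<phi> x)"
          by (rule integrable_mult_bounded[OF integrable_inner_left[OF ig(1)] \<phi>K C(1)])
             (rule integrable_mult_bounded[OF integrable_inner_left[OF ig(2)] \<phi>K C(1)])
        have "(LBINT x. f x * \<phi> x) = (LBINT x. indicator ?K x *\<^sub>R (f x * \<phi> x))"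
          using f(2) by (intro Bochner_Integration.integral_cong) (auto simp: indicator_def)
        also have "\<dots> = integral\<^sup>L (lebesgue_on ?K) (\<lambda>x. f x * \<phi> x)"
          by (rule lebesgue_on_borel(3)[symmetric, OF Kb]) (use f(1) C1c_borel(1)[OF \<phi>] in auto)
        also have "\<dots> = integral\<^sup>L (lebesgue_on ?K) (\<lambda>x. (g x \<bullet> i) * \<phi> x - (g' x \<bullet> i) * \<phi> x)"
        proof (rule integral_cong_AE)
          show "AE x in lebesgue_on ?K. f x * \<phi> x = (g x \<bullet> i) * \<phi> x - (g' x \<bullet> i) * \<phi> x"
            using fae
          proof eventually_elim
            fix x assume "?d x = f x"
            then have "f x = (g x \<bullet> i) - (g' x \<bullet> i)" unfolding inner_diff_left by (rule sym)
            then show "f x * \<phi> x = (g x \<bullet> i) * \<phi> x - (g' x \<bullet> i) * \<phi> x" by (simp only: left_diff_distrib)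
          qed
          show "(\<lambda>x. f x * \<phi> x) \<in> borel_measurable (lebesgue_on ?K)" using fK \<phi>K by (rule borel_measurable_times)
          show "(\<lambda>x. (g x \<bullet> i) * \<phi> x - (g' x \<bullet> i) * \<phi> x) \<in> borel_measurable (lebesgue_on ?K)"
            by (rule borel_measurable_integrable[OF Bochner_Integration.integrable_diff[OF ii]])
        qed
        also have "\<dots> = 0" using Bochner_Integration.integral_diff[OF ii] eq by (simp add: red)
        finally show "(LBINT x. f x * \<phi> x) = 0" .
      qed
      then show ?thesis using f(3)
      proof (eventually_elim, intro impI)
        fix x assume a: "x \<in> ball a r \<longrightarrow> f x = 0" "x \<in> ?K \<longrightarrow> ?d x = f x" and x: "x \<in> ball a r"
        then have "x \<in> ?K" using ball_subset_cball by blast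
        then show "?d x = 0" using a x by metis
      qed
    qed
    then have "AE x in lborel. \<forall>i\<in>Basis. x \<in> ball a r \<longrightarrow> (g x - g' x) \<bullet> i = 0"
      by (intro AE_finite_allI) auto
    then show ?thesis
    proof (eventually_elim, intro impI)
      fix x assume "\<forall>i\<in>Basis. x \<in> ball a r \<longrightarrow> (g x - g' x) \<bullet> i = 0" "x \<in> ball a r"
      then have "g x - g' x = 0" by (subst euclidean_all_zero_iff[symmetric]) blast
      then show "g x = g' x" by simp
    qed
  qed
  define F where "F = {ball a r | a r. cball a r \<subseteq> U}"
  obtain F' where F': "F' \<subseteq> F" "countable F'" "\<Union>F' = \<Union>F"
    by (rule Lindelof[of F]) (auto simp: F_def)
  have cover: "U \<subseteq> \<Union>F'"
  proof
    fix x assume "x \<in> U"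
    then obtain r where r: "r > 0" "cball x r \<subseteq> U" using open_contains_cball_eq[OF U] by blast
    then have "ball x r \<in> F" "x \<in> ball x r" by (auto simp: F_def)
    then show "x \<in> \<Union>F'" unfolding F'(3) by blast
  qed
  have "AE x in lborel. \<forall>S\<in>F'. x \<in> S \<longrightarrow> g x = g' x"
  proof (subst AE_ball_countable[OF F'(2)], intro ballI)
    fix S assume "S \<in> F'"
    then obtain a r where "S = ball a r" "cball a r \<subseteq> U" using F'(1) by (auto simp: F_def)
    then show "AE x in lborel. x \<in> S \<longrightarrow> g x = g' x" using one by simp
  qed
  then show ?thesis
  proof (eventually_elim, intro impI)
    fix x assume a: "\<forall>S\<in>F'. x \<in> S \<longrightarrow> g x = g' x" and "x \<in> U"
    then obtain S where "S \<in> F'" "x \<in> S" using cover by (meson UnionE subsetD)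
    then show "g x = g' x" using a by (meson bspec)
  qed
qed

section \<open>Weak gradients of radial functions\<close>

text \<open>
  A decreasing profile \<open>r\<close> with derivative \<open>- w\<close> in integrated form, and the radial function \<open>v\<close> that it defines on
  the ball of measure \<open>L\<close>.  The assumptions on \<open>r\<close> concern the open interval from 0 to \<open>L\<close> only, since the
  rearrangement is unspecified at its ends; consequently \<open>v\<close> may take any value at the origin.
\<close>

locale radial_profile =
  fixes r w :: "real \<Rightarrow> real" and L :: real and v :: "'a::euclidean_space \<Rightarrow> real"
  assumes v_eq: "\<And>x. v x = r (radial_volume x)"
    and dim: "DIM('a) \<ge> 2" and L: "L > 0"
    and w_borel [measurable]: "w \<in> borel_measurable borel" and w0: "\<And>s. w s \<ge> 0"
    and r_diff: "\<And>s1 s2. 0 < s1 \<Longrightarrow> s1 \<le> s2 \<Longrightarrow> s2 < L \<Longrightarrow>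
      r s2 \<le> r s1 \<and> ennreal (r s1 - r s2) = (\<integral>\<^sup>+s. ennreal (w s) * indicator {s1<..s2} s \<partial>lborel)"
    and r_borel [measurable]: "(\<lambda>s. indicator {0<..<L} s * r s) \<in> borel_measurable borel"
    and r_sq: "(\<integral>\<^sup>+s. ennreal ((r s)\<^sup>2) * indicator {0<..<L} s \<partial>lborel) < \<infinity>"
    and w_sq: "\<And>R. R < L \<Longrightarrow> (\<integral>\<^sup>+s. ennreal ((w s * s powr (1 - 1 / DIM('a)))\<^sup>2) * indicator {0<..<R} s \<partial>lborel) < \<infinity>"
begin

definition radial_grad :: "'a \<Rightarrow> 'a" where "radial_grad x = - (w (radial_volume x)) *\<^sub>R radial_volume_grad x"

text \<open>
  A globally Borel function that agrees with \<open>v\<close> on the whole ball, the origin included.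
\<close>

definition v_borel :: "'a \<Rightarrow> real" where
  "v_borel x = (if x = 0 then v 0 else indicator {0<..<L} (radial_volume x) * r (radial_volume x))"

lemma borel_G [measurable]: "radial_grad \<in> borel_measurable borel" unfolding radial_grad_def[abs_def] by measurable

lemma borel_v_borel [measurable]: "v_borel \<in> borel_measurable borel"
proof -
  have "(\<lambda>x::'a. indicator {0<..<L} (radial_volume x) * r (radial_volume x)) \<in> borel_measurable borel"
    using measurable_compose[OF borel_radial_volume r_borel] .
  then show ?thesis unfolding v_borel_def[abs_def] by measurable
qed

lemma ball_eq: "centred_ball L = {x::'a. radial_volume x < L}"
  using centred_ball_eq[of L] L by simp

lemma v_eq_v_borel: "x \<in> centred_ball L \<Longrightarrow> v x = v_borel x"
  using radial_volume_pos[of x] by (auto simp: ball_eq v_borel_def v_eq)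

lemma open_ball_L: "open (centred_ball L :: 'a set)" by (simp add: centred_ball_def)

lemma compact_in_smaller_ball:
  assumes "compact K" "K \<subseteq> (centred_ball L :: 'a set)"
  obtains R where "0 < R" "R < L" "\<forall>x\<in>K. radial_volume x < R"
proof (cases "K = {}")
  case True
  then show ?thesis using that[of "L / 2"] L by simp
next
  case False
  have "continuous_on UNIV (radial_volume :: 'a \<Rightarrow> real)"
    unfolding radial_volume_def[abs_def] by (intro continuous_intros)
  then have "continuous_on K (radial_volume :: 'a \<Rightarrow> real)" by (rule continuous_on_subset) simp
  from continuous_attains_sup[OF assms(1) False this] obtain x0 where x0: "x0 \<in> K" "\<forall>y\<in>K. radial_volume y \<le> radial_volume x0" by blast
  have "radial_volume x0 < L" using x0(1) assms(2) by (auto simp: ball_eq)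
  moreover have "0 \<le> radial_volume x0" by (rule radial_volume_nonneg)
  ultimately show ?thesis
    using x0(2) by (intro that[of "(radial_volume x0 + L) / 2"]) (auto simp: field_simps intro: order.strict_trans1)
qed

lemma norm_G_square: "(norm (radial_grad x))\<^sup>2 =
  (DIM('a) * measure lebesgue (ball (0::'a) 1) powr (1 / DIM('a)))\<^sup>2 * (w (radial_volume x) * radial_volume x powr (1 - 1 / DIM('a)))\<^sup>2"
proof -
  have "norm (radial_grad x) = w (radial_volume x) * norm (radial_volume_grad x)" using w0 by (simp add: radial_grad_def)
  then show ?thesis unfolding norm_radial_volume_grad[OF dim] by (simp add: power_mult_distrib)
qed

lemma gradient_energy:
  "(\<integral>\<^sup>+x. ennreal ((norm (radial_grad x))\<^sup>2) * indicator {x. radial_volume x < b} x \<partial>lborel) =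
   ennreal ((DIM('a) * measure lebesgue (ball (0::'a) 1) powr (1 / DIM('a)))\<^sup>2) *
   (\<integral>\<^sup>+s. ennreal ((w s * s powr (1 - 1 / DIM('a)))\<^sup>2) * indicator {0<..<b} s \<partial>lborel)"
proof -
  let ?A = "(DIM('a) * measure lebesgue (ball (0::'a) 1) powr (1 / DIM('a)))\<^sup>2"
  let ?h = "\<lambda>s. ennreal ?A * (ennreal ((w s * s powr (1 - 1 / DIM('a)))\<^sup>2) * indicator {..<b} s)"
  have "(\<integral>\<^sup>+x. ennreal ((norm (radial_grad x))\<^sup>2) * indicator {x. radial_volume x < b} x \<partial>lborel) = (\<integral>\<^sup>+x. ?h (radial_volume (x::'a)) \<partial>lborel)"
  proof (rule nn_integral_cong)
    fix x :: 'a
    have "ennreal ((norm (radial_grad x))\<^sup>2) = ennreal ?A * ennreal ((w (radial_volume x) * radial_volume x powr (1 - 1 / DIM('a)))\<^sup>2)"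
      unfolding norm_G_square by (rule ennreal_mult) auto
    then show "ennreal ((norm (radial_grad x))\<^sup>2) * indicator {x. radial_volume x < b} x = ?h (radial_volume x)"
      by (simp add: indicator_def)
  qed
  also have "\<dots> = (\<integral>\<^sup>+s. ?h s * indicator {0<..} s \<partial>lborel)" by (rule nn_integral_radial) measurable
  also have "\<dots> = (\<integral>\<^sup>+s. ennreal ?A * (ennreal ((w s * s powr (1 - 1 / DIM('a)))\<^sup>2) * indicator {0<..<b} s) \<partial>lborel)"
    by (intro nn_integral_cong) (auto simp: indicator_def)
  also have "\<dots> = ennreal ?A * (\<integral>\<^sup>+s. ennreal ((w s * s powr (1 - 1 / DIM('a)))\<^sup>2) * indicator {0<..<b} s \<partial>lborel)"
    by (rule nn_integral_cmult) measurable
  finally show ?thesis .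
qed

lemma square_integrable_v:
  assumes K: "compact K" "K \<subseteq> centred_ball L"
  shows "square_integrable_on v K"
proof -
  have Kb: "K \<in> sets borel" using K(1) by (simp add: compact_imp_closed)
  have vv: "v x = v_borel x" if "x \<in> K" for x using v_eq_v_borel that K(2) by blast
  have "integrable lborel (\<lambda>x. indicator K x *\<^sub>R (norm (v_borel x))\<^sup>2)"
  proof (rule integrableI_nonneg)
    have "(\<integral>\<^sup>+x. ennreal (indicator K x *\<^sub>R (norm (v_borel x))\<^sup>2) \<partial>lborel)
        \<le> (\<integral>\<^sup>+x. ennreal ((indicator {0<..<L} (radial_volume (x::'a)) * r (radial_volume x))\<^sup>2) \<partial>lborel)"
    proof (rule nn_integral_mono_AE)
      show "AE x in lborel. ennreal (indicator K x *\<^sub>R (norm (v_borel x))\<^sup>2) \<le> ennreal ((indicator {0<..<L} (radial_volume (x::'a)) * r (radial_volume x))\<^sup>2)"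
        using AE_lborel_singleton[of "0::'a"]
      proof eventually_elim
        fix x :: 'a assume "x \<noteq> 0"
        then show "ennreal (indicator K x *\<^sub>R (norm (v_borel x))\<^sup>2) \<le> ennreal ((indicator {0<..<L} (radial_volume x) * r (radial_volume x))\<^sup>2)"
          by (intro ennreal_leI) (simp add: v_borel_def indicator_def)
      qed
    qed
    also have "\<dots> = (\<integral>\<^sup>+s. ennreal ((indicator {0<..<L} s * r s)\<^sup>2) * indicator {0<..} s \<partial>lborel)"
      by (rule nn_integral_radial) measurable
    also have "\<dots> = (\<integral>\<^sup>+s. ennreal ((r s)\<^sup>2) * indicator {0<..<L} s \<partial>lborel)"
      by (intro nn_integral_cong) (auto simp: indicator_def)
    finally show "(\<integral>\<^sup>+x. ennreal (indicator K x *\<^sub>R (norm (v_borel x))\<^sup>2) \<partial>lborel) < \<infinity>" using r_sq by simp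
  qed (use Kb in auto)
  moreover have "(\<lambda>x. (norm (v_borel x))\<^sup>2) \<in> borel_measurable borel" by measurable
  ultimately have "integrable (lebesgue_on K) (\<lambda>x. (norm (v x))\<^sup>2)"
    using lebesgue_on_borel(2)[OF Kb, of "\<lambda>x. (norm (v_borel x))\<^sup>2" "\<lambda>x. (norm (v x))\<^sup>2"] vv by simp
  moreover have "v \<in> borel_measurable (lebesgue_on K)" by (rule lebesgue_on_borel(1)[OF Kb borel_v_borel vv])
  ultimately show ?thesis by (simp add: square_integrable_on_def)
qed

lemma square_integrable_G:
  assumes K: "compact K" "K \<subseteq> centred_ball L"
  shows "square_integrable_on radial_grad K"
proof -
  have Kb: "K \<in> sets borel" using K(1) by (simp add: compact_imp_closed)
  obtain R where R: "0 < R" "R < L" "\<forall>x\<in>K. radial_volume x < R" by (rule compact_in_smaller_ball[OF K])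
  have "integrable lborel (\<lambda>x. indicator K x *\<^sub>R (norm (radial_grad x))\<^sup>2)"
  proof (rule integrableI_nonneg)
    have "(\<integral>\<^sup>+x. ennreal (indicator K x *\<^sub>R (norm (radial_grad x))\<^sup>2) \<partial>lborel)
        \<le> (\<integral>\<^sup>+x. ennreal ((norm (radial_grad x))\<^sup>2) * indicator {x. radial_volume x < R} x \<partial>lborel)"
      using R(3) by (intro nn_integral_mono) (auto simp: indicator_def)
    also have "\<dots> < \<infinity>" unfolding gradient_energy using w_sq[OF R(2)] by (simp add: ennreal_mult_less_top)
    finally show "(\<integral>\<^sup>+x. ennreal (indicator K x *\<^sub>R (norm (radial_grad x))\<^sup>2) \<partial>lborel) < \<infinity>" .
  qed (use Kb in auto)
  moreover have "(\<lambda>x. (norm (radial_grad x))\<^sup>2) \<in> borel_measurable borel" by measurable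
  ultimately have "integrable (lebesgue_on K) (\<lambda>x. (norm (radial_grad x))\<^sup>2)"
    using lebesgue_on_borel(2)[OF Kb, of "\<lambda>x. (norm (radial_grad x))\<^sup>2" "\<lambda>x. (norm (radial_grad x))\<^sup>2"] by simp
  moreover have "radial_grad \<in> borel_measurable (lebesgue_on K)" by (rule lebesgue_on_borel(1)[OF Kb borel_G]) simp
  ultimately show ?thesis by (simp add: square_integrable_on_def)
qed

text \<open>
  On the support of \<open>\<phi>\<close> one has \<open>v x = r R + \<integral>_{T x}^R w\<close> for a suitable \<open>R < L\<close>.  The constant drops out, and Fubini's
  theorem turns the rest into the integral of \<open>w\<close> against the fluxes.
\<close>

lemma radial_integration_by_parts:
  assumes \<phi>: "C1c (centred_ball L) \<phi>"
  shows "(LBINT x. indicator (centred_ball L) x * (v_borel x * frechet_derivative \<phi> (at x) e))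
    = - (LBINT x. indicator (centred_ball L) x * ((radial_grad x \<bullet> e) * \<phi> x))"
proof -
  let ?D = "\<lambda>x. frechet_derivative \<phi> (at x) e" and ?T = "radial_volume :: 'a \<Rightarrow> real"
  define q where "q s = s powr (1 - 1 / DIM('a))" for s
  have q0: "q s \<ge> 0" for s by (simp add: q_def)
  have [measurable]: "q \<in> borel_measurable borel" unfolding q_def[abs_def] by measurable
  note [measurable] = C1c_borel(1)[OF \<phi>] C1c_borel(2)[OF \<phi>, of e]
  have "compact (closure {x. \<phi> x \<noteq> 0})" "closure {x. \<phi> x \<noteq> 0} \<subseteq> centred_ball L" using \<phi> by (auto simp: C1c_def)
  from compact_in_smaller_ball[OF this] obtain R where R: "0 < R" "R < L" "\<forall>x\<in>closure {x. \<phi> x \<noteq> 0}. ?T x < R" by blast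
  have out: "\<phi> x = 0" "?D x = 0" if "\<not> ?T x < R" for x
  proof -
    have x: "x \<notin> closure {x. \<phi> x \<noteq> 0}" using R(3) that by blast
    show "\<phi> x = 0" by (rule C1c_outside[OF \<phi> x])
    show "?D x = 0" using C1c_frechet_outside[OF \<phi> x] by simp
  qed
  obtain C Rb where "\<forall>x. \<bar>\<phi> x\<bar> \<le> C" "\<forall>x. \<bar>?D x\<bar> \<le> C"
    "\<forall>x. Rb < norm x \<longrightarrow> \<phi> x = 0" "\<forall>x. Rb < norm x \<longrightarrow> ?D x = 0"
    by (rule C1c_bounds[OF \<phi>, where e=e])
  note C = this[rule_format]
  have Z: "integrable lborel (\<lambda>s. indicator {0<..<R} s * (1 + (w s * q s)\<^sup>2))"
  proof -
    have "integrable lborel (\<lambda>s. (w s * q s)\<^sup>2 * indicator {0<..<R} s)"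
    proof (rule integrableI_nonneg)
      have "(\<integral>\<^sup>+s. ennreal ((w s * q s)\<^sup>2 * indicator {0<..<R} s) \<partial>lborel) = (\<integral>\<^sup>+s. ennreal ((w s * q s)\<^sup>2) * indicator {0<..<R} s \<partial>lborel)"
        by (intro nn_integral_cong) (auto simp: indicator_def)
      then show "(\<integral>\<^sup>+s. ennreal ((w s * q s)\<^sup>2 * indicator {0<..<R} s) \<partial>lborel) < \<infinity>" using w_sq[OF R(2)] by (simp add: q_def)
    qed auto
    moreover have "integrable lborel (\<lambda>s. indicat_real {0<..<R} s)" using R(1) by (simp add: integrable_indicator_iff)
    ultimately have "integrable lborel (\<lambda>s. indicat_real {0<..<R} s + (w s * q s)\<^sup>2 * indicator {0<..<R} s)" by (rule Bochner_Integration.integrable_add[rotated])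
    then show ?thesis by (simp add: algebra_simps)
  qed
  have am: "w s * q s \<le> 1 + (w s * q s)\<^sup>2" for s
  proof -
    have "0 \<le> (w s * q s - 1)\<^sup>2" by simp
    then have "2 * (w s * q s) \<le> 1 + (w s * q s)\<^sup>2" by (simp only: power2_diff) simp
    moreover have "0 \<le> w s * q s" using w0[of s] q0[of s] by simp
    ultimately show ?thesis by linarith
  qed
  have iwq: "integrable lborel (\<lambda>s. indicator {0<..<R} s * (w s * s powr (1 - 1 / DIM('a))))"
    unfolding q_def[symmetric]
  proof (rule Bochner_Integration.integrable_bound[OF Z])
    show "AE s in lborel. norm (indicator {0<..<R} s * (w s * q s)) \<le> norm (indicator {0<..<R} s * (1 + (w s * q s)\<^sup>2))"
    proof (rule AE_I2)
      fix s
      have "0 \<le> w s * q s" using w0[of s] q0[of s] by simp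
      then show "norm (indicator {0<..<R} s * (w s * q s)) \<le> norm (indicator {0<..<R} s * (1 + (w s * q s)\<^sup>2))"
        using am[of s] by (simp add: indicator_def)
    qed
  qed measurable
  have iws: "integrable lborel (\<lambda>s. w s * s * indicator {0<..<R} s)"
  proof (rule Bochner_Integration.integrable_bound[where f="\<lambda>s. R powr (1 / DIM('a)) * (indicator {0<..<R} s * (w s * q s))"])
    show "integrable lborel (\<lambda>s. R powr (1 / DIM('a)) * (indicator {0<..<R} s * (w s * q s)))" using iwq by (simp add: q_def)
    show "AE s in lborel. norm (w s * s * indicator {0<..<R} s) \<le> norm (R powr (1 / DIM('a)) * (indicator {0<..<R} s * (w s * q s)))"
    proof (rule AE_I2)
      fix s show "norm (w s * s * indicator {0<..<R} s) \<le> norm (R powr (1 / DIM('a)) * (indicator {0<..<R} s * (w s * q s)))"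
      proof (cases "s \<in> {0<..<R}")
        case True
        have "s = s powr (1 / DIM('a)) * q s" using True by (simp add: q_def powr_add[symmetric])
        also have "\<dots> \<le> R powr (1 / DIM('a)) * q s" using True q0 by (intro mult_right_mono powr_mono2) auto
        finally have "w s * s \<le> w s * (R powr (1 / DIM('a)) * q s)" using w0[of s] by (intro mult_left_mono) auto
        then show ?thesis using True w0[of s] q0[of s] by (simp add: mult_ac)
      qed simp
    qed
  qed measurable
  note fub = layer_fubini[OF C1c_integrable(2)[OF \<phi>, of e] C(2) w_borel w0 iws]
  have pt: "AE x in lborel. indicator (centred_ball L) x * (v_borel x * ?D x) = (LBINT s. w s * indicator {?T x<..<R} s) * ?D x + r R * ?D x"
    using AE_lborel_singleton[of "0::'a"]
  proof eventually_elim
    fix x :: 'a assume x0: "x \<noteq> 0"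
    show "indicator (centred_ball L) x * (v_borel x * ?D x) = (LBINT s. w s * indicator {?T x<..<R} s) * ?D x + r R * ?D x"
    proof (cases "?T x < R")
      case True
      have Tx: "0 < ?T x" using radial_volume_pos[OF x0] .
      have rd: "r R \<le> r (?T x)" "ennreal (r (?T x) - r R) = (\<integral>\<^sup>+s. ennreal (w s) * indicator {?T x<..R} s \<partial>lborel)"
        using r_diff[of "?T x" R] Tx True R(2) by auto
      have "(LBINT s. w s * indicator {?T x<..<R} s) = enn2real (\<integral>\<^sup>+s. ennreal (w s * indicator {?T x<..<R} s) \<partial>lborel)"
        by (rule integral_eq_enn2real_nn_integral) (use w0 in auto)
      also have "(\<integral>\<^sup>+s. ennreal (w s * indicator {?T x<..<R} s) \<partial>lborel) = (\<integral>\<^sup>+s. ennreal (w s) * indicator {?T x<..R} s \<partial>lborel)"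
      proof (rule nn_integral_cong_AE)
        show "AE s in lborel. ennreal (w s * indicator {?T x<..<R} s) = ennreal (w s) * indicator {?T x<..R} s"
          using AE_lborel_singleton[of R] by eventually_elim (auto simp: indicator_def)
      qed
      also have "\<dots> = ennreal (r (?T x) - r R)" using rd by simp
      finally have I: "(LBINT s. w s * indicator {?T x<..<R} s) = r (?T x) - r R" using rd(1) by simp
      have "x \<in> centred_ball L" using True R(2) by (simp add: ball_eq)
      moreover have "v_borel x = r (?T x)" using x0 Tx True R(2) by (simp add: v_borel_def)
      ultimately show ?thesis unfolding I by (simp add: algebra_simps)
    next
      case False
      then show ?thesis by (simp only: out(2)[OF False] mult_zero_right add_0)
    qed
  qed
  have D0: "(LBINT x. ?D x) = 0"
    by (rule integral_directional_derivative_zero[OF C1c_integrable(1)[OF \<phi>] line_derivative[OF C1c_has_derivative[OF \<phi>]] C(2) C(3)])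
  have "(LBINT x. indicator (centred_ball L) x * (v_borel x * ?D x)) = (LBINT x. (LBINT s. w s * indicator {?T x<..<R} s) * ?D x + r R * ?D x)"
  proof (rule integral_cong_AE[OF _ _ pt])
    show "(\<lambda>x. indicator (centred_ball L) x * (v_borel x * ?D x)) \<in> borel_measurable lborel" using open_ball_L by simp
    show "(\<lambda>x. (LBINT s. w s * indicator {?T x<..<R} s) * ?D x + r R * ?D x) \<in> borel_measurable lborel"
      using borel_measurable_integrable[OF fub(2)] by simp
  qed
  also have "\<dots> = (LBINT x. (LBINT s. w s * indicator {?T x<..<R} s) * ?D x) + r R * (LBINT x. ?D x)"
    using fub(2) C1c_integrable(2)[OF \<phi>, of e] by simp
  also have "\<dots> = (LBINT s. indicator {0<..<R} s * (w s * (LBINT x. indicator {x. ?T x < s} x * ?D x)))"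
    unfolding D0 fub(3) by simp
  also have "\<dots> = (LBINT x. indicator {x. ?T x < R} x * (w (?T x) * ((radial_volume_grad x \<bullet> e) * \<phi> x)))"
    by (rule weighted_layers_eq(1)[OF dim \<phi> R(1) w_borel w0 iwq])
  also have "\<dots> = (LBINT x. - (indicator (centred_ball L) x * ((radial_grad x \<bullet> e) * \<phi> x)))"
  proof (rule Bochner_Integration.integral_cong[OF refl])
    fix x :: 'a
    show "indicator {x. ?T x < R} x * (w (?T x) * ((radial_volume_grad x \<bullet> e) * \<phi> x)) = - (indicator (centred_ball L) x * ((radial_grad x \<bullet> e) * \<phi> x))"
    proof (cases "?T x < R")
      case True
      then show ?thesis using R(2) by (simp add: ball_eq radial_grad_def)
    next
      case False
      then show ?thesis by (simp only: out(1)[OF False] mult_zero_right minus_zero)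
    qed
  qed
  finally show ?thesis by simp
qed

lemma is_weak_gradient_radial: "is_weak_gradient (centred_ball L) v radial_grad"
  unfolding is_weak_gradient_def
proof (intro conjI allI impI ballI)
  have Bb: "(centred_ball L :: 'a set) \<in> sets borel" using open_ball_L by simp
  show "locally_integrable_on v (centred_ball L)" "locally_integrable_on radial_grad (centred_ball L)"
    by (rule square_integrable_imp_locally_integrable, rule square_integrable_v square_integrable_G; assumption)+
  fix \<phi> :: "'a \<Rightarrow> real" and i :: 'a assume \<phi>: "C1c (centred_ball L) \<phi>"
  note [measurable] = C1c_borel(1)[OF \<phi>] C1c_borel(2)[OF \<phi>, of i]
  have 1: "integral\<^sup>L (lebesgue_on (centred_ball L)) (\<lambda>x. v x * frechet_derivative \<phi> (at x) i)
      = (LBINT x. indicator (centred_ball L) x *\<^sub>R (v_borel x * frechet_derivative \<phi> (at x) i))"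
    by (rule lebesgue_on_borel(3)[OF Bb]) (simp_all add: v_eq_v_borel)
  have 2: "integral\<^sup>L (lebesgue_on (centred_ball L)) (\<lambda>x. (radial_grad x \<bullet> i) * \<phi> x)
      = (LBINT x. indicator (centred_ball L) x *\<^sub>R ((radial_grad x \<bullet> i) * \<phi> x))"
    by (rule lebesgue_on_borel(3)[OF Bb]) simp_all
  show "integral\<^sup>L (lebesgue_on (centred_ball L)) (\<lambda>x. v x * frechet_derivative \<phi> (at x) i)
      = - integral\<^sup>L (lebesgue_on (centred_ball L)) (\<lambda>x. (radial_grad x \<bullet> i) * \<phi> x)"
    unfolding 1 2 using radial_integration_by_parts[OF \<phi>, of i] by simp
qed

lemma H12_loc_radial: "v \<in> H12_loc (centred_ball L)"
  unfolding H12_loc_def using is_weak_gradient_radial square_integrable_v square_integrable_G by blast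

end

section \<open>The comparison theorem\<close>

text \<open>
  The source of the constant \<open>c(\<epsilon>)\<close>: for \<open>R = L - \<epsilon>\<close> the maximum is \<open>(L - \<epsilon>) / \<epsilon>\<close> if \<open>\<epsilon> \<le> L / 2\<close>, and 1 otherwise.
\<close>

lemma powr_ratio_bound:
  assumes s: "0 < s" "s < R" and R: "R < L" and \<beta>: "\<beta> \<ge> (0::real)"
  shows "s powr \<beta> \<le> max 1 (R / (L - R)) powr \<beta> * min s (L - s) powr \<beta>"
proof -
  have LR: "L - R > 0" using R by simp
  have m0: "0 < min s (L - s)" using s R by auto
  have "s \<le> max 1 (R / (L - R)) * min s (L - s)"
  proof (cases "s \<le> L - s")
    case True
    then have "min s (L - s) = s" by simp
    moreover have "1 * s \<le> max 1 (R / (L - R)) * s" using s by (intro mult_right_mono) auto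
    ultimately show ?thesis by simp
  next
    case False
    have "s \<le> R" using s by simp
    also have "R = R / (L - R) * (L - R)" using LR by simp
    also have "\<dots> \<le> max 1 (R / (L - R)) * (L - s)" using s LR by (intro mult_mono) auto
    finally show ?thesis using False by (simp add: min_def)
  qed
  then have "s powr \<beta> \<le> (max 1 (R / (L - R)) * min s (L - s)) powr \<beta>" using s \<beta> by (intro powr_mono2) auto
  also have "\<dots> = max 1 (R / (L - R)) powr \<beta> * min s (L - s) powr \<beta>" by (rule powr_mult)
  finally show ?thesis .
qed

theorem theorem2p1:
  fixes \<Omega> :: "'a::euclidean_space set" and Q :: real and u :: "'a \<Rightarrow> real"
  assumes "DIM('a) \<ge> 2"
    and "bounded_lipschitz_domain \<Omega>"
    and "Q > 0"
    and "\<And>E. E \<in> sets lebesgue \<Longrightarrow> E \<subseteq> \<Omega> \<Longrightarrow>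
           ereal Q * perimeter \<Omega> E \<ge>
           ereal (min (measure lebesgue E) (measure lebesgue (\<Omega> - E)) powr (1 - 1 / DIM('a)))"
    and "u \<in> H12 \<Omega>"
  shows "schwarz_symm \<Omega> u \<in> H12_loc (centred_ball (measure lebesgue \<Omega>))
    \<and> (\<forall>\<epsilon>. 0 < \<epsilon> \<and> \<epsilon> < measure lebesgue \<Omega> \<longrightarrow>
         (\<integral>\<^sup>+x. ennreal ((norm (weak_gradient (centred_ball (measure lebesgue \<Omega>))
                                    (schwarz_symm \<Omega> u) x))\<^sup>2)
             \<partial>lebesgue_on (centred_ball (measure lebesgue \<Omega> - \<epsilon>)))
         \<le> ennreal ((if \<epsilon> \<le> measure lebesgue \<Omega> / 2
                      then ((measure lebesgue \<Omega> - \<epsilon>) / \<epsilon>) powr (2 - 2 / DIM('a))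
                      else 1)
                     * (Q * DIM('a) * measure lebesgue (ball (0::'a) 1) powr (1 / DIM('a)))\<^sup>2)
           * (\<integral>\<^sup>+x. ennreal ((norm (weak_gradient \<Omega> u x))\<^sup>2) \<partial>lebesgue_on \<Omega>))
    \<and> (\<forall>\<epsilon>. 0 < \<epsilon> \<and> \<epsilon> < measure lebesgue \<Omega> / 2 \<longrightarrow>
         absolutely_continuous_on {\<epsilon><..<measure lebesgue \<Omega> - \<epsilon>} (decr_rearrangement \<Omega> u))"
proof -
  have op: "open \<Omega>" and bd: "bounded \<Omega>" and ne: "\<Omega> \<noteq> {}"
    using assms(2) by (auto simp: bounded_lipschitz_domain_def)
  have Ob: "\<Omega> \<in> sets borel" using op by simp
  have fin: "emeasure lborel \<Omega> < \<infinity>" by (rule emeasure_bounded_finite[OF bd])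
  have lm: "\<Omega> \<in> lmeasurable" using bd op by (rule lmeasurable_open)
  have fm: "finite_measure (lebesgue_on \<Omega>)" by (rule finite_measure_lebesgue_on[OF lm])
  have mOm: "measure lebesgue \<Omega> = measure lborel \<Omega>" by (rule measure_completion) (use Ob in simp)
  have "measure lebesgue \<Omega> > 0"
  proof -
    obtain a r where "r > 0" "ball a r \<subseteq> \<Omega>" using op ne openE by blast
    then have "measure lebesgue (ball a r) \<le> measure lebesgue \<Omega>" by (intro measure_mono_fmeasurable lm) auto
    moreover have "measure lebesgue (ball a r) > 0" using \<open>r > 0\<close> by (simp add: content_ball)
    ultimately show ?thesis by linarith
  qed
  note Lpos = this
  define \<beta> where "\<beta> = 1 - 1 / real DIM('a)"
  have \<beta>0: "\<beta> \<ge> 0" using assms(1) by (simp add: \<beta>_def)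
  obtain g1 where g1: "is_weak_gradient \<Omega> u g1" "square_integrable_on g1 \<Omega>" and usq: "square_integrable_on u \<Omega>"
    using assms(5) by (auto simp: H12_def)
  have um: "u \<in> borel_measurable (lebesgue_on \<Omega>)" and gm: "g1 \<in> borel_measurable (lebesgue_on \<Omega>)"
    using usq g1(2) by (auto simp: square_integrable_on_def)
  have ui: "integrable (lebesgue_on \<Omega>) u" and gi: "integrable (lebesgue_on \<Omega>) g1"
    using usq g1(2) integrable_of_square[OF fm um] integrable_of_square[OF fm gm] unfolding square_integrable_on_def by blast+
  obtain u0 where u0: "u0 \<in> borel_measurable borel" "\<forall>x. x \<notin> \<Omega> \<longrightarrow> u0 x = 0" "AE x in lborel. x \<in> \<Omega> \<longrightarrow> u x = u0 x"
    by (rule lebesgue_on_representative[OF Ob um])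
  obtain g where g: "g \<in> borel_measurable borel" "\<forall>x. x \<notin> \<Omega> \<longrightarrow> g x = 0" "AE x in lborel. x \<in> \<Omega> \<longrightarrow> g1 x = g x"
    by (rule lebesgue_on_representative[OF Ob gm])
  have uae: "AE x in lebesgue_on \<Omega>. u x = u0 x" using u0(3) by (simp only: AE_lebesgue_on_iff[OF Ob])
  have gae: "AE x in lebesgue_on \<Omega>. g1 x = g x" using g(3) by (simp only: AE_lebesgue_on_iff[OF Ob])
  have u0m: "u0 \<in> borel_measurable (lebesgue_on \<Omega>)" by (rule lebesgue_on_borel(1)[OF Ob u0(1)]) simp
  have g0m: "g \<in> borel_measurable (lebesgue_on \<Omega>)" by (rule lebesgue_on_borel(1)[OF Ob g(1)]) simp
  have u0ind: "(\<lambda>x. indicator \<Omega> x *\<^sub>R u0 x) = u0" using u0(2) by (auto simp: indicator_def fun_eq_iff)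
  have gind: "(\<lambda>x. indicator \<Omega> x *\<^sub>R g x) = g" using g(2) by (auto simp: indicator_def fun_eq_iff)
  have u0i: "integrable lborel u0"
    using integrable_cong_AE[OF um u0m uae] ui lebesgue_on_borel(2)[OF Ob u0(1), of u0] unfolding u0ind by simp
  have g0i: "integrable lborel g"
    using integrable_cong_AE[OF gm g0m gae] gi lebesgue_on_borel(2)[OF Ob g(1), of g] unfolding gind by simp
  have u0sq: "(\<integral>\<^sup>+x. ennreal ((u0 x)\<^sup>2) * indicator \<Omega> x \<partial>lborel) < \<infinity>"
  proof -
    have "(\<integral>\<^sup>+x. ennreal ((u0 x)\<^sup>2) * indicator \<Omega> x \<partial>lborel) = (\<integral>\<^sup>+x. ennreal ((u0 x)\<^sup>2) \<partial>lebesgue_on \<Omega>)"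
      by (rule nn_integral_lebesgue_on_borel[OF Ob, symmetric]) (use u0(1) in measurable)
    also have "\<dots> = (\<integral>\<^sup>+x. ennreal ((norm (u x))\<^sup>2) \<partial>lebesgue_on \<Omega>)"
      using uae by (intro nn_integral_cong_AE) (auto elim!: eventually_mono)
    also have "\<dots> < \<infinity>" using usq by (auto simp: square_integrable_on_def integrable_iff_bounded)
    finally show ?thesis .
  qed
  have gsq_eq: "(\<integral>\<^sup>+x. ennreal ((norm (g x))\<^sup>2) \<partial>lborel) = (\<integral>\<^sup>+x. ennreal ((norm (g1 x))\<^sup>2) \<partial>lebesgue_on \<Omega>)"
  proof -
    have "(\<integral>\<^sup>+x. ennreal ((norm (g x))\<^sup>2) \<partial>lborel) = (\<integral>\<^sup>+x. ennreal ((norm (g x))\<^sup>2) * indicator \<Omega> x \<partial>lborel)"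
      using g(2) by (intro nn_integral_cong) (auto simp: indicator_def)
    also have "\<dots> = (\<integral>\<^sup>+x. ennreal ((norm (g x))\<^sup>2) \<partial>lebesgue_on \<Omega>)"
      by (rule nn_integral_lebesgue_on_borel[OF Ob, symmetric]) (use g(1) in measurable)
    also have "\<dots> = (\<integral>\<^sup>+x. ennreal ((norm (g1 x))\<^sup>2) \<partial>lebesgue_on \<Omega>)"
      using gae by (intro nn_integral_cong_AE) (auto elim!: eventually_mono)
    finally show ?thesis .
  qed
  have gsq: "integrable lborel (\<lambda>x. (norm (g x))\<^sup>2)"
  proof (rule integrableI_nonneg)
    show "(\<integral>\<^sup>+x. ennreal ((norm (g x))\<^sup>2) \<partial>lborel) < \<infinity>"
      unfolding gsq_eq using g1(2) by (auto simp: square_integrable_on_def integrable_iff_bounded)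
  qed (use g(1) in auto)
  have mu_eq0: "distribution_fun \<Omega> u = distribution_fun \<Omega> u0"
  proof
    fix t
    have "{x \<in> \<Omega>. u x > t} \<in> sets (lebesgue_on \<Omega>)"
      using measurable_sets[OF um, of "{t<..}"] by (simp add: vimage_def Int_def conj_commute)
    then have 1: "{x \<in> \<Omega>. u x > t} \<in> sets lebesgue" using Ob by (simp add: sets_restrict_space_iff)
    have "{x \<in> \<Omega>. u0 x > t} \<in> sets borel" using Ob u0(1) by measurable
    then have 2: "{x \<in> \<Omega>. u0 x > t} \<in> sets lebesgue" by simp
    have "AE x in lebesgue. (x \<in> {x \<in> \<Omega>. u x > t}) = (x \<in> {x \<in> \<Omega>. u0 x > t})"
      using AE_completion[OF u0(3)] by eventually_elim auto
    from measure_eq_AE[OF this 1 2] show "distribution_fun \<Omega> u t = distribution_fun \<Omega> u0 t"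
      by (simp add: distribution_fun_def)
  qed
  have ust: "decr_rearrangement \<Omega> u = decr_rearrangement \<Omega> u0" by (simp add: decr_rearrangement_def[abs_def] mu_eq0)
  (* From here on ustar and mu refer to the Borel representative u0; they coincide with those of u. *)
  interpret distribution \<Omega> u0 by unfold_locales (use Ob u0(1) fin in auto)
  have LL: "measure lebesgue \<Omega> = L" by (simp add: L_def mOm)
  interpret isoperimetric_sobolev \<Omega> u0 g Q
  proof unfold_locales
    show "open \<Omega>" by fact
    show "integrable lborel u0" "integrable lborel g" "integrable lborel (\<lambda>x. (norm (g x))\<^sup>2)" "Q > 0" by fact+
    show "g x = 0" if "x \<notin> \<Omega>" for x using g(2) that by blast
    show "weak_partial \<Omega> u0 (\<lambda>x. g x \<bullet> i) i" if i: "i \<in> Basis" for i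
      unfolding weak_partial_def
    proof (intro allI impI)
      fix \<phi> :: "'a \<Rightarrow> real" assume \<phi>: "C1c \<Omega> \<phi>"
      note [measurable] = C1c_borel(1)[OF \<phi>] C1c_borel(2)[OF \<phi>, of i] u0(1) g(1)
      have mD: "(\<lambda>x. frechet_derivative \<phi> (at x) i) \<in> borel_measurable (lebesgue_on \<Omega>)"
        by (rule lebesgue_on_borel(1)[OF Ob C1c_borel(2)[OF \<phi>]]) simp
      have m\<phi>: "\<phi> \<in> borel_measurable (lebesgue_on \<Omega>)" by (rule lebesgue_on_borel(1)[OF Ob C1c_borel(1)[OF \<phi>]]) simp
      have "(LBINT x. u0 x * frechet_derivative \<phi> (at x) i) = (LBINT x. indicator \<Omega> x *\<^sub>R (u0 x * frechet_derivative \<phi> (at x) i))"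
        using u0(2) by (intro Bochner_Integration.integral_cong) (auto simp: indicator_def)
      also have "\<dots> = integral\<^sup>L (lebesgue_on \<Omega>) (\<lambda>x. u0 x * frechet_derivative \<phi> (at x) i)"
        by (rule lebesgue_on_borel(3)[OF Ob, symmetric]) simp_all
      also have "\<dots> = integral\<^sup>L (lebesgue_on \<Omega>) (\<lambda>x. u x * frechet_derivative \<phi> (at x) i)"
      proof (rule integral_cong_AE)
        show "AE x in lebesgue_on \<Omega>. u0 x * frechet_derivative \<phi> (at x) i = u x * frechet_derivative \<phi> (at x) i"
          using uae by eventually_elim (simp only:)
      qed (use u0m um mD in \<open>auto intro!: borel_measurable_times\<close>)
      also have "\<dots> = - integral\<^sup>L (lebesgue_on \<Omega>) (\<lambda>x. (g1 x \<bullet> i) * \<phi> x)"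
        using g1(1) \<phi> i unfolding is_weak_gradient_def by blast
      also have "integral\<^sup>L (lebesgue_on \<Omega>) (\<lambda>x. (g1 x \<bullet> i) * \<phi> x) = integral\<^sup>L (lebesgue_on \<Omega>) (\<lambda>x. (g x \<bullet> i) * \<phi> x)"
      proof (rule integral_cong_AE)
        show "AE x in lebesgue_on \<Omega>. (g1 x \<bullet> i) * \<phi> x = (g x \<bullet> i) * \<phi> x"
          using gae by eventually_elim (simp only:)
      qed (use g0m gm m\<phi> in \<open>auto intro!: borel_measurable_times borel_measurable_inner\<close>)
      also have "\<dots> = (LBINT x. indicator \<Omega> x *\<^sub>R ((g x \<bullet> i) * \<phi> x))"
        by (rule lebesgue_on_borel(3)[OF Ob]) simp_all
      also have "\<dots> = (LBINT x. (g x \<bullet> i) * \<phi> x)"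
        using g(2) by (intro Bochner_Integration.integral_cong) (auto simp: indicator_def)
      finally show "(LBINT x. u0 x * frechet_derivative \<phi> (at x) i) = - (LBINT x. (g x \<bullet> i) * \<phi> x)" .
    qed
    show "ereal (min (mu t) (L - mu t) powr (1 - 1 / DIM('a))) \<le> ereal Q * perimeter \<Omega> {x \<in> \<Omega>. u0 x > t}" for t
    proof -
      let ?E = "{x \<in> \<Omega>. u0 x > t}"
      have Eb: "?E \<in> sets borel" using Ob u0(1) by measurable
      have E: "?E \<in> lmeasurable" by (rule fmeasurableI2[OF lm]) (use Eb in auto)
      have "measure lebesgue (\<Omega> - ?E) = L - mu t"
        using measurable_measure_Diff[OF lm, of ?E] Eb by (simp add: LL distribution_fun_def)
      then show ?thesis using assms(4)[of ?E] Eb by (simp add: distribution_fun_def)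
    qed
  qed
  have Lp: "0 < L" using Lpos LL by simp
  obtain w where w: "w \<in> borel_measurable borel" "\<forall>s. w s \<ge> 0"
    "\<forall>s1 s2. 0 < s1 \<longrightarrow> s1 \<le> s2 \<longrightarrow> s2 < L \<longrightarrow>
      ennreal (ustar s1 - ustar s2) = (\<integral>\<^sup>+s. ennreal (w s) * indicator {s1<..s2} s \<partial>lborel)"
    "(\<integral>\<^sup>+s. ennreal ((w s * psi s)\<^sup>2) * indicator {0<..<L} s \<partial>lborel) \<le> ennreal (Q\<^sup>2 * energy)"
    by (rule rearrangement_density[OF Lp])
  note [measurable] = w(1)
  have wR: "(\<integral>\<^sup>+s. ennreal ((w s * s powr (1 - 1 / DIM('a)))\<^sup>2) * indicator {0<..<R} s \<partial>lborel)
      \<le> ennreal ((max 1 (R / (L - R)) powr \<beta>)\<^sup>2) * ennreal (Q\<^sup>2 * energy)" if R: "R < L" for R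
  proof -
    let ?k = "max 1 (R / (L - R)) powr \<beta>"
    have "(\<integral>\<^sup>+s. ennreal ((w s * s powr (1 - 1 / DIM('a)))\<^sup>2) * indicator {0<..<R} s \<partial>lborel)
       \<le> (\<integral>\<^sup>+s. ennreal (?k\<^sup>2) * (ennreal ((w s * psi s)\<^sup>2) * indicator {0<..<L} s) \<partial>lborel)"
    proof (rule nn_integral_mono)
      fix s
      show "ennreal ((w s * s powr (1 - 1 / DIM('a)))\<^sup>2) * indicator {0<..<R} s \<le> ennreal (?k\<^sup>2) * (ennreal ((w s * psi s)\<^sup>2) * indicator {0<..<L} s)"
      proof (cases "s \<in> {0<..<R}")
        case True
        then have "s powr \<beta> \<le> ?k * psi s"
          using powr_ratio_bound[of s R L \<beta>] R \<beta>0 by (simp add: psi_def \<beta>_def)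
        then have "w s * s powr \<beta> \<le> ?k * (w s * psi s)" using w(2) by (simp add: mult_left_mono mult.left_commute)
        then have "(w s * s powr \<beta>)\<^sup>2 \<le> (?k * (w s * psi s))\<^sup>2" using w(2) by (intro power_mono) auto
        also have "\<dots> = ?k\<^sup>2 * (w s * psi s)\<^sup>2" by (rule power_mult_distrib)
        finally have "ennreal ((w s * s powr \<beta>)\<^sup>2) \<le> ennreal (?k\<^sup>2) * ennreal ((w s * psi s)\<^sup>2)"
          by (simp add: ennreal_mult[symmetric] ennreal_leI)
        then show ?thesis using True R by (simp add: \<beta>_def)
      qed simp
    qed
    also have "\<dots> = ennreal (?k\<^sup>2) * (\<integral>\<^sup>+s. ennreal ((w s * psi s)\<^sup>2) * indicator {0<..<L} s \<partial>lborel)"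
      by (rule nn_integral_cmult) measurable
    also have "\<dots> \<le> ennreal (?k\<^sup>2) * ennreal (Q\<^sup>2 * energy)" by (intro mult_left_mono w(4)) simp
    finally show ?thesis .
  qed
  interpret rad: radial_profile ustar w L "schwarz_symm \<Omega> u"
  proof unfold_locales
    show "schwarz_symm \<Omega> u x = ustar (radial_volume x)" for x by (simp add: schwarz_symm_def radial_volume_def ust)
    show "DIM('a) \<ge> 2" "L > 0" "w \<in> borel_measurable borel" by fact+
    show "w s \<ge> 0" for s using w(2) by blast
    show "ustar s2 \<le> ustar s1 \<and> ennreal (ustar s1 - ustar s2) = (\<integral>\<^sup>+s. ennreal (w s) * indicator {s1<..s2} s \<partial>lborel)"
      if "0 < s1" "s1 \<le> s2" "s2 < L" for s1 s2
      using w(3) rearrangement_antimono that by blast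
    show "(\<lambda>s. indicator {0<..<L} s * ustar s) \<in> borel_measurable borel" by (rule measurable_rearrangement)
    show "(\<integral>\<^sup>+s. ennreal ((ustar s)\<^sup>2) * indicator {0<..<L} s \<partial>lborel) < \<infinity>"
      using rearrangement_equimeasurable[of "\<lambda>y. ennreal (y\<^sup>2)"] u0sq by simp
    show "(\<integral>\<^sup>+s. ennreal ((w s * s powr (1 - 1 / DIM('a)))\<^sup>2) * indicator {0<..<R} s \<partial>lborel) < \<infinity>" if "R < L" for R
      using wR[OF that] by (rule order.strict_trans1) (simp add: ennreal_mult_less_top)
  qed
  have wgO: "is_weak_gradient \<Omega> u (weak_gradient \<Omega> u)" unfolding weak_gradient_def by (rule someI[of "is_weak_gradient \<Omega> u", OF g1(1)])
  have wgB: "is_weak_gradient (centred_ball L) (schwarz_symm \<Omega> u) (weak_gradient (centred_ball L) (schwarz_symm \<Omega> u))"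
    unfolding weak_gradient_def by (rule someI[of "is_weak_gradient (centred_ball L) (schwarz_symm \<Omega> u)", OF rad.is_weak_gradient_radial])
  have energy: "ennreal energy = (\<integral>\<^sup>+x. ennreal ((norm (weak_gradient \<Omega> u x))\<^sup>2) \<partial>lebesgue_on \<Omega>)"
  proof -
    have "ennreal energy = (\<integral>\<^sup>+x. ennreal ((norm (g x))\<^sup>2) \<partial>lborel)"
      unfolding energy_def using gsq by (intro nn_integral_eq_integral[symmetric]) auto
    also have "\<dots> = (\<integral>\<^sup>+x. ennreal ((norm (g1 x))\<^sup>2) \<partial>lebesgue_on \<Omega>)" by (rule gsq_eq)
    also have "\<dots> = (\<integral>\<^sup>+x. ennreal ((norm (weak_gradient \<Omega> u x))\<^sup>2) \<partial>lebesgue_on \<Omega>)"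
    proof (rule nn_integral_cong_AE)
      have "AE x in lebesgue_on \<Omega>. g1 x = weak_gradient \<Omega> u x"
        using weak_gradient_unique[OF op g1(1) wgO] by (simp only: AE_lebesgue_on_iff[OF Ob])
      then show "AE x in lebesgue_on \<Omega>. ennreal ((norm (g1 x))\<^sup>2) = ennreal ((norm (weak_gradient \<Omega> u x))\<^sup>2)"
        by eventually_elim (simp only:)
    qed
    finally show ?thesis .
  qed
  have part2: "(\<integral>\<^sup>+x. ennreal ((norm (weak_gradient (centred_ball L) (schwarz_symm \<Omega> u) x))\<^sup>2) \<partial>lebesgue_on (centred_ball (L - \<epsilon>)))
      \<le> ennreal ((if \<epsilon> \<le> L / 2 then ((L - \<epsilon>) / \<epsilon>) powr (2 - 2 / DIM('a)) else 1)
                  * (Q * DIM('a) * measure lebesgue (ball (0::'a) 1) powr (1 / DIM('a)))\<^sup>2)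
         * (\<integral>\<^sup>+x. ennreal ((norm (weak_gradient \<Omega> u x))\<^sup>2) \<partial>lebesgue_on \<Omega>)"
    if \<epsilon>: "0 < \<epsilon>" "\<epsilon> < L" for \<epsilon>
  proof -
    let ?B = "centred_ball (L - \<epsilon>) :: 'a set" and ?A = "real DIM('a) * measure lebesgue (ball (0::'a) 1) powr (1 / DIM('a))"
    let ?c = "if \<epsilon> \<le> L / 2 then ((L - \<epsilon>) / \<epsilon>) powr (2 - 2 / DIM('a)) else 1"
    have Beq: "?B = {x. radial_volume x < L - \<epsilon>}" using \<epsilon> by (intro centred_ball_eq) simp
    have Bb: "?B \<in> sets borel" unfolding Beq by measurable
    have sub: "?B \<subseteq> centred_ball L" unfolding Beq rad.ball_eq using \<epsilon> by auto
    have c: "(max 1 ((L - \<epsilon>) / (L - (L - \<epsilon>))) powr \<beta>)\<^sup>2 = ?c"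
    proof (cases "\<epsilon> \<le> L / 2")
      case True
      then have "1 \<le> (L - \<epsilon>) / \<epsilon>" using \<epsilon> by (simp add: le_divide_eq)
      moreover have "(z powr \<beta>)\<^sup>2 = z powr (2 - 2 / DIM('a))" if "z \<ge> 1" for z
        using that by (simp add: power2_eq_square powr_add[symmetric] \<beta>_def)
      ultimately show ?thesis using True by (simp add: max_def)
    next
      case False
      then have "(L - \<epsilon>) / \<epsilon> \<le> 1" using \<epsilon> by (simp add: divide_le_eq)
      then show ?thesis using False by (simp add: max_def)
    qed
    have "(\<integral>\<^sup>+x. ennreal ((norm (weak_gradient (centred_ball L) (schwarz_symm \<Omega> u) x))\<^sup>2) \<partial>lebesgue_on ?B)
        = (\<integral>\<^sup>+x. ennreal ((norm (rad.radial_grad x))\<^sup>2) \<partial>lebesgue_on ?B)"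
    proof (rule nn_integral_cong_AE)
      have "AE x in lborel. x \<in> ?B \<longrightarrow> weak_gradient (centred_ball L) (schwarz_symm \<Omega> u) x = rad.radial_grad x"
        using weak_gradient_unique[OF rad.open_ball_L wgB rad.is_weak_gradient_radial] by eventually_elim (use sub in blast)
      then have "AE x in lebesgue_on ?B. weak_gradient (centred_ball L) (schwarz_symm \<Omega> u) x = rad.radial_grad x"
        by (simp only: AE_lebesgue_on_iff[OF Bb])
      then show "AE x in lebesgue_on ?B. ennreal ((norm (weak_gradient (centred_ball L) (schwarz_symm \<Omega> u) x))\<^sup>2) = ennreal ((norm (rad.radial_grad x))\<^sup>2)"
        by eventually_elim (simp only:)
    qed
    also have "\<dots> = (\<integral>\<^sup>+x. ennreal ((norm (rad.radial_grad x))\<^sup>2) * indicator ?B x \<partial>lborel)"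
      by (rule nn_integral_lebesgue_on_borel[OF Bb]) measurable
    also have "\<dots> = ennreal (?A\<^sup>2) * (\<integral>\<^sup>+s. ennreal ((w s * s powr (1 - 1 / DIM('a)))\<^sup>2) * indicator {0<..<L - \<epsilon>} s \<partial>lborel)"
      unfolding Beq by (rule rad.gradient_energy)
    also have "\<dots> \<le> ennreal (?A\<^sup>2) * (ennreal ?c * ennreal (Q\<^sup>2 * energy))"
      using wR[of "L - \<epsilon>"] \<epsilon> unfolding c by (intro mult_left_mono) auto
    also have "\<dots> = ennreal (?c * (Q * DIM('a) * measure lebesgue (ball (0::'a) 1) powr (1 / DIM('a)))\<^sup>2) * ennreal energy"
    proof -
      have "?c \<ge> 0" by simp
      then show ?thesis using energy_nonneg by (simp add: ennreal_mult[symmetric] power_mult_distrib mult_ac del: ennreal_1)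
    qed
    finally show ?thesis unfolding energy .
  qed
  have part3: "absolutely_continuous_on {\<epsilon><..<L - \<epsilon>} ustar" if \<epsilon>: "0 < \<epsilon>" "\<epsilon> < L / 2" for \<epsilon>
  proof (rule absolutely_continuous_on_square_integrable_density[OF w(1)])
    let ?m = "\<epsilon> powr \<beta>"
    have m: "?m > 0" using \<epsilon> by simp
    show "w s \<ge> 0" for s using w(2) by blast
    show "ustar s2 \<le> ustar s1 \<and> ennreal (ustar s1 - ustar s2) = (\<integral>\<^sup>+s. ennreal (w s) * indicator {s1<..s2} s \<partial>lborel)"
      if "\<epsilon> < s1" "s1 \<le> s2" "s2 < L - \<epsilon>" for s1 s2
    proof -
      have "0 < s1" "s2 < L" using that \<epsilon> by auto
      then show ?thesis using w(3) rearrangement_antimono that(2) by blast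
    qed
    show "0 \<le> Q\<^sup>2 * energy / ?m\<^sup>2" using energy_nonneg by simp
    have "(\<integral>\<^sup>+s. ennreal ((w s)\<^sup>2) * indicator {\<epsilon><..<L - \<epsilon>} s \<partial>lborel)
       \<le> (\<integral>\<^sup>+s. ennreal (1 / ?m\<^sup>2) * (ennreal ((w s * psi s)\<^sup>2) * indicator {0<..<L} s) \<partial>lborel)"
    proof (rule nn_integral_mono)
      fix s
      show "ennreal ((w s)\<^sup>2) * indicator {\<epsilon><..<L - \<epsilon>} s \<le> ennreal (1 / ?m\<^sup>2) * (ennreal ((w s * psi s)\<^sup>2) * indicator {0<..<L} s)"
      proof (cases "s \<in> {\<epsilon><..<L - \<epsilon>}")
        case True
        then have "?m \<le> psi s" unfolding psi_def \<beta>_def[symmetric] using \<epsilon> \<beta>0 by (intro powr_mono2) auto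
        then have "w s * ?m \<le> w s * psi s" using w(2) by (intro mult_left_mono) auto
        then have "(w s * ?m)\<^sup>2 \<le> (w s * psi s)\<^sup>2" using w(2) m by (intro power_mono) auto
        then have "(w s)\<^sup>2 \<le> 1 / ?m\<^sup>2 * (w s * psi s)\<^sup>2" using m by (simp add: power_mult_distrib pos_le_divide_eq)
        then have "ennreal ((w s)\<^sup>2) \<le> ennreal (1 / ?m\<^sup>2) * ennreal ((w s * psi s)\<^sup>2)"
          by (subst ennreal_mult[symmetric]) (auto intro: ennreal_leI)
        then show ?thesis using True \<epsilon> by simp
      qed simp
    qed
    also have "\<dots> = ennreal (1 / ?m\<^sup>2) * (\<integral>\<^sup>+s. ennreal ((w s * psi s)\<^sup>2) * indicator {0<..<L} s \<partial>lborel)"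
      by (rule nn_integral_cmult) measurable
    also have "\<dots> \<le> ennreal (1 / ?m\<^sup>2) * ennreal (Q\<^sup>2 * energy)" by (intro mult_left_mono w(4)) simp
    also have "\<dots> = ennreal (Q\<^sup>2 * energy / ?m\<^sup>2)" using energy_nonneg by (subst ennreal_mult[symmetric]) auto
    finally show "(\<integral>\<^sup>+s. ennreal ((w s)\<^sup>2) * indicator {\<epsilon><..<L - \<epsilon>} s \<partial>lborel) \<le> ennreal (Q\<^sup>2 * energy / ?m\<^sup>2)" .
  qed
  show ?thesis
    unfolding LL ust using rad.H12_loc_radial part2 part3 by blast
qed

end
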